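(* Let $d\geq 1$ and $k\geq 0$ be integers. There is a constant $C=C(d,k)$ such that for every integer $n\geq 1$ and every probability distribution $\tau$ on $S^{d-1}\times[-1,1]$ there exists a probability distribution $\tau'$ on $S^{d-1}\times[-1,1]$ supported on at most $n$ points such that for every multi-index $\alpha$ with $|\alpha|\leq k$, \[ \sup_{x\in B^d}\left|D_x^\alpha\left(\int_{S^{d-1}\times[-1,1]}\sigma_k(\omega\cdot x+b)\,d\tau(\omega,b) - \int_{S^{d-1}\times[-1,1]}\sigma_k(\omega\cdot x+b)\,d\tau'(\omega,b)\right)\right| \leq C n^{-\frac12-\frac{2(k-|\alpha|)+1}{2d}}. \]
   Context: $B^d=\{x\in\mathbb{R}^d:|x|\leq 1\}$ and $S^{d-1}$ is the unit sphere in $\mathbb{R}^d$. The ReLU$^k$ activation is $\sigma_k(t)=t^k$ for $t\geq 0$ and $\sigma_k(t)=0$ for $t<0$, with the convention $0^0=1$ (so $\sigma_0$ is the Heaviside function). $D_x^\alpha$ denotes the $\alpha$-th order partial derivative with respect to $x$; for a single atom, $D_x^\alpha\sigma_k(\omega\cdot x+b)$ is understood as $\frac{k!}{(k-|\alpha|)!}(\omega\cdot x+b)^{k-|\alpha|}\omega^\alpha$ when $\omega\cdot x+b\geq 0$ and $0$ otherwise. *)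

theory Defs
  imports "HOL-Probability.Probability"
begin

text \<open>ReLU^k activation, with the convention 0^0 = 1 (Isabelle's power already satisfies this).\<close>
definition relu_pow :: "nat \<Rightarrow> real \<Rightarrow> real" where
  "relu_pow k t = (if t \<ge> 0 then t ^ k else 0)"

definition mi_order :: "('d::finite \<Rightarrow> nat) \<Rightarrow> nat" where
  "mi_order \<alpha> = (\<Sum>i\<in>UNIV. \<alpha> i)"

definition mi_pow :: "real^'d::finite \<Rightarrow> ('d \<Rightarrow> nat) \<Rightarrow> real" where
  "mi_pow w \<alpha> = (\<Prod>i\<in>UNIV. (w $ i) ^ (\<alpha> i))"

definition atom_deriv :: "nat \<Rightarrow> ('d::finite \<Rightarrow> nat) \<Rightarrow> (real^'d) \<Rightarrow> ((real^'d) \<times> real) \<Rightarrow> real" where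
  "atom_deriv k \<alpha> x wb =
     (let t = fst wb \<bullet> x + snd wb in
      if t \<ge> 0 then fact k / fact (k - mi_order \<alpha>) * t ^ (k - mi_order \<alpha>) * mi_pow (fst wb) \<alpha>
      else 0)"

definition param_dom :: "((real^'d::finite) \<times> real) set" where
  "param_dom = sphere 0 1 \<times> {-1..1}"

definition prob_on_dom :: "((real^'d::finite) \<times> real) measure \<Rightarrow> bool" where
  "prob_on_dom \<tau> \<longleftrightarrow> prob_space \<tau> \<and> sets \<tau> = sets borel \<and> emeasure \<tau> (UNIV - param_dom) = 0"

end

theory Submission
  imports Defs
begin

text \<open>Halfspaces of \<open>\<real>\<^sup>d\<close> have VC dimension \<open>d\<close> in the parameter \<open>x\<close>, so by Haussler's packing bound \<open>M\<close> given points
  of the parameter domain admit a net of \<open>O(\<delta>\<^sup>-\<^sup>d)\<close> points \<open>x'\<close> such that every \<open>x\<close> is within \<open>O(\<delta>)\<close> of some \<open>x'\<close> from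
  which it is separated by at most \<open>\<delta> M\<close> of the hyperplanes \<open>\<omega> \<bullet> x + b = 0\<close>. Given a measure with \<open>m\<close> atoms, a partial
  colouring of the light atoms is chosen that makes all derivatives vanish exactly on a net of scale
  \<open>\<delta> \<approx> m\<^sup>-\<^sup>1\<^sup>/\<^sup>d\<close> (a small fraction of \<open>m\<close> linear constraints) and that nearly balances the Taylor remainders
  between the nets of scales \<open>\<delta>, \<delta>/2, \<delta>/4, \<dots>\<close>. A remainder involves only the atoms whose hyperplane separates the two
  points, and the sum over all scales loses no logarithm. Perturbing the weights along the colouring kills a fixed
  fraction of the atoms, and the errors of the iterated reductions form a geometric series. The initial
  passage from an arbitrary measure to a finitely supported one uses finite brackets for halfspaces.\<close>

section \<open>Orthonormal families\<close>

text \<open>The exponent comes from a count at one scale. With m atoms of weight about 1/m, two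
  points at scale \<delta> are separated by at most about \<delta> m of them, and each Taylor
  remainder of degree j = k - |\<alpha>| has size at most about \<delta>^j / m. The Euclidean norm
  of the remainder vector is thus about sqrt (\<delta>/m) \<delta>^j, which for \<delta> = m^(-1/d)
  is the claimed rate. A union bound over independent signs would lose a logarithm, because the
  coarsest net already has of the order of m points. Turning the conditions there into exact
  equations avoids this, at the price of colouring only a fixed fraction of the atoms. At level l
  there are about 2^(l d) m conditions whose vectors are shorter by 2^(-l/2); an allowance growing
  linearly in l makes them affordable, and l 2^(-l/2) is summable. All orders up to k are treated
  together, since expanding one derivative around a net point uses all higher ones. The first
  discretization may use any number of atoms, because the error bound of the reductions is
  independent of it.\<close>

text \<open>Gaussian elimination: \<open>v0 i0\<close> is the pivot, \<open>el\<close> clears the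
  variable \<open>i0\<close> from the other forms, and a solution of the smaller system is extended
  by solving \<open>v0\<close> for \<open>i0\<close>.\<close>

lemma homogeneous_system_nontrivial:
  fixes V :: "('a \<Rightarrow> real) set"
  assumes "finite V" "finite I" "card V < card I"
  shows "\<exists>y. (\<exists>i\<in>I. y i \<noteq> 0) \<and> (\<forall>v\<in>V. (\<Sum>i\<in>I. v i * y i) = 0)"
  using assms
proof (induction "card I" arbitrary: V I rule: less_induct)
  case less
  show ?case
  proof (cases "\<exists>v\<in>V. \<exists>i\<in>I. v i \<noteq> 0")
    case False
    moreover obtain i where "i \<in> I" using less by fastforce
    ultimately show ?thesis by (intro exI[of _ "\<lambda>_. 1"]) auto
  next
    case True
    then obtain v0 i0 where v0: "v0 \<in> V" "i0 \<in> I" "v0 i0 \<noteq> 0" by blast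
    define I' where "I' = I - {i0}"
    define el where "el = (\<lambda>(v::'a \<Rightarrow> real) i. v i - v i0 * v0 i / v0 i0)"
    define W where "W = el ` (V - {v0})"
    have I': "finite I'" "i0 \<notin> I'" "I = insert i0 I'"
      using less.prems v0 by (auto simp: I'_def)
    have cI': "card I' < card I" "card I' = card I - 1"
      using card_Diff1_less[OF less.prems(2) v0(2)] less.prems v0 by (auto simp: I'_def)
    have cV: "card (V - {v0}) < card V" "finite V"
      using card_Diff1_less[OF less.prems(1) v0(1)] less.prems(1) by auto
    have "card W \<le> card (V - {v0})" unfolding W_def using cV by (intro card_image_le) auto
    then have cW: "card W < card I'" using cV less.prems cI'(2) by linarith
    have fW: "finite W" using cV(2) by (simp add: W_def)
    from less.hyps[OF cI'(1) fW I'(1) cW]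
    obtain y where y: "\<exists>i\<in>I'. y i \<noteq> 0" "\<forall>v\<in>W. (\<Sum>i\<in>I'. v i * y i) = 0"
      by (elim exE conjE)
    define z where "z = y(i0 := - (\<Sum>i\<in>I'. v0 i * y i) / v0 i0)"
    have z_sum: "(\<Sum>i\<in>I. v i * z i) = v i0 * z i0 + (\<Sum>i\<in>I'. v i * y i)" for v
    proof -
      have "(\<Sum>i\<in>I'. v i * z i) = (\<Sum>i\<in>I'. v i * y i)"
        using I' by (intro sum.cong) (auto simp: z_def)
      then show ?thesis using I' by simp
    qed
    have "(\<Sum>i\<in>I. v i * z i) = 0" if v: "v \<in> V" for v
    proof (cases "v = v0")
      case True
      then show ?thesis using v0 unfolding z_sum by (simp add: z_def)
    next
      case False
      then have "(\<Sum>i\<in>I'. el v i * y i) = 0" using v by (intro y(2)[rule_format]) (auto simp: W_def)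
      also have "(\<Sum>i\<in>I'. el v i * y i) = (\<Sum>i\<in>I'. v i * y i) - v i0 / v0 i0 * (\<Sum>i\<in>I'. v0 i * y i)"
        by (simp add: el_def sum_distrib_left algebra_simps sum_subtractf)
      finally show ?thesis unfolding z_sum by (simp add: z_def)
    qed
    moreover have "\<exists>i\<in>I. z i \<noteq> 0" using y(1) I' by (auto simp: z_def)
    ultimately show ?thesis by blast
  qed
qed

text \<open>Each new vector solves the homogeneous system given by \<open>V\<close> and the vectors
  found so far. These are fewer than \<open>card I\<close> conditions, so a nonzero solution exists
  and can be normalised.\<close>

lemma orthonormal_complement:
  fixes V :: "('a \<Rightarrow> real) set"
  assumes "finite V" "finite I" "card V + q \<le> card I"
  shows "\<exists>u. (\<forall>a<q. (\<Sum>i\<in>I. (u a i)^2) = 1) \<and> (\<forall>a<q. \<forall>b<q. a \<noteq> b \<longrightarrow> (\<Sum>i\<in>I. u a i * u b i) = 0)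
    \<and> (\<forall>a<q. \<forall>v\<in>V. (\<Sum>i\<in>I. v i * u a i) = 0)"
  using assms(3)
proof (induction q)
  case 0
  show ?case by simp
next
  case (Suc q)
  then obtain u where u: "\<forall>a<q. (\<Sum>i\<in>I. (u a i)^2) = 1"
    "\<forall>a<q. \<forall>b<q. a \<noteq> b \<longrightarrow> (\<Sum>i\<in>I. u a i * u b i) = 0"
    "\<forall>a<q. \<forall>v\<in>V. (\<Sum>i\<in>I. v i * u a i) = 0"
    by auto
  have "card (V \<union> u ` {..<q}) \<le> card V + card (u ` {..<q})" by (rule card_Un_le)
  also have "\<dots> \<le> card V + q" using card_image_le[of "{..<q}" u] by simp
  finally have "card (V \<union> u ` {..<q}) < card I" using Suc.prems by simp
  with homogeneous_system_nontrivial[of "V \<union> u ` {..<q}" I] assms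
  obtain y where y: "\<exists>i\<in>I. y i \<noteq> 0" "\<forall>v\<in>V \<union> u ` {..<q}. (\<Sum>i\<in>I. v i * y i) = 0" by auto
  define N where "N = (\<Sum>i\<in>I. (y i)^2)"
  have N: "N > 0" unfolding N_def using y(1) assms(2)
    by (metis (no_types, lifting) sum_pos2 zero_le_power2 zero_less_power2)
  define u' where "u' = u(q := (\<lambda>i. y i / sqrt N))"
  have 1: "(\<Sum>i\<in>I. (y i / sqrt N)^2) = 1"
    using N by (simp add: power_divide flip: sum_divide_distrib N_def)
  have 2: "(\<Sum>i\<in>I. v i * (y i / sqrt N)) = 0" if "v \<in> V \<union> u ` {..<q}" for v
    using y(2) that by (simp flip: sum_divide_distrib)
  have 3: "(\<Sum>i\<in>I. (y i / sqrt N) * v i) = 0" if "v \<in> V \<union> u ` {..<q}" for v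
    using 2[OF that] by (simp add: mult.commute)
  show ?case
    by (rule exI[of _ u']) (use u 1 2 3 in \<open>auto simp: u'_def less_Suc_eq\<close>)
qed

lemma bessel_finite:
  fixes u :: "nat \<Rightarrow> 'a \<Rightarrow> real"
  assumes "finite I" "\<forall>a<q. (\<Sum>i\<in>I. (u a i)^2) = 1"
    "\<forall>a<q. \<forall>b<q. a \<noteq> b \<longrightarrow> (\<Sum>i\<in>I. u a i * u b i) = 0"
  shows "(\<Sum>a<q. (\<Sum>i\<in>I. c i * u a i)^2) \<le> (\<Sum>i\<in>I. (c i)^2)"
proof -
  define p where "p a = (\<Sum>i\<in>I. c i * u a i)" for a
  have "0 \<le> (\<Sum>i\<in>I. (c i - (\<Sum>a<q. p a * u a i))^2)" by (simp add: sum_nonneg)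
  also have "\<dots> = (\<Sum>i\<in>I. (c i)^2) - 2 * (\<Sum>i\<in>I. c i * (\<Sum>a<q. p a * u a i))
      + (\<Sum>i\<in>I. (\<Sum>a<q. p a * u a i) * (\<Sum>b<q. p b * u b i))"
    by (simp add: power2_diff sum.distrib sum_subtractf sum_distrib_left power2_eq_square algebra_simps)
  also have "(\<Sum>i\<in>I. c i * (\<Sum>a<q. p a * u a i)) = (\<Sum>a<q. (p a)^2)"
  proof -
    have "(\<Sum>i\<in>I. c i * (\<Sum>a<q. p a * u a i)) = (\<Sum>i\<in>I. \<Sum>a<q. p a * (c i * u a i))"
      by (simp add: sum_distrib_left algebra_simps)
    also have "\<dots> = (\<Sum>a<q. \<Sum>i\<in>I. p a * (c i * u a i))" by (rule sum.swap)
    also have "\<dots> = (\<Sum>a<q. p a * p a)" by (simp add: p_def sum_distrib_left)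
    finally show ?thesis by (simp add: power2_eq_square)
  qed
  also have "(\<Sum>i\<in>I. (\<Sum>a<q. p a * u a i) * (\<Sum>b<q. p b * u b i)) = (\<Sum>a<q. (p a)^2)"
  proof -
    have "(\<Sum>i\<in>I. (\<Sum>a<q. p a * u a i) * (\<Sum>b<q. p b * u b i))
        = (\<Sum>i\<in>I. \<Sum>a<q. \<Sum>b<q. p a * p b * (u a i * u b i))"
      by (simp add: sum_product algebra_simps)
    also have "\<dots> = (\<Sum>a<q. \<Sum>i\<in>I. \<Sum>b<q. p a * p b * (u a i * u b i))" by (rule sum.swap)
    also have "\<dots> = (\<Sum>a<q. \<Sum>b<q. \<Sum>i\<in>I. p a * p b * (u a i * u b i))"
      by (intro sum.cong refl sum.swap)
    also have "\<dots> = (\<Sum>a<q. \<Sum>b<q. p a * p b * (\<Sum>i\<in>I. u a i * u b i))"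
      by (simp add: sum_distrib_left)
    also have "\<dots> = (\<Sum>a<q. \<Sum>b<q. if b = a then p a * p b else 0)"
    proof (intro sum.cong refl)
      fix a b assume "a \<in> {..<q}" "b \<in> {..<q}"
      then show "p a * p b * (\<Sum>i\<in>I. u a i * u b i) = (if b = a then p a * p b else 0)"
        using assms(2,3) by (auto simp flip: power2_eq_square)
    qed
    also have "\<dots> = (\<Sum>a<q. (p a)^2)" by (simp add: power2_eq_square)
    finally show ?thesis .
  qed
  finally show ?thesis by (simp add: p_def)
qed

section \<open>The subgaussian bound for the hyperbolic cosine\<close>

lemma fact_double_ge: "2 ^ n * fact n \<le> (fact (2 * n) :: real)"
proof (induction n)
  case (Suc n)
  have "2 ^ Suc n * fact (Suc n) = (2 * (real n + 1)) * (2 ^ n * fact n)" by (simp add: algebra_simps)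
  also have "\<dots> \<le> (2 * (real n + 1)) * fact (2 * n)" by (intro mult_left_mono Suc) auto
  also have "\<dots> \<le> (2 * (real n + 1)) * ((2 * real n + 1) * fact (2 * n))"
    by (intro mult_left_mono) auto
  also have "\<dots> = fact (2 * Suc n)" by (simp add: algebra_simps)
  finally show ?case .
qed simp

text \<open>Termwise comparison of the two power series. It is used to bound the growth of the
  potential when the colouring moves a step in either of two opposite directions.\<close>

lemma cosh_le_exp_half_square: "cosh s \<le> exp (s\<^sup>2 / 2)" for s :: real
proof -
  have "strict_mono (\<lambda>n::nat. 2 * n)" by (rule strict_monoI) simp
  then have "(\<lambda>n. s ^ (2 * n) /\<^sub>R fact (2 * n)) sums cosh s"
    using sums_mono_reindex[of "\<lambda>n::nat. 2 * n" "\<lambda>n. if even n then s ^ n /\<^sub>R fact n else 0" "cosh s"]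
      cosh_converges[of s] by (fastforce elim!: evenE)
  moreover have "(\<lambda>n. (s\<^sup>2 / 2) ^ n /\<^sub>R fact n) sums exp (s\<^sup>2 / 2)" by (rule exp_converges)
  ultimately show ?thesis
  proof (rule sums_le[rotated])
    fix n
    have "(s\<^sup>2) ^ n / fact (2 * n) \<le> (s\<^sup>2) ^ n / (2 ^ n * fact n)"
      by (intro divide_left_mono fact_double_ge) auto
    moreover have "s ^ (2 * n) = (s\<^sup>2) ^ n" "(s\<^sup>2 / 2) ^ n = (s\<^sup>2) ^ n / 2 ^ n"
      by (simp_all add: power_mult power_divide)
    ultimately show "s ^ (2 * n) /\<^sub>R fact (2 * n) \<le> (s\<^sup>2 / 2) ^ n /\<^sub>R fact n"
      by (simp only: real_scaleR_def divide_inverse inverse_mult_distrib mult.assoc mult.commute mult.left_commute)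
  qed
qed

section \<open>Partial colourings\<close>

text \<open>Averaging over \<open>q\<close> orthonormal vectors orthogonal to \<open>V\<close>: by
  Bessel each \<open>c r\<close> has total squared inner product at most 1 with them, so the
  \<open>q\<close> values of the quadratic form add up to at most the sum of
  \<open>w\<close>.\<close>

lemma exists_sparse_direction:
  fixes c :: "'r \<Rightarrow> 'a \<Rightarrow> real" and w :: "'r \<Rightarrow> real"
  assumes "finite I" "finite V" "finite R" "card V + q \<le> card I" "q > 0"
    and w: "\<And>r. r \<in> R \<Longrightarrow> w r \<ge> 0" and c: "\<And>r. r \<in> R \<Longrightarrow> (\<Sum>i\<in>I. (c r i)\<^sup>2) \<le> 1"
  shows "\<exists>y. (\<Sum>i\<in>I. (y i)\<^sup>2) = 1 \<and> (\<forall>v\<in>V. (\<Sum>i\<in>I. v i * y i) = 0) \<and>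
    real q * (\<Sum>r\<in>R. w r * (\<Sum>i\<in>I. c r i * y i)\<^sup>2) \<le> (\<Sum>r\<in>R. w r)"
proof -
  obtain u where u: "\<forall>a<q. (\<Sum>i\<in>I. (u a i)^2) = 1"
    "\<forall>a<q. \<forall>b<q. a \<noteq> b \<longrightarrow> (\<Sum>i\<in>I. u a i * u b i) = 0"
    "\<forall>a<q. \<forall>v\<in>V. (\<Sum>i\<in>I. v i * u a i) = 0"
    using orthonormal_complement[of V I q] assms by blast
  define Q where "Q a = (\<Sum>r\<in>R. w r * (\<Sum>i\<in>I. c r i * u a i)\<^sup>2)" for a
  have "(\<Sum>a<q. Q a) = (\<Sum>r\<in>R. w r * (\<Sum>a<q. (\<Sum>i\<in>I. c r i * u a i)\<^sup>2))"
    unfolding Q_def by (subst sum.swap) (simp add: sum_distrib_left)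
  also have "\<dots> \<le> (\<Sum>r\<in>R. w r * 1)"
    using bessel_finite[OF assms(1) u(1,2)] c w by (intro sum_mono mult_left_mono) (force intro: order_trans)+
  finally have le: "(\<Sum>a<q. Q a) \<le> (\<Sum>r\<in>R. w r)" by simp
  have "\<exists>a<q. real q * Q a \<le> (\<Sum>r\<in>R. w r)"
  proof (rule ccontr)
    assume "\<not> ?thesis"
    then have *: "\<And>a. a < q \<Longrightarrow> (\<Sum>r\<in>R. w r) < real q * Q a" by force
    have "(\<Sum>a<q. (\<Sum>r\<in>R. w r)) < (\<Sum>a<q. real q * Q a)"
      using \<open>q > 0\<close> * by (intro sum_strict_mono) auto
    also have "\<dots> = real q * (\<Sum>a<q. Q a)" by (simp add: sum_distrib_left)
    also have "\<dots> \<le> real q * (\<Sum>r\<in>R. w r)" using le by (intro mult_left_mono) auto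
    finally show False by simp
  qed
  then obtain a where "a < q" "real q * Q a \<le> (\<Sum>r\<in>R. w r)" by blast
  then show ?thesis using u unfolding Q_def by (intro exI[of _ "u a"]) auto
qed

text \<open>Tychonoff on the whole function space; pinning the coordinates outside \<open>J\<close>
  to 0 is what makes the set compact there.\<close>

lemma compact_coordinate_box:
  "compact {x::'a \<Rightarrow> real. \<forall>i. x i \<in> (if i \<in> J then {-1..1} else {0})}" (is "compact ?K")
proof -
  have "compactin (product_topology (\<lambda>_. euclidean) UNIV) (PiE UNIV (\<lambda>i. if i \<in> J then {-1..1::real} else {0}))"
    by (subst compactin_PiE) auto
  moreover have "PiE UNIV (\<lambda>i. if i \<in> J then {-1..1::real} else {0}) = ?K"
    by (auto simp: PiE_def Pi_def)
  ultimately show ?thesis by (simp add: euclidean_product_topology)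
qed

text \<open>The colouring is a point of maximal Euclidean norm in the body cut out of the cube by the linear
  constraints, the potential bound \<open>\<Sum>r. w r x \<le> card J / 8\<close> and the bounds \<open>w r x \<le> 1\<close>. The factor
  \<open>exp (- 4 (l r)\<^sup>2 \<parallel>x\<parallel>\<^sup>2 / card J)\<close> in \<open>w\<close> makes the potential decrease along a suitable direction
  whenever fewer than a quarter of the coordinates have reached the boundary of the cube.\<close>
lemma partial_coloring_unit:
  fixes c :: "'r \<Rightarrow> 'a \<Rightarrow> real" and l :: "'r \<Rightarrow> real"
  assumes fin: "finite J" "finite U" "finite R" and U: "4 * card U \<le> card J" and J16: "16 \<le> card J"
    and sum_l: "(\<Sum>r\<in>R. exp (- (l r)\<^sup>2)) \<le> card J / 8" and l: "\<And>r. r \<in> R \<Longrightarrow> 1 \<le> l r"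
    and c: "\<And>r. r \<in> R \<Longrightarrow> (\<Sum>i\<in>J. (c r i)\<^sup>2) \<le> 1"
  shows "\<exists>e. (\<forall>i\<in>J. \<bar>e i\<bar> \<le> 1) \<and> card J \<le> 4 * card {i\<in>J. \<bar>e i\<bar> = 1} \<and>
    (\<forall>v\<in>U. (\<Sum>i\<in>J. v i * e i) = 0) \<and> (\<forall>r\<in>R. \<bar>\<Sum>i\<in>J. c r i * e i\<bar> \<le> 6 * l r)"
proof -
  define M where "M = real (card J)"
  have M: "M \<ge> 16" using J16 by (simp add: M_def)
  define ip where "ip v e = (\<Sum>i\<in>J. v i * e i)" for v e :: "'a \<Rightarrow> real"
  define nn where "nn e = (\<Sum>i\<in>J. (e i)\<^sup>2)" for e :: "'a \<Rightarrow> real"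
  \<comment> \<open>At the origin \<open>w r\<close> equals \<open>exp (- (l r)\<^sup>2)\<close>, so
    \<open>sum_l\<close> and \<open>l\<close> place the origin in the body \<open>K\<close>.\<close>
  define w where "w r e = exp (- (l r)\<^sup>2) * cosh (l r * ip (c r) e) * exp (- (4 * (l r)\<^sup>2 / M) * nn e)" for r e
  have cont_ip: "continuous_on UNIV (ip v)" for v unfolding ip_def by (intro continuous_intros) auto
  have cont_nn: "continuous_on UNIV nn" unfolding nn_def by (intro continuous_intros) auto
  have cont_w: "continuous_on UNIV (w r)" for r
    unfolding w_def cosh_def by (intro continuous_intros cont_ip cont_nn)
  have w_pos: "w r e > 0" for r e unfolding w_def by simp
  define K where "K = {x. \<forall>i. x i \<in> (if i \<in> J then {-1..1} else {0})} \<inter>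
    {e. (\<forall>v\<in>U. ip v e = 0) \<and> (\<Sum>r\<in>R. w r e) \<le> M / 8 \<and> (\<forall>r\<in>R. w r e \<le> 1)}"
  have "closed {e. (\<forall>v\<in>U. ip v e = 0) \<and> (\<Sum>r\<in>R. w r e) \<le> M / 8 \<and> (\<forall>r\<in>R. w r e \<le> 1)}"
    unfolding Ball_def
    by (intro closed_Collect_conj closed_Collect_all closed_Collect_imp open_Collect_const closed_Collect_eq
        closed_Collect_le continuous_intros cont_ip cont_w)
  then have "compact K" unfolding K_def by (intro compact_Int_closed compact_coordinate_box)
  moreover have "(\<lambda>_. 0) \<in> K"
    using sum_l by (auto simp: K_def ip_def w_def nn_def M_def)
  ultimately obtain x where x: "x \<in> K" and x_max: "\<And>y. y \<in> K \<Longrightarrow> nn y \<le> nn x"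
    using continuous_attains_sup[of K nn] continuous_on_subset[OF cont_nn] by blast
  define F where "F = {i\<in>J. \<bar>x i\<bar> = 1}"
  have x_cube: "\<And>i. i \<in> J \<Longrightarrow> \<bar>x i\<bar> \<le> 1" "\<And>i. i \<notin> J \<Longrightarrow> x i = 0"
    and x_U: "\<And>v. v \<in> U \<Longrightarrow> ip v x = 0" and x_sum: "(\<Sum>r\<in>R. w r x) \<le> M / 8" and x_w: "\<And>r. r \<in> R \<Longrightarrow> w r x \<le> 1"
  proof -
    have "x i \<in> (if i \<in> J then {-1..1} else {0})" for i using x by (simp add: K_def)
    then show "\<And>i. i \<in> J \<Longrightarrow> \<bar>x i\<bar> \<le> 1" "\<And>i. i \<notin> J \<Longrightarrow> x i = 0"
      by (metis abs_le_iff atLeastAtMost_iff minus_le_iff, metis singletonD)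
  qed (use x in \<open>auto simp: K_def\<close>)
  have frozen: "card J \<le> 4 * card F"
  proof (rule ccontr)
    assume F: "\<not> card J \<le> 4 * card F"
    \<comment> \<open>The rows whose bound \<open>w r x \<le> 1\<close> is tight. Each contributes 1
      to the potential, so there are at most \<open>M / 8\<close> of them.\<close>
    define T where "T = {r\<in>R. w r x = 1}"
    have "real (card T) = (\<Sum>r\<in>T. w r x)" by (simp add: T_def)
    also have "\<dots> \<le> (\<Sum>r\<in>R. w r x)"
      using w_pos fin by (intro sum_mono2) (auto simp: T_def less_imp_le)
    finally have T: "8 * card T \<le> card J" using x_sum by (simp add: M_def)
    define V where "V = insert x (((\<lambda>i j. of_bool (j = i)) ` F \<union> U) \<union> c ` T)"
    have fV: "finite V" "finite F" using fin by (auto simp: V_def F_def T_def)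
    have "card V \<le> Suc (card F + card U + card T)"
    proof -
      have "card V \<le> Suc (card (((\<lambda>i (j::'a). of_bool (j = i) :: real) ` F \<union> U) \<union> c ` T))"
        unfolding V_def by (rule card_insert_le_m1[THEN order_trans]) auto
      also have "\<dots> \<le> Suc (card (((\<lambda>i (j::'a). of_bool (j = i) :: real) ` F)) + card U + card (c ` T))"
        by (intro Suc_mono[THEN less_imp_le] le_imp_less_Suc order_trans[OF card_Un_le] add_mono card_Un_le order_refl Suc_le_mono[THEN iffD2])
      also have "\<dots> \<le> Suc (card F + card U + card T)"
        using fin fV by (intro Suc_le_mono[THEN iffD2] add_mono card_image_le) (auto simp: T_def)
      finally show ?thesis .
    qed
    define q where "q = (card J + 3) div 4"
    have q: "4 * q \<ge> card J" "4 * q \<le> card J + 3" "q > 0" using J16 by (auto simp: q_def)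
    have "card V + q \<le> card J"
      using \<open>card V \<le> _\<close> F U T q J16 by linarith
    then obtain y where y: "nn y = 1" "\<And>v. v \<in> V \<Longrightarrow> ip v y = 0"
      "real q * (\<Sum>r\<in>R. w r x * (l r)\<^sup>2 * (ip (c r) y)\<^sup>2) \<le> (\<Sum>r\<in>R. w r x * (l r)\<^sup>2)"
      using exists_sparse_direction[of J V R q "\<lambda>r. w r x * (l r)\<^sup>2" c] fin fV q(3) w_pos c
      unfolding ip_def nn_def by (auto simp: less_imp_le)
    define y' where "y' i = (if i \<in> J then y i else 0)" for i
    have y': "nn y' = 1" "ip v y' = ip v y" for v
      by (auto simp: nn_def ip_def y'_def y(1)[unfolded nn_def] cong: sum.cong)
    have yF: "y' i = 0" if "i \<in> F" for i
    proof -
      have "ip (\<lambda>j. of_bool (j = i)) y = 0" using that by (intro y(2)) (auto simp: V_def)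
      then show ?thesis using that fin(1) by (simp add: ip_def F_def y'_def)
    qed
    have yx: "ip x y' = 0" and yU: "\<And>v. v \<in> U \<Longrightarrow> ip v y' = 0" and yT: "\<And>r. r \<in> T \<Longrightarrow> ip (c r) y' = 0"
      using y(2) y'(2) by (auto simp: V_def)
    define mv where "mv s i = x i + s * y' i" for s i
    have ip_mv: "ip v (mv s) = ip v x + s * ip v y'" for v s
      by (simp add: ip_def mv_def algebra_simps sum.distrib sum_distrib_left)
    have nn_mv: "nn (mv s) = nn x + s\<^sup>2" for s
    proof -
      have "nn (mv s) = nn x + 2 * s * ip x y' + s\<^sup>2 * nn y'"
        by (simp add: nn_def ip_def mv_def algebra_simps power2_eq_square sum.distrib sum_distrib_left)
      then show ?thesis using yx y' by simp
    qed
    \<comment> \<open>The exponential rate, in terms of \<open>s\<^sup>2\<close>, that bounds the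
      average of \<open>w r\<close> over the moves by \<open>s\<close> and by \<open>- s\<close>:
      growth from the cosh, decay from the norm factor.\<close>
    define \<kappa> where "\<kappa> r = (l r * ip (c r) y')\<^sup>2 / 2 - 4 * (l r)\<^sup>2 / M" for r
    have w_mv: "w r (mv s) + w r (mv (- s)) \<le> 2 * (w r x * exp (s\<^sup>2 * \<kappa> r))" for r s
    proof -
      let ?a = "l r * ip (c r) x" and ?b = "s * (l r * ip (c r) y')"
      let ?E = "exp (- (l r)\<^sup>2) * exp (- (4 * (l r)\<^sup>2 / M) * (nn x + s\<^sup>2))"
      have "w r (mv s) + w r (mv (- s)) = ?E * (cosh (?a + ?b) + cosh (?a - ?b))"
        unfolding w_def nn_mv ip_mv by (simp add: algebra_simps)
      also have "cosh (?a + ?b) + cosh (?a - ?b) = 2 * cosh ?a * cosh ?b"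
        by (simp add: cosh_add cosh_diff)
      also have "?E * (2 * cosh ?a * cosh ?b) \<le> ?E * (2 * cosh ?a * exp (?b\<^sup>2 / 2))"
        by (intro mult_left_mono cosh_le_exp_half_square) auto
      also have "\<dots> = 2 * (w r x * exp (s\<^sup>2 * \<kappa> r))"
        by (simp add: w_def \<kappa>_def exp_diff exp_add[symmetric] exp_minus algebra_simps power_mult_distrib add_divide_distrib)
      finally show ?thesis .
    qed
    define \<psi> where "\<psi> \<tau> = (\<Sum>r\<in>R. w r x * exp (\<tau> * \<kappa> r))" for \<tau>
    \<comment> \<open>By \<open>y(3)\<close> and \<open>4 * q \<ge> card J\<close>, the growth part
      of the derivative of \<psi> at 0 is at most \<open>2 / M\<close> times the sum of
      \<open>w r x * (l r)\<^sup>2\<close>, while the decay part is \<open>4 / M\<close> times that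
      sum. The sum is positive because every \<open>l r\<close> is at least 1.\<close>
    have psi: "\<forall>\<^sub>F s in at_right 0. \<psi> (s\<^sup>2) \<le> \<psi> 0"
    proof (cases "R = {}")
      case True
      then show ?thesis by (simp add: \<psi>_def)
    next
      case False
      have "M * (\<Sum>r\<in>R. w r x * (l r)\<^sup>2 * (ip (c r) y)\<^sup>2) \<le> 4 * (real q * (\<Sum>r\<in>R. w r x * (l r)\<^sup>2 * (ip (c r) y)\<^sup>2))"
        using q w_pos by (subst mult.assoc[symmetric], intro mult_right_mono)
          (auto simp: M_def less_imp_le intro!: sum_nonneg mult_nonneg_nonneg)
      with y(3) have le: "M * (\<Sum>r\<in>R. w r x * (l r)\<^sup>2 * (ip (c r) y)\<^sup>2) \<le> 4 * (\<Sum>r\<in>R. w r x * (l r)\<^sup>2)"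
        by linarith
      have pos: "(\<Sum>r\<in>R. w r x * (l r)\<^sup>2) > 0"
      proof (rule sum_pos[OF fin(3) False])
        fix r assume "r \<in> R"
        then show "0 < w r x * (l r)\<^sup>2" using l[of r] w_pos[of r x] by (intro mult_pos_pos) auto
      qed
      have "(\<Sum>r\<in>R. w r x * \<kappa> r) = (\<Sum>r\<in>R. w r x * (l r)\<^sup>2 * (ip (c r) y)\<^sup>2) / 2 - 4 * (\<Sum>r\<in>R. w r x * (l r)\<^sup>2) / M"
        by (simp add: \<kappa>_def y' sum_subtractf sum_divide_distrib sum_distrib_left algebra_simps power_mult_distrib)
      also have "\<dots> < 0" using le pos M by (simp add: field_simps)
      finally have neg: "(\<Sum>r\<in>R. w r x * \<kappa> r) < 0" .
      have "(\<psi> has_real_derivative (\<Sum>r\<in>R. w r x * \<kappa> r)) (at 0)"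
        unfolding \<psi>_def by (auto intro!: derivative_eq_intros sum.cong)
      from DERIV_neg_dec_right[OF this neg] obtain d where d: "d > 0" "\<And>h. 0 < h \<Longrightarrow> h < d \<Longrightarrow> \<psi> h < \<psi> 0" by auto
      have "\<forall>\<^sub>F s::real in at_right 0. s\<^sup>2 < d"
      proof -
        have "((\<lambda>s::real. s\<^sup>2) \<longlongrightarrow> 0\<^sup>2) (at_right 0)" by (intro tendsto_intros)
        then show ?thesis using d(1) by (intro order_tendstoD) auto
      qed
      then show ?thesis using eventually_at_right_less[of 0]
        by eventually_elim (use d in \<open>auto intro: less_imp_le\<close>)
    qed
    have lim: "((\<lambda>s. mv (\<sigma> * s) i) \<longlongrightarrow> x i) (at_right 0)" for \<sigma> i
      unfolding mv_def by (auto intro!: tendsto_eq_intros)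
    have limip: "((\<lambda>s. ip v (mv (\<sigma> * s))) \<longlongrightarrow> ip v x) (at_right 0)" for \<sigma> v
      unfolding ip_mv by (auto intro!: tendsto_eq_intros)
    have limw: "((\<lambda>s. w r (mv (\<sigma> * s))) \<longlongrightarrow> w r x) (at_right 0)" for \<sigma> r
    proof -
      have "continuous_on UNIV (\<lambda>s. w r (mv (\<sigma> * s)))"
        unfolding w_def nn_mv ip_mv cosh_def using M by (intro continuous_intros) auto
      then have "((\<lambda>s. w r (mv (\<sigma> * s))) \<longlongrightarrow> w r (mv (\<sigma> * 0))) (at 0)"
        by (metis UNIV_I continuous_on_def)
      moreover have "mv 0 = x" by (simp add: mv_def fun_eq_iff)
      ultimately show ?thesis by (simp add: filterlim_at_split)
    qed
    have ev_cube: "\<forall>\<^sub>F s in at_right 0. \<forall>i\<in>J. \<bar>mv (\<sigma> * s) i\<bar> \<le> 1" for \<sigma>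
    proof (intro eventually_ball_finite fin ballI)
      fix i assume i: "i \<in> J"
      show "\<forall>\<^sub>F s in at_right 0. \<bar>mv (\<sigma> * s) i\<bar> \<le> 1"
      proof (cases "i \<in> F")
        case True
        then show ?thesis using x_cube(1)[OF i] by (simp add: mv_def yF)
      next
        case False
        then have "\<bar>x i\<bar> < 1" using x_cube(1)[OF i] i by (force simp: F_def)
        then have "\<forall>\<^sub>F s in at_right 0. \<bar>mv (\<sigma> * s) i\<bar> < 1"
          by (intro order_tendstoD(2)[OF tendsto_rabs[OF lim]])
        then show ?thesis by eventually_elim simp
      qed
    qed
    have ev_w: "\<forall>\<^sub>F s in at_right 0. \<forall>r\<in>R. w r (mv (\<sigma> * s)) \<le> 1" for \<sigma>
    proof (intro eventually_ball_finite fin ballI)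
      fix r assume r: "r \<in> R"
      show "\<forall>\<^sub>F s in at_right 0. w r (mv (\<sigma> * s)) \<le> 1"
      proof (cases "r \<in> T")
        \<comment> \<open>For a tight row only the norm factor changes, and it decreases.\<close>
        case True
        have "w r (mv (\<sigma> * s)) \<le> w r x" for s
          unfolding w_def ip_mv nn_mv using yT[OF True] M
          by (simp add: mult_left_mono divide_right_mono)
        then have "w r (mv (\<sigma> * s)) \<le> 1" for s using x_w[OF r] by (rule order_trans)
        then show ?thesis by simp
      next
        case False
        then have "w r x < 1" using x_w[OF r] r by (force simp: T_def)
        then have "\<forall>\<^sub>F s in at_right 0. w r (mv (\<sigma> * s)) < 1"
          by (intro order_tendstoD(2)[OF limw])
        then show ?thesis by eventually_elim simp
      qed
    qed
    have "\<forall>\<^sub>F s in at_right 0. 0 < s \<and> \<psi> (s\<^sup>2) \<le> \<psi> 0 \<and>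
        (\<forall>i\<in>J. \<bar>mv (1 * s) i\<bar> \<le> 1) \<and> (\<forall>i\<in>J. \<bar>mv ((-1) * s) i\<bar> \<le> 1) \<and>
        (\<forall>r\<in>R. w r (mv (1 * s)) \<le> 1) \<and> (\<forall>r\<in>R. w r (mv ((-1) * s)) \<le> 1)"
      by (intro eventually_conj psi ev_cube ev_w eventually_at_right_less)
    from eventually_happens'[OF trivial_limit_at_right_real this]
    obtain s where s: "0 < s" "\<psi> (s\<^sup>2) \<le> \<psi> 0" "\<forall>i\<in>J. \<bar>mv s i\<bar> \<le> 1" "\<forall>i\<in>J. \<bar>mv (-s) i\<bar> \<le> 1"
      "\<forall>r\<in>R. w r (mv s) \<le> 1" "\<forall>r\<in>R. w r (mv (-s)) \<le> 1"
      by (metis mult_1 mult_minus1)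
    have "(\<Sum>r\<in>R. w r (mv s)) + (\<Sum>r\<in>R. w r (mv (- s))) \<le> (\<Sum>r\<in>R. 2 * (w r x * exp (s\<^sup>2 * \<kappa> r)))"
      unfolding sum.distrib[symmetric] by (intro sum_mono w_mv)
    also have "\<dots> = 2 * \<psi> (s\<^sup>2)" by (simp add: \<psi>_def sum_distrib_left)
    also have "\<dots> \<le> 2 * (M / 8)" using s(2) x_sum by (simp add: \<psi>_def)
    \<comment> \<open>Only the average over the two signs is controlled, so one of the two moves
      stays in \<open>K\<close>; its norm exceeds that of \<open>x\<close>, against
      maximality.\<close>
    finally have "(\<Sum>r\<in>R. w r (mv s)) \<le> M / 8 \<or> (\<Sum>r\<in>R. w r (mv (-s))) \<le> M / 8" by linarith
    moreover have mem: "mv t \<in> K" if "(\<Sum>r\<in>R. w r (mv t)) \<le> M / 8" "\<forall>i\<in>J. \<bar>mv t i\<bar> \<le> 1" "\<forall>r\<in>R. w r (mv t) \<le> 1" for t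
      unfolding K_def using that x_cube(2) x_U yU by (force simp: ip_mv mv_def y'_def abs_le_iff)
    ultimately have "mv s \<in> K \<or> mv (-s) \<in> K" using s by blast
    then have "nn (mv s) \<le> nn x \<or> nn (mv (-s)) \<le> nn x" using x_max by blast
    then show False using s(1) by (simp add: nn_mv)
  qed
  \<comment> \<open>Since \<open>w r x \<le> 1\<close> and \<open>nn x \<le> M\<close>, the exponent
    \<open>l r * ip (c r) x\<close> is at most \<open>(l r)\<^sup>2 + 4 * (l r)\<^sup>2\<close> in
    absolute value, plus 1 for the factor 2 in the cosh. With \<open>1 \<le> l r\<close> this gives
    the 6.\<close>
  have "\<bar>ip (c r) x\<bar> \<le> 6 * l r" if r: "r \<in> R" for r
  proof -
    let ?t = "l r * ip (c r) x"
    have "nn x \<le> (\<Sum>i\<in>J. 1)" unfolding nn_def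
      using x_cube(1) by (intro sum_mono) (simp add: abs_square_le_1)
    then have nn: "nn x \<le> M" by (simp add: M_def)
    have "exp \<bar>?t\<bar> \<le> 2 * cosh ?t" by (simp add: cosh_def abs_if)
    also have "\<dots> = 2 * (w r x * exp ((l r)\<^sup>2 + 4 * (l r)\<^sup>2 / M * nn x))"
      by (simp add: w_def exp_add exp_minus field_simps)
    also have "\<dots> \<le> 2 * (1 * exp ((l r)\<^sup>2 + 4 * (l r)\<^sup>2 / M * M))"
    proof -
      have "4 * (l r)\<^sup>2 / M * nn x \<le> 4 * (l r)\<^sup>2 / M * M" using M by (intro mult_left_mono nn) auto
      then show ?thesis using x_w[OF r] by (intro mult_left_mono mult_mono) auto
    qed
    also have "\<dots> \<le> exp 1 * exp (5 * (l r)\<^sup>2)"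
      using M exp_ge_add_one_self[of 1] by (intro mult_mono) auto
    also have "\<dots> = exp (1 + 5 * (l r)\<^sup>2)" by (simp add: exp_add)
    finally have "\<bar>?t\<bar> \<le> 1 + 5 * (l r)\<^sup>2" by simp
    also have "\<dots> \<le> l r * (6 * l r)" using l[OF r] one_le_power[of "l r" 2] by (simp add: power2_eq_square)
    finally show ?thesis using l[OF r] by (simp add: abs_mult)
  qed
  then show ?thesis using x_cube x_U frozen unfolding F_def ip_def by (intro exI[of _ x]) auto
qed

lemma partial_coloring:
  fixes v :: "'r \<Rightarrow> 'a \<Rightarrow> real" and l s :: "'r \<Rightarrow> real"
  assumes fin: "finite J" "finite U" "finite R" and U: "4 * card U \<le> card J" and J16: "16 \<le> card J"
    and sum_l: "(\<Sum>r\<in>R. exp (- (l r)\<^sup>2)) \<le> card J / 8" and l: "\<And>r. r \<in> R \<Longrightarrow> 1 \<le> l r"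
    and s: "\<And>r. r \<in> R \<Longrightarrow> 0 < s r" "\<And>r. r \<in> R \<Longrightarrow> (\<Sum>i\<in>J. (v r i)\<^sup>2) \<le> (s r)\<^sup>2"
  shows "\<exists>e. (\<forall>i\<in>J. \<bar>e i\<bar> \<le> 1) \<and> card J \<le> 4 * card {i\<in>J. \<bar>e i\<bar> = 1} \<and>
    (\<forall>u\<in>U. (\<Sum>i\<in>J. u i * e i) = 0) \<and> (\<forall>r\<in>R. \<bar>\<Sum>i\<in>J. v r i * e i\<bar> \<le> 6 * l r * s r)"
proof -
  have "(\<Sum>i\<in>J. (v r i / s r)\<^sup>2) \<le> 1" if "r \<in> R" for r
    using s[OF that] by (simp add: power_divide flip: sum_divide_distrib)
  from partial_coloring_unit[where c = "\<lambda>r i. v r i / s r", OF fin U J16 sum_l l this]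
  obtain e where e: "\<forall>i\<in>J. \<bar>e i\<bar> \<le> 1" "card J \<le> 4 * card {i\<in>J. \<bar>e i\<bar> = 1}"
    "\<forall>u\<in>U. (\<Sum>i\<in>J. u i * e i) = 0" "\<forall>r\<in>R. \<bar>\<Sum>i\<in>J. v r i / s r * e i\<bar> \<le> 6 * l r" by blast
  have "\<bar>\<Sum>i\<in>J. v r i * e i\<bar> \<le> 6 * l r * s r" if r: "r \<in> R" for r
  proof -
    have "(\<Sum>i\<in>J. v r i / s r * e i) = (\<Sum>i\<in>J. v r i * e i) / s r" by (simp add: sum_divide_distrib)
    with e(4) r have "\<bar>\<Sum>i\<in>J. v r i * e i\<bar> / s r \<le> 6 * l r" using s(1)[OF r] by auto
    then show ?thesis using s(1)[OF r] by (simp add: field_simps)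
  qed
  with e show ?thesis by blast
qed

section \<open>Packing\<close>

text \<open>VC dimension at most \<open>d\<close>. Sets of exactly \<open>Suc d\<close> points
  suffice, since every subset of a shattered set is shattered.\<close>

definition vc_le :: "'a set set \<Rightarrow> nat \<Rightarrow> bool" where
  "vc_le Q d \<longleftrightarrow> (\<forall>T. finite T \<longrightarrow> card T = Suc d \<longrightarrow> \<not> Pow T \<subseteq> (\<lambda>S. S \<inter> T) ` Q)"

lemma vc_le_shattered:
  assumes "vc_le Q d" "finite T" "card T = Suc d" "\<And>Z. Z \<subseteq> T \<Longrightarrow> \<exists>S\<in>Q. S \<inter> T = Z"
  shows False
proof -
  have "Pow T \<subseteq> (\<lambda>S. S \<inter> T) ` Q"
  proof
    fix Z assume "Z \<in> Pow T"
    then obtain S where "S \<in> Q" "S \<inter> T = Z" using assms(4) by blast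
    then show "Z \<in> (\<lambda>S. S \<inter> T) ` Q" by blast
  qed
  then show False using assms(1-3) unfolding vc_le_def by blast
qed

lemma vc_le_deletion:
  assumes Q: "vc_le Q d" and Q': "\<And>R. R \<in> Q' \<Longrightarrow> a \<notin> R \<and> (\<exists>S\<in>Q. S - {a} = R)"
  shows "vc_le Q' d"
  unfolding vc_le_def
proof (intro allI impI notI)
  fix T assume T: "finite T" "card T = Suc d" "Pow T \<subseteq> (\<lambda>S. S \<inter> T) ` Q'"
  have sh: "\<exists>R\<in>Q'. R \<inter> T = Z" if "Z \<subseteq> T" for Z using T(3) that by blast
  have "a \<notin> T" using sh[of T] Q' by blast
  show False
  proof (rule vc_le_shattered[OF Q T(1,2)])
    fix Z assume "Z \<subseteq> T"
    then obtain R where R: "R \<in> Q'" "R \<inter> T = Z" using sh by blast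
    then obtain S where "S \<in> Q" "S - {a} = R" using Q' by blast
    then show "\<exists>S\<in>Q. S \<inter> T = Z" using R \<open>a \<notin> T\<close> by blast
  qed
qed

text \<open>If the link shatters \<open>T\<close>, then \<open>Q\<close> shatters
  \<open>insert a T\<close>, because every member of the link occurs in \<open>Q\<close> both with
  and without \<open>a\<close>. This is where the dimension drops.\<close>

lemma vc_le_link:
  assumes Q: "vc_le Q (Suc d)" and Q': "\<And>R. R \<in> Q' \<Longrightarrow> a \<notin> R \<and> R \<in> Q \<and> insert a R \<in> Q"
  shows "vc_le Q' d"
  unfolding vc_le_def
proof (intro allI impI notI)
  fix T assume T: "finite T" "card T = Suc d" "Pow T \<subseteq> (\<lambda>S. S \<inter> T) ` Q'"
  have sh: "\<exists>R\<in>Q'. R \<inter> T = Z" if "Z \<subseteq> T" for Z using T(3) that by blast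
  have a: "a \<notin> T" using sh[of T] Q' by blast
  show False
  proof (rule vc_le_shattered[OF Q, of "insert a T"])
    fix Z assume Z: "Z \<subseteq> insert a T"
    then obtain R where R: "R \<in> Q'" "R \<inter> T = Z - {a}" using sh[of "Z - {a}"] by blast
    show "\<exists>S\<in>Q. S \<inter> insert a T = Z"
    proof (cases "a \<in> Z")
      case True
      then have "insert a R \<inter> insert a T = Z" using R by blast
      then show ?thesis using Q'[OF R(1)] by blast
    next
      case False
      then have "R \<inter> insert a T = Z" using R Q'[OF R(1)] by blast
      then show ?thesis using Q'[OF R(1)] by blast
    qed
  qed (use T a in auto)
qed

lemma vc_le_0_link:
  assumes Q: "vc_le Q 0" and "a \<notin> R" "R \<in> Q" "insert a R \<in> Q"
  shows False
proof (rule vc_le_shattered[OF Q, of "{a}"])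
  fix Z assume "Z \<subseteq> {a}"
  then have "Z = {} \<or> Z = {a}" by blast
  then show "\<exists>S\<in>Q. S \<inter> {a} = Z"
  proof
    assume "Z = {}"
    then show ?thesis using assms(2) by (intro bexI[OF _ assms(3)]) simp
  next
    assume "Z = {a}"
    then show ?thesis by (intro bexI[OF _ assms(4)]) simp
  qed
qed auto

text \<open>Sauer's lemma in a crude form suited to induction: the deletion keeps the dimension, the
  link loses one, and (n+1)^d + (n+1)^(d-1) is at most (n+2)^d.\<close>

lemma sauer_bound:
  assumes "finite A" "Q \<subseteq> Pow A" "vc_le Q d"
  shows "card Q \<le> (card A + 1) ^ d"
  using assms
proof (induction A arbitrary: Q d rule: finite_induct)
  case empty
  then have "card Q \<le> card {{}::'a set}" by (intro card_mono) auto
  then show ?case by simp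
next
  case (insert a A)
  define Q1 where "Q1 = (\<lambda>S. S - {a}) ` Q"
  define Q2 where "Q2 = {R\<in>Q. a \<notin> R \<and> insert a R \<in> Q}"
  have fQ: "finite Q" using insert by (meson finite_Pow_iff finite_insert finite_subset)
  \<comment> \<open>Forgetting \<open>a\<close> merges exactly the pairs that \<open>Q2\<close>
    counts.\<close>
  have "card Q = card Q1 + card Q2"
  proof -
    have "card Q = card (Q \<inter> {S. a \<notin> S}) + card (Q \<inter> {S. a \<in> S})"
      using fQ by (subst card_Un_disjoint[symmetric]) (auto intro!: arg_cong[of _ _ card])
    also have "card (Q \<inter> {S. a \<in> S}) = card ((\<lambda>S. S - {a}) ` (Q \<inter> {S. a \<in> S}))"
      by (intro card_image[symmetric] inj_onI) blast
    also have "card (Q \<inter> {S. a \<notin> S}) + \<dots> =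
        card ((Q \<inter> {S. a \<notin> S}) \<union> (\<lambda>S. S - {a}) ` (Q \<inter> {S. a \<in> S})) +
        card ((Q \<inter> {S. a \<notin> S}) \<inter> (\<lambda>S. S - {a}) ` (Q \<inter> {S. a \<in> S}))"
      using fQ by (intro card_Un_Int) auto
    also have "(Q \<inter> {S. a \<notin> S}) \<union> (\<lambda>S. S - {a}) ` (Q \<inter> {S. a \<in> S}) = Q1"
    proof -
      have "(\<lambda>S. S - {a}) ` (Q \<inter> {S. a \<notin> S}) = id ` (Q \<inter> {S. a \<notin> S})"
        by (rule image_cong) auto
      moreover have "(\<lambda>S. S - {a}) ` Q = (\<lambda>S. S - {a}) ` (Q \<inter> {S. a \<notin> S}) \<union> (\<lambda>S. S - {a}) ` (Q \<inter> {S. a \<in> S})"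
        unfolding image_Un[symmetric] by (rule arg_cong[where f = "image _"]) blast
      ultimately show ?thesis unfolding Q1_def by (simp only: image_id id_apply)
    qed
    also have "(Q \<inter> {S. a \<notin> S}) \<inter> (\<lambda>S. S - {a}) ` (Q \<inter> {S. a \<in> S}) = Q2"
    proof -
      have "R \<in> (\<lambda>S. S - {a}) ` (Q \<inter> {S. a \<in> S}) \<longleftrightarrow> insert a R \<in> Q" if "a \<notin> R" for R
      proof
        assume "R \<in> (\<lambda>S. S - {a}) ` (Q \<inter> {S. a \<in> S})"
        then obtain S where "S \<in> Q" "a \<in> S" "R = S - {a}" by blast
        then show "insert a R \<in> Q" by (simp add: insert_absorb)
      next
        assume "insert a R \<in> Q"
        then show "R \<in> (\<lambda>S. S - {a}) ` (Q \<inter> {S. a \<in> S})"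
          using that by (intro image_eqI[of _ _ "insert a R"]) auto
      qed
      then show ?thesis unfolding Q2_def
        by (intro set_eqI iffI; elim IntE CollectE conjE; intro IntI CollectI conjI) simp_all
    qed
    finally show ?thesis .
  qed
  moreover have "vc_le Q1 d" by (rule vc_le_deletion[OF insert.prems(2)]) (auto simp: Q1_def)
  then have 1: "card Q1 \<le> (card A + 1) ^ d"
    using insert.prems by (intro insert.IH) (auto simp: Q1_def)
  moreover have "card Q1 + card Q2 \<le> (card A + 2) ^ d"
  proof (cases d)
    case 0
    then have "Q2 = {}" using vc_le_0_link[of Q a] insert.prems by (auto simp: Q2_def)
    then show ?thesis using 1 0 by simp
  next
    case (Suc d')
    have "vc_le Q2 d'" by (rule vc_le_link[of Q]) (use Suc insert.prems in \<open>auto simp: Q2_def\<close>)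
    then have "card Q2 \<le> (card A + 1) ^ d'"
      using insert.prems by (intro insert.IH) (auto simp: Q2_def)
    then have "card Q1 + card Q2 \<le> (card A + 2) * (card A + 1) ^ d'" using 1 Suc by simp
    also have "\<dots> \<le> (card A + 2) * (card A + 2) ^ d'" by (intro mult_left_mono power_mono) auto
    finally show ?thesis using Suc by simp
  qed
  ultimately show ?case using insert by simp
qed

text \<open>A weighted edge count of the one-inclusion graph. If \<open>w\<close> is the indicator
  of a family, it is the number of pairs of members that differ in one element.\<close>

definition edge_weight :: "'a set \<Rightarrow> ('a set \<Rightarrow> real) \<Rightarrow> real" where
  "edge_weight A w = (\<Sum>a\<in>A. \<Sum>R\<in>Pow (A - {a}). min (w R) (w (insert a R)))"

lemma sum_Pow_insert:
  assumes "finite A" "a \<notin> A"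
  shows "sum f (Pow (insert a A)) = (\<Sum>R\<in>Pow A. f R + f (insert a R))"
proof -
  have "sum f (Pow (insert a A)) = sum f (Pow A) + sum f (insert a ` Pow A)"
    unfolding Pow_insert using assms by (intro sum.union_disjoint) auto
  also have "sum f (insert a ` Pow A) = (\<Sum>R\<in>Pow A. f (insert a R))"
    using assms by (subst sum.reindex) (auto intro!: inj_onI)
  finally show ?thesis by (simp add: sum.distrib)
qed

text \<open>The weights pass to the deletion as \<open>max\<close> and to the link as \<open>min\<close>; this uses
  \<open>min x\<^sub>0 y\<^sub>0 + min x\<^sub>1 y\<^sub>1 \<le> min (max x\<^sub>0 x\<^sub>1) (max y\<^sub>0 y\<^sub>1) + min (min x\<^sub>0 x\<^sub>1) (min y\<^sub>0 y\<^sub>1)\<close>.\<close>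
lemma edge_weight_le:
  assumes "finite A" "\<And>S. w S \<ge> 0" "vc_le {S\<in>Pow A. w S > 0} d"
  shows "edge_weight A w \<le> real d * (\<Sum>S\<in>Pow A. w S)"
  using assms
proof (induction A arbitrary: w d rule: finite_induct)
  case empty
  then show ?case by (simp add: edge_weight_def)
next
  case (insert a A)
  define w1 where "w1 R = max (w R) (w (insert a R))" for R
  define w2 where "w2 R = min (w R) (w (insert a R))" for R
  have nonneg: "\<And>R. w1 R \<ge> 0" "\<And>R. w2 R \<ge> 0" using insert.prems(1) by (auto simp: w1_def w2_def le_max_iff_disj)
  have "edge_weight (insert a A) w = (\<Sum>R\<in>Pow A. w2 R) +
      (\<Sum>b\<in>A. \<Sum>R\<in>Pow (insert a A - {b}). min (w R) (w (insert b R)))"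
    using insert.hyps by (simp add: edge_weight_def w2_def)
  also have "(\<Sum>b\<in>A. \<Sum>R\<in>Pow (insert a A - {b}). min (w R) (w (insert b R))) \<le>
      (\<Sum>b\<in>A. \<Sum>R\<in>Pow (A - {b}). min (w1 R) (w1 (insert b R)) + min (w2 R) (w2 (insert b R)))"
  proof (intro sum_mono)
    fix b assume b: "b \<in> A"
    then have "insert a A - {b} = insert a (A - {b})" using insert.hyps by auto
    then have "(\<Sum>R\<in>Pow (insert a A - {b}). min (w R) (w (insert b R))) =
        (\<Sum>R\<in>Pow (A - {b}). min (w R) (w (insert b R)) + min (w (insert a R)) (w (insert b (insert a R))))"
      using insert.hyps by (simp add: sum_Pow_insert)
    also have "\<dots> \<le> (\<Sum>R\<in>Pow (A - {b}). min (w1 R) (w1 (insert b R)) + min (w2 R) (w2 (insert b R)))"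
      unfolding w1_def w2_def by (intro sum_mono) (auto simp: min_def max_def insert_commute)
    finally show "(\<Sum>R\<in>Pow (insert a A - {b}). min (w R) (w (insert b R))) \<le> \<dots>" .
  qed
  also have "\<dots> = edge_weight A w1 + edge_weight A w2"
    by (simp add: edge_weight_def sum.distrib)
  also have "edge_weight A w1 \<le> real d * (\<Sum>R\<in>Pow A. w1 R)"
  proof (intro insert.IH nonneg vc_le_deletion[OF insert.prems(2)])
    fix R assume R: "R \<in> {S\<in>Pow A. w1 S > 0}"
    then have "w R > 0 \<or> w (insert a R) > 0" by (auto simp: w1_def less_max_iff_disj)
    moreover have a: "a \<notin> R" using R insert.hyps by auto
    ultimately obtain S where "S \<in> {R, insert a R}" "w S > 0" by blast
    with R a show "a \<notin> R \<and> (\<exists>S\<in>{S\<in>Pow (insert a A). w S > 0}. S - {a} = R)"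
      by (intro conjI bexI[of _ S]) auto
  qed
  also have "(\<Sum>R\<in>Pow A. w2 R) + (real d * (\<Sum>R\<in>Pow A. w1 R) + edge_weight A w2) \<le>
     real d * (\<Sum>R\<in>Pow A. w1 R + w2 R)"
  proof (cases d)
    case 0
    have z: "w2 R = 0" if "R \<in> Pow A" for R
    proof (rule ccontr)
      assume "w2 R \<noteq> 0"
      then have "w R > 0" "w (insert a R) > 0" using nonneg(2)[of R] by (auto simp: w2_def min_def split: if_splits)
      then show False using vc_le_0_link[of "{S\<in>Pow (insert a A). w S > 0}" a R] insert 0 that by auto
    qed
    have "edge_weight A w2 \<le> 0"
      unfolding edge_weight_def
    proof (intro sum_nonpos)
      fix b R assume "R \<in> Pow (A - {b})"
      then have "w2 R = 0" by (intro z) auto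
      then show "min (w2 R) (w2 (insert b R)) \<le> 0" by simp
    qed
    moreover have "(\<Sum>R\<in>Pow A. w2 R) = 0" by (rule sum.neutral) (use z in blast)
    moreover have "real d = 0" using 0 by (simp only: of_nat_0)
    ultimately show ?thesis by (simp only: mult_zero_left add_0_left)
  next
    \<comment> \<open>The link contributes the factor \<open>d'\<close>; the edges in direction
      \<open>a\<close> add one more copy of the sum of \<open>w2\<close>, so \<open>w1\<close> and
      \<open>w2\<close> end up with the same factor \<open>d\<close>.\<close>
    case (Suc d')
    have "edge_weight A w2 \<le> real d' * (\<Sum>R\<in>Pow A. w2 R)"
    proof (rule insert.IH[OF nonneg(2)], rule vc_le_link[where a = a])
      show "vc_le {S\<in>Pow (insert a A). w S > 0} (Suc d')" using Suc insert.prems by simp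
      fix R assume R: "R \<in> {S\<in>Pow A. w2 S > 0}"
      then show "a \<notin> R \<and> R \<in> {S \<in> Pow (insert a A). 0 < w S} \<and> insert a R \<in> {S \<in> Pow (insert a A). 0 < w S}"
        using insert.hyps by (auto simp: w2_def)
    qed
    then show ?thesis using Suc by (simp add: sum.distrib algebra_simps)
  qed
  also have "(\<Sum>R\<in>Pow A. w1 R + w2 R) = (\<Sum>S\<in>Pow (insert a A). w S)"
    using insert.hyps unfolding sum_Pow_insert[OF insert.hyps] w1_def w2_def
    by (intro sum.cong refl) (simp add: max_def min_def)
  finally show ?case by simp
qed


section \<open>Haussler's packing bound\<close>

lemma sum_PiE_remove:
  assumes "finite B" "t \<in> B"
  shows "(\<Sum>a\<in>B \<rightarrow>\<^sub>E I. f a) = (\<Sum>a\<in>(B - {t}) \<rightarrow>\<^sub>E I. \<Sum>i\<in>I. f (a(t := i)))"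
proof -
  have "B \<rightarrow>\<^sub>E I = (\<lambda>(y, g). g(t := y)) ` (I \<times> ((B - {t}) \<rightarrow>\<^sub>E I))"
    using PiE_insert_eq[of t "B - {t}" "\<lambda>_. I"] assms by (simp add: insert_absorb)
  moreover have "inj_on (\<lambda>(y, g). g(t := y)) (I \<times> ((B - {t}) \<rightarrow>\<^sub>E I))"
    using inj_combinator[of t "B - {t}" "\<lambda>_. I"] by simp
  ultimately have "(\<Sum>a\<in>B \<rightarrow>\<^sub>E I. f a) = (\<Sum>(i, a)\<in>I \<times> ((B - {t}) \<rightarrow>\<^sub>E I). f (a(t := i)))"
    by (simp add: sum.reindex case_prod_unfold comp_def)
  also have "\<dots> = (\<Sum>i\<in>I. \<Sum>a\<in>(B - {t}) \<rightarrow>\<^sub>E I. f (a(t := i)))"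
    by (simp add: sum.cartesian_product)
  also have "\<dots> = (\<Sum>a\<in>(B - {t}) \<rightarrow>\<^sub>E I. \<Sum>i\<in>I. f (a(t := i)))" by (rule sum.swap)
  finally show ?thesis .
qed

text \<open>Double counting of separated ordered pairs: an element \<open>i\<close> splits
  \<open>C\<close> into parts of sizes n and p and separates 2 n p pairs, and n p is at most
  \<open>card C\<close> times the smaller part. Separation by \<open>q\<close> bounds the total from
  below.\<close>

lemma min_split_sum_ge:
  fixes S :: "'x \<Rightarrow> 'i set" and q :: nat
  assumes fin: "finite C" "finite I" and S: "\<And>x. x \<in> C \<Longrightarrow> S x \<subseteq> I"
    and sep: "\<And>x y. x \<in> C \<Longrightarrow> y \<in> C \<Longrightarrow> x \<noteq> y \<Longrightarrow> q \<le> card ((S x - S y) \<union> (S y - S x))"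
    and ne: "C \<noteq> {}"
  shows "real q * (real (card C) - 1) \<le>
    2 * (\<Sum>i\<in>I. min (real (card {x\<in>C. i \<notin> S x})) (real (card {x\<in>C. i \<in> S x})))"
proof -
  let ?b = "real (card C)"
  let ?n = "\<lambda>i. real (card {x\<in>C. i \<notin> S x})" and ?p = "\<lambda>i. real (card {x\<in>C. i \<in> S x})"
  have b: "?b > 0" using fin ne by (simp add: card_gt_0_iff)
  have "real q * (?b * (?b - 1)) \<le> (\<Sum>x\<in>C. \<Sum>y\<in>C. real (card ((S x - S y) \<union> (S y - S x))))"
  proof -
    have "real q * (?b * (?b - 1)) = (\<Sum>x\<in>C. \<Sum>y\<in>C - {x}. real q)"
      using fin b by (simp add: of_nat_diff Suc_leI card_gt_0_iff ne)
    also have "\<dots> \<le> (\<Sum>x\<in>C. \<Sum>y\<in>C - {x}. real (card ((S x - S y) \<union> (S y - S x))))"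
      using sep by (intro sum_mono of_nat_mono) auto
    also have "\<dots> \<le> (\<Sum>x\<in>C. \<Sum>y\<in>C. real (card ((S x - S y) \<union> (S y - S x))))"
      using fin by (intro sum_mono sum_mono2) auto
    finally show ?thesis .
  qed
  also have "\<dots> \<le> (\<Sum>x\<in>C. \<Sum>y\<in>C. real (card (S x - S y)) + real (card (S y - S x)))"
    by (intro sum_mono) (simp add: card_Un_le flip: of_nat_add)
  also have "\<dots> = 2 * (\<Sum>x\<in>C. \<Sum>y\<in>C. real (card (S x - S y)))"
  proof -
    have "(\<Sum>x\<in>C. \<Sum>y\<in>C. real (card (S y - S x))) = (\<Sum>x\<in>C. \<Sum>y\<in>C. real (card (S x - S y)))"
      by (rule sum.swap)
    then show ?thesis by (simp add: sum.distrib)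
  qed
  also have "(\<Sum>x\<in>C. \<Sum>y\<in>C. real (card (S x - S y))) = (\<Sum>i\<in>I. ?n i * ?p i)"
  proof -
    have card_sum: "real (card (S x - S y)) = (\<Sum>i\<in>I. of_bool (i \<in> S x) * of_bool (i \<notin> S y))" if "x \<in> C" for x y
    proof -
      have "(\<Sum>i\<in>I. of_bool (i \<in> S x) * of_bool (i \<notin> S y)) = (\<Sum>i\<in>I. if i \<in> S x - S y then 1 else (0::real))"
        by (intro sum.cong) auto
      also have "\<dots> = real (card (I \<inter> (S x - S y)))" using fin by (subst sum.inter_restrict[symmetric]) simp_all
      also have "I \<inter> (S x - S y) = S x - S y" using S[OF that] by blast
      finally show ?thesis by simp
    qed
    have "(\<Sum>x\<in>C. \<Sum>y\<in>C. real (card (S x - S y))) =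
        (\<Sum>x\<in>C. \<Sum>y\<in>C. \<Sum>i\<in>I. of_bool (i \<in> S x) * of_bool (i \<notin> S y))"
      by (intro sum.cong refl card_sum)
    also have "\<dots> = (\<Sum>x\<in>C. \<Sum>i\<in>I. \<Sum>y\<in>C. of_bool (i \<in> S x) * of_bool (i \<notin> S y))"
      by (intro sum.cong refl sum.swap)
    also have "\<dots> = (\<Sum>i\<in>I. \<Sum>x\<in>C. \<Sum>y\<in>C. of_bool (i \<in> S x) * of_bool (i \<notin> S y))"
      by (rule sum.swap)
    also have "\<dots> = (\<Sum>i\<in>I. (\<Sum>x\<in>C. of_bool (i \<in> S x)) * (\<Sum>y\<in>C. of_bool (i \<notin> S y)))"
      by (simp add: sum_product)
    also have "\<dots> = (\<Sum>i\<in>I. ?n i * ?p i)"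
      using fin by (simp add: of_bool_def sum.If_cases Int_def mult.commute conj_commute)
    finally show ?thesis .
  qed
  also have "(\<Sum>i\<in>I. ?n i * ?p i) \<le> (\<Sum>i\<in>I. ?b * min (?n i) (?p i))"
  proof (intro sum_mono)
    fix i
    have "?n i \<le> ?b" "?p i \<le> ?b" using fin by (auto intro!: card_mono)
    then have "?n i * ?p i \<le> ?b * ?p i" "?n i * ?p i \<le> ?n i * ?b"
      by (intro mult_right_mono mult_left_mono; simp)+
    then show "?n i * ?p i \<le> ?b * min (?n i) (?p i)"
      by (simp only: min_def mult.commute split: if_split) simp
  qed
  also have "\<dots> = ?b * (\<Sum>i\<in>I. min (?n i) (?p i))" by (simp add: sum_distrib_left)
  finally have "?b * (real q * (?b - 1)) \<le> ?b * (2 * (\<Sum>i\<in>I. min (?n i) (?p i)))"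
    by (simp add: algebra_simps)
  then show ?thesis using b by (simp only: mult_le_cancel_left_pos)
qed

lemma sum_card_fibres:
  assumes "finite P" "finite T" "g ` P \<subseteq> T"
  shows "(\<Sum>R\<in>T. real (card {x\<in>P. g x = R})) = real (card P)"
proof -
  have "real (card P) = (\<Sum>x\<in>P. 1)" by simp
  also have "\<dots> = (\<Sum>R\<in>T. real (card {x\<in>P. g x = R}) * 1)"
    using assms by (subst sum_fun_comp[of P T g]) auto
  finally show ?thesis by simp
qed

text \<open>Haussler's packing bound, with \<open>s\<close> samples drawn with replacement: over all samples, the weighted
  number of unit-distance edges in the direction of a fixed sample point is large unless most elements
  of \<open>P\<close> are already told apart by the other samples.\<close>
lemma haussler_packing:
  fixes S :: "'x \<Rightarrow> 'i set" and q s d :: nat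
  assumes fin: "finite P" "finite I" and S: "\<And>x. x \<in> P \<Longrightarrow> S x \<subseteq> I"
    and sep: "\<And>x y. x \<in> P \<Longrightarrow> y \<in> P \<Longrightarrow> x \<noteq> y \<Longrightarrow> q \<le> card ((S x - S y) \<union> (S y - S x))"
    and vc: "\<And>(B::nat set) a. finite B \<Longrightarrow> vc_le ((\<lambda>x. {t\<in>B. a t \<in> S x}) ` P) d"
    and s: "4 * d * card I \<le> s * q" and pos: "d > 0" "card I > 0"
  shows "card P \<le> 2 * s ^ d"
proof -
  define n where "n = real (card I)"
  have n: "n > 0" using pos by (simp add: n_def)
  define tr where "tr B a x = {t\<in>B. a t \<in> S x}" for B :: "nat set" and a x
  define w where "w a R = real (card {x\<in>P. tr {..<s} a x = R})" for a R
  have s0: "s > 0" using s pos by (cases s) auto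
  have w_sum: "(\<Sum>R\<in>Pow {..<s}. w a R) = real (card P)" for a
    unfolding w_def using fin by (intro sum_card_fibres) (auto simp: tr_def)
  have upper: "edge_weight {..<s} (w a) \<le> real d * real (card P)" for a
    unfolding w_sum[of a, symmetric]
  proof (rule edge_weight_le)
    have "{R\<in>Pow {..<s}. 0 < w a R} \<subseteq> (\<lambda>x. {t\<in>{..<s}. a t \<in> S x}) ` P"
      unfolding w_def tr_def by (auto simp: card_gt_0_iff)
    then show "vc_le {R\<in>Pow {..<s}. 0 < w a R} d"
      using vc[of "{..<s}" a] unfolding vc_le_def by (meson finite_lessThan image_mono order_trans)
  qed (auto simp: w_def)
  \<comment> \<open>With the samples other than \<open>t\<close> fixed, \<open>P\<close> falls into
    the classes \<open>cl R\<close> of equal trace. Letting the \<open>t\<close>-th sample run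
    through \<open>I\<close> splits each class, and a split is an edge in direction \<open>t\<close>
    whose weight is the smaller part.\<close>
  have lower: "(\<Sum>i\<in>I. \<Sum>R\<in>Pow ({..<s} - {t}). min (w (a(t := i)) R) (w (a(t := i)) (insert t R)))
      \<ge> real q / 2 * (real (card P) - real (s ^ d))" if t: "t < s" for a t
  proof -
    let ?B = "{..<s} - {t}"
    define cl where "cl R = {x\<in>P. tr ?B a x = R}" for R
    define TR where "TR = tr ?B a ` P"
    have w0: "w (a(t := i)) R = real (card {x\<in>cl R. i \<notin> S x})"
      and w1: "w (a(t := i)) (insert t R) = real (card {x\<in>cl R. i \<in> S x})" if R: "R \<in> Pow ?B" for i R
    proof -
      have "tr {..<s} (a(t := i)) x = (if i \<in> S x then insert t (tr ?B a x) else tr ?B a x)" for x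
        using t by (auto simp: tr_def)
      moreover have "t \<notin> R" "t \<notin> tr ?B a x" for x using R by (auto simp: tr_def)
      ultimately have "{x\<in>P. tr {..<s} (a(t := i)) x = R} = {x\<in>cl R. i \<notin> S x}"
        "{x\<in>P. tr {..<s} (a(t := i)) x = insert t R} = {x\<in>cl R. i \<in> S x}"
        unfolding cl_def by (auto dest: insert_ident[THEN iffD1, rotated 2] split: if_splits)
      then show "w (a(t := i)) R = real (card {x\<in>cl R. i \<notin> S x})"
        "w (a(t := i)) (insert t R) = real (card {x\<in>cl R. i \<in> S x})" by (simp_all add: w_def)
    qed
    have TR: "TR \<subseteq> Pow ?B" "finite TR" using fin by (auto simp: TR_def tr_def)
    have "vc_le TR d" unfolding TR_def tr_def by (rule vc) simp
    then have "card TR \<le> (card ?B + 1) ^ d" using TR by (intro sauer_bound) auto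
    \<comment> \<open>There are \<open>s - 1\<close> other samples, so the Sauer bound is exactly
      \<open>s ^ d\<close>.\<close>
    then have cTR: "card TR \<le> s ^ d" using t by simp
    have "real (card P) = (\<Sum>R\<in>TR. real (card (cl R)))"
      unfolding cl_def using fin TR by (intro sum_card_fibres[symmetric]) (auto simp: TR_def)
    then have "real q / 2 * (real (card P) - real (card TR)) = (\<Sum>R\<in>TR. real q / 2 * (real (card (cl R)) - 1))"
      by (simp only: sum_distrib_left[symmetric] sum_subtractf sum_constant mult_1_right)
    also have "\<dots> \<le> (\<Sum>R\<in>TR. \<Sum>i\<in>I. min (w (a(t := i)) R) (w (a(t := i)) (insert t R)))"
    proof (intro sum_mono)
      fix R assume R: "R \<in> TR"
      then have "cl R \<noteq> {}" by (auto simp: TR_def cl_def)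
      then have "real q * (real (card (cl R)) - 1) \<le>
          2 * (\<Sum>i\<in>I. min (real (card {x\<in>cl R. i \<notin> S x})) (real (card {x\<in>cl R. i \<in> S x})))"
        using fin S sep by (intro min_split_sum_ge) (auto simp: cl_def)
      then show "real q / 2 * (real (card (cl R)) - 1) \<le>
          (\<Sum>i\<in>I. min (w (a(t := i)) R) (w (a(t := i)) (insert t R)))"
        using w0[of R] w1[of R] R TR by auto
    qed
    also have "\<dots> \<le> (\<Sum>R\<in>Pow ?B. \<Sum>i\<in>I. min (w (a(t := i)) R) (w (a(t := i)) (insert t R)))"
      using TR by (intro sum_mono2) (auto intro!: sum_nonneg simp: w_def)
    also have "\<dots> = (\<Sum>i\<in>I. \<Sum>R\<in>Pow ?B. min (w (a(t := i)) R) (w (a(t := i)) (insert t R)))"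
      by (rule sum.swap)
    finally show ?thesis
      using cTR by (smt (verit) divide_nonneg_nonneg mult_left_mono of_nat_0_le_iff of_nat_mono)
  qed
  let ?SQ = "{..<s} \<rightarrow>\<^sub>E I"
  have cSQ: "real (card ?SQ) = n ^ s" by (simp add: card_PiE n_def)
  have "real s * n ^ (s - 1) * (real q / 2 * (real (card P) - real (s ^ d))) =
      (\<Sum>t<s. \<Sum>a\<in>({..<s} - {t}) \<rightarrow>\<^sub>E I. real q / 2 * (real (card P) - real (s ^ d)))"
    by (simp add: card_PiE n_def)
  also have "\<dots> \<le> (\<Sum>t<s. \<Sum>a\<in>({..<s} - {t}) \<rightarrow>\<^sub>E I.
      \<Sum>i\<in>I. \<Sum>R\<in>Pow ({..<s} - {t}). min (w (a(t := i)) R) (w (a(t := i)) (insert t R)))"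
    by (intro sum_mono lower) simp
  also have "\<dots> = (\<Sum>t<s. \<Sum>a\<in>?SQ. \<Sum>R\<in>Pow ({..<s} - {t}). min (w a R) (w a (insert t R)))"
  proof (rule sum.cong[OF refl])
    fix t assume "t \<in> {..<s}"
    from sum_PiE_remove[OF finite_lessThan this, where I = I and
        f = "\<lambda>a. \<Sum>R\<in>Pow ({..<s} - {t}). min (w a R) (w a (insert t R))"]
    show "(\<Sum>a\<in>({..<s} - {t}) \<rightarrow>\<^sub>E I. \<Sum>i\<in>I. \<Sum>R\<in>Pow ({..<s} - {t}).
        min (w (a(t := i)) R) (w (a(t := i)) (insert t R))) =
      (\<Sum>a\<in>?SQ. \<Sum>R\<in>Pow ({..<s} - {t}). min (w a R) (w a (insert t R)))" by (rule sym)
  qed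
  also have "\<dots> = (\<Sum>a\<in>?SQ. edge_weight {..<s} (w a))"
    unfolding edge_weight_def by (rule sum.swap)
  also have "\<dots> \<le> (\<Sum>a\<in>?SQ. real d * real (card P))" by (intro sum_mono upper)
  also have "\<dots> = n ^ (s - 1) * (n * real d * real (card P))"
    using s0 by (simp add: cSQ power_eq_if)
  finally have "n ^ (s - 1) * (real s * (real q / 2 * (real (card P) - real (s ^ d)))) \<le>
      n ^ (s - 1) * (n * real d * real (card P))" by (simp add: mult_ac)
  then have "real s * (real q / 2 * (real (card P) - real (s ^ d))) \<le> n * real d * real (card P)"
    using n by (subst (asm) mult_le_cancel_left_pos) auto
  then have le: "real s * real q * (real (card P) - real (s ^ d)) \<le> 2 * n * real d * real (card P)"
    by simp
  show ?thesis
  proof (rule ccontr)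
    assume "\<not> ?thesis"
    then have big: "real (card P) > 2 * real (s ^ d)" by (metis not_le of_nat_less_iff of_nat_mult of_nat_numeral)
    \<comment> \<open>The sample size is twice what the comparison of the two counts needs, so
      \<open>card P - s ^ d\<close> is at most half of \<open>card P\<close>.\<close>
    have "4 * real d * n \<le> real s * real q"
      using s unfolding n_def by (metis of_nat_le_iff of_nat_mult of_nat_numeral)
    then have "4 * real d * n * (real (card P) - real (s ^ d)) \<le> real s * real q * (real (card P) - real (s ^ d))"
      using big of_nat_0_le_iff[of "s ^ d", where ?'a = real] by (intro mult_right_mono) linarith+
    with le have "(2 * n * real d) * (2 * (real (card P) - real (s ^ d))) \<le> (2 * n * real d) * real (card P)"
      by (simp add: algebra_simps)
    then have "2 * (real (card P) - real (s ^ d)) \<le> real (card P)"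
      using n pos by (subst (asm) mult_le_cancel_left_pos) auto
    with big show False by simp
  qed
qed

section \<open>Nets for halfspaces\<close>

abbreviation in_halfspace :: "real^'d \<Rightarrow> (real^'d::finite) \<times> real \<Rightarrow> bool" where
  "in_halfspace x p \<equiv> 0 \<le> fst p \<bullet> x + snd p"

text \<open>The bound is \<open>CARD('d)\<close> and not \<open>CARD('d) + 1\<close>: a linear relation \<open>\<Sum>t. y t *\<^sub>R \<omega> t = 0\<close> makes
  \<open>\<Sum>t. y t * (\<omega> t \<bullet> x + b t)\<close> independent of \<open>x\<close>, so the sign patterns of \<open>y\<close> and of \<open>- y\<close> cannot both occur.\<close>
lemma vc_le_halfspaces:
  fixes h :: "'i \<Rightarrow> (real^'d::finite) \<times> real"
  assumes "finite B"
  shows "vc_le ((\<lambda>x. {t\<in>B. in_halfspace x (h t)}) ` P) CARD('d)"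
  unfolding vc_le_def
proof (intro allI impI notI)
  fix T assume T: "finite T" "card T = Suc CARD('d)"
    and sh: "Pow T \<subseteq> (\<lambda>S. S \<inter> T) ` ((\<lambda>x. {t\<in>B. in_halfspace x (h t)}) ` P)"
  define f where "f t x = fst (h t) \<bullet> x + snd (h t)" for t x
  have pat: "\<exists>x. \<forall>t\<in>T. (t \<in> B \<and> f t x \<ge> 0) = (t \<in> Z)" if "Z \<subseteq> T" for Z
  proof -
    have "Z \<in> (\<lambda>S. S \<inter> T) ` ((\<lambda>x. {t\<in>B. in_halfspace x (h t)}) ` P)" using sh that by blast
    then obtain x where "Z = {t\<in>B. in_halfspace x (h t)} \<inter> T" by blast
    then show ?thesis unfolding f_def by (intro exI[of _ x]) blast
  qed
  have TB: "T \<subseteq> B" using pat[of T] by blast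
  define V where "V = (\<lambda>c t. fst (h t) $ c) ` (UNIV :: 'd set)"
  have "card V \<le> CARD('d)" unfolding V_def by (rule card_image_le) simp
  then obtain y where y: "\<exists>t\<in>T. y t \<noteq> 0" "\<forall>v\<in>V. (\<Sum>t\<in>T. v t * y t) = 0"
    using homogeneous_system_nontrivial[of V T] T by (auto simp: V_def)
  \<comment> \<open>The pattern that includes \<open>t\<close> exactly when
    \<open>z t \<ge> 0\<close> makes every \<open>z t * f t x\<close> nonnegative, and positive
    where \<open>z t < 0\<close> because the halfspaces are closed. For \<open>y\<close> and
    \<open>- y\<close> the resulting sums are opposite and nonnegative, yet one of them is
    positive.\<close>
  have key: "(\<Sum>t\<in>T. z t * snd (h t)) \<ge> 0 \<and> ((\<exists>t\<in>T. z t < 0) \<longrightarrow> (\<Sum>t\<in>T. z t * snd (h t)) > 0)"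
    if z: "\<And>c. (\<Sum>t\<in>T. z t * fst (h t) $ c) = 0" for z
  proof -
    obtain x where x: "\<forall>t\<in>T. (t \<in> B \<and> f t x \<ge> 0) = (t \<in> {t\<in>T. z t \<ge> 0})"
      using pat[of "{t\<in>T. z t \<ge> 0}"] by blast
    have iff: "f t x \<ge> 0 \<longleftrightarrow> z t \<ge> 0" if "t \<in> T" for t using x TB that by auto
    have nonneg: "z t * f t x \<ge> 0" if "t \<in> T" for t
      using iff[OF that] by (simp add: zero_le_mult_iff) linarith
    have pos: "z t * f t x > 0" if "t \<in> T" "z t < 0" for t
      using iff[OF that(1)] that(2) by (intro mult_neg_neg) auto
    have "(\<Sum>t\<in>T. z t * f t x) = (\<Sum>t\<in>T. z t * (fst (h t) \<bullet> x)) + (\<Sum>t\<in>T. z t * snd (h t))"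
      by (simp add: f_def algebra_simps sum.distrib)
    also have "(\<Sum>t\<in>T. z t * (fst (h t) \<bullet> x)) = (\<Sum>t\<in>T. \<Sum>c\<in>UNIV. x $ c * (z t * fst (h t) $ c))"
      by (simp add: inner_vec_def sum_distrib_left mult_ac)
    also have "\<dots> = (\<Sum>c\<in>UNIV. x $ c * (\<Sum>t\<in>T. z t * fst (h t) $ c))"
      by (subst sum.swap) (simp add: sum_distrib_left)
    also have "\<dots> = 0" using z by simp
    finally have eq: "(\<Sum>t\<in>T. z t * snd (h t)) = (\<Sum>t\<in>T. z t * f t x)" by simp
    show ?thesis unfolding eq
    proof (intro conjI impI)
      show "(\<Sum>t\<in>T. z t * f t x) \<ge> 0" using nonneg by (intro sum_nonneg)
      assume "\<exists>t\<in>T. z t < 0"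
      then obtain t where "t \<in> T" "z t < 0" by blast
      then show "(\<Sum>t\<in>T. z t * f t x) > 0" using nonneg pos T by (intro sum_pos2[of T t]) auto
    qed
  qed
  have z: "(\<Sum>t\<in>T. y t * fst (h t) $ c) = 0" for c using y(2) by (auto simp: V_def mult.commute)
  have "(\<Sum>t\<in>T. (- y t) * fst (h t) $ c) = 0" for c using z[of c] by (simp add: sum_negf)
  from key[OF z] key[OF this] y(1) show False
    by (auto simp: sum_negf neq_iff)
qed

text \<open>The thresholds \<open>2 * t / M - 1\<close> have spacing \<open>2 / M\<close>, so an
  interval longer than \<open>2 * q / M\<close> inside [-1,1] contains at least \<open>q\<close> of
  them.\<close>

lemma grid_count:
  fixes u v :: real
  assumes "-1 \<le> u" "u \<le> v" "v \<le> 1" "M > 0"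
    and "card {t\<in>{1..M}. (0 \<le> u + (1 - 2 * real t / real M)) \<noteq> (0 \<le> v + (1 - 2 * real t / real M))} < q"
  shows "v - u \<le> 2 * real q / real M"
proof -
  define a b where "a = (u + 1) * real M / 2" and "b = (v + 1) * real M / 2"
  have "0 \<le> (u + 1) * real M" "(u + 1) * real M \<le> (v + 1) * real M" "(v + 1) * real M \<le> 2 * real M"
    using assms(1-4) by (intro mult_nonneg_nonneg mult_right_mono; simp)+
  then have ab: "0 \<le> a" "a \<le> b" "b \<le> real M" by (auto simp: a_def b_def)
  have iff: "(0 \<le> u + (1 - 2 * real t / real M)) = (real t \<le> a)" "(0 \<le> v + (1 - 2 * real t / real M)) = (real t \<le> b)" for t
    using assms(4) by (auto simp: a_def b_def field_simps)
  have "{nat \<lfloor>a\<rfloor> <.. nat \<lfloor>b\<rfloor>} \<subseteq> {t\<in>{1..M}. (real t \<le> a) \<noteq> (real t \<le> b)}"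
  proof
    fix t assume "t \<in> {nat \<lfloor>a\<rfloor> <.. nat \<lfloor>b\<rfloor>}"
    then have "a < real t" "real t \<le> b" using ab by (auto simp: nat_less_iff le_nat_iff floor_less_iff le_floor_iff)
    then show "t \<in> {t\<in>{1..M}. (real t \<le> a) \<noteq> (real t \<le> b)}" using ab by auto
  qed
  then have "card {nat \<lfloor>a\<rfloor> <.. nat \<lfloor>b\<rfloor>} \<le> card {t\<in>{1..M}. (real t \<le> a) \<noteq> (real t \<le> b)}"
    by (intro card_mono) auto
  with assms(5) have "nat \<lfloor>b\<rfloor> - nat \<lfloor>a\<rfloor> < q" unfolding iff by simp
  then have "nat \<lfloor>b\<rfloor> < q + nat \<lfloor>a\<rfloor>" by linarith
  then have "real (nat \<lfloor>b\<rfloor>) + 1 \<le> real q + real (nat \<lfloor>a\<rfloor>)" by linarith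
  moreover have "real (nat \<lfloor>b\<rfloor>) > b - 1" "real (nat \<lfloor>a\<rfloor>) \<le> a" using ab by linarith+
  ultimately have "b - a \<le> real q" by linarith
  then show ?thesis using assms(4) by (simp add: a_def b_def field_simps)
qed

text \<open>To control the distance to the net along with the number of separated points, the point set is
  enriched by \<open>M\<close> equally spaced coordinate halfspaces in each coordinate direction.\<close>
lemma halfspace_net:
  fixes J :: "((real^'d::finite) \<times> real) set"
  assumes J: "finite J" "card J = M" and q: "1 \<le> q" "q \<le> M"
  shows "\<exists>N\<subseteq>cball 0 1. finite N \<and>
    real (card N) \<le> 2 * (8 * real CARD('d) * (real CARD('d) + 1) * (real M / real q)) ^ CARD('d) \<and>
    (\<forall>x\<in>cball 0 1. \<exists>x'\<in>N. card {p\<in>J. in_halfspace x p \<noteq> in_halfspace x' p} < q \<and>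
      (\<Sum>c\<in>UNIV. \<bar>x $ c - x' $ c\<bar>) \<le> 2 * real CARD('d) * (real q / real M))"
proof -
  let ?d = "CARD('d)"
  have M: "M > 0" using q by simp
  define h :: "((real^'d) \<times> real) + ('d \<times> nat) \<Rightarrow> (real^'d) \<times> real" where
    "h i = (case i of Inl p \<Rightarrow> p | Inr (c, t) \<Rightarrow> (axis c 1, 1 - 2 * real t / real M))" for i
  define I where "I = J <+> (UNIV :: 'd set) \<times> {1..M}"
  define S where "S x = {i\<in>I. in_halfspace x (h i)}" for x
  have fI: "finite I" and cI: "card I = M * (?d + 1)"
    using J by (auto simp: I_def card_Plus card_cartesian_product)
  define sep where "sep N \<longleftrightarrow> (\<forall>x\<in>N. \<forall>y\<in>N. x \<noteq> y \<longrightarrow> q \<le> card ((S x - S y) \<union> (S y - S x)))" for N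
  \<comment> \<open>Chosen so that \<open>4 * d * card I \<le> s * q\<close>, where
    \<open>card I = M * (d + 1)\<close> and \<open>M div q + 1\<close> exceeds
    \<open>M / q\<close>.\<close>
  define s where "s = 4 * ?d * (?d + 1) * (M div q + 1)"
  have bound: "card N \<le> 2 * s ^ ?d" if N: "finite N" "sep N" for N
  proof (rule haussler_packing[OF N(1) fI])
    fix B :: "nat set" and a assume B: "finite B"
    have "{t\<in>B. a t \<in> S x} = {t\<in>{t\<in>B. a t \<in> I}. in_halfspace x (h (a t))}" for x by (auto simp: S_def)
    then show "vc_le ((\<lambda>x. {t\<in>B. a t \<in> S x}) ` N) ?d"
      using vc_le_halfspaces[of "{t\<in>B. a t \<in> I}" "\<lambda>t. h (a t)" N] B by simp
  next
    have "M \<le> (M div q + 1) * q"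
      using q by (metis Suc_eq_plus1 dividend_less_div_times less_imp_le mult.commute add.commute
          mult_Suc zero_less_one less_le_trans)
    then have "4 * ?d * (?d + 1) * M \<le> 4 * ?d * (?d + 1) * ((M div q + 1) * q)" by (rule mult_left_mono) simp
    then show "4 * ?d * card I \<le> s * q" unfolding cI s_def by (simp only: mult.assoc mult.commute[of M])
  qed (use N M in \<open>auto simp: sep_def S_def cI\<close>)
  define fam where "fam N \<longleftrightarrow> finite N \<and> N \<subseteq> cball 0 1 \<and> sep N" for N
  have "fam {}" by (simp add: fam_def sep_def)
  moreover have "\<forall>N. fam N \<longrightarrow> card N \<le> 2 * s ^ ?d" using bound by (simp add: fam_def)
  \<comment> \<open>Separated sets have bounded size, so a largest one exists. A point far from all
    its members could be added, hence it is a net.\<close>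
  ultimately obtain N where N: "fam N" and max: "\<And>N'. fam N' \<Longrightarrow> card N' \<le> card N"
    using ex_has_greatest_nat[of fam "{}" card "2 * s ^ ?d + 1"] by (auto simp: less_Suc_eq_le)
  have sym: "(S x - S y) \<union> (S y - S x) = (S y - S x) \<union> (S x - S y)" for x y by blast
  have "\<exists>x'\<in>N. card {p\<in>J. in_halfspace x p \<noteq> in_halfspace x' p} < q \<and>
      (\<Sum>c\<in>UNIV. \<bar>x $ c - x' $ c\<bar>) \<le> 2 * real ?d * (real q / real M)" if x: "x \<in> cball 0 1" for x
  proof -
    have "\<exists>x'\<in>N. card ((S x - S x') \<union> (S x' - S x)) < q"
    proof (rule ccontr)
      assume far: "\<not> ?thesis"
      have "x \<notin> N"
      proof
        assume "x \<in> N"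
        with far have "\<not> card ((S x - S x) \<union> (S x - S x)) < q" by blast
        then show False using q by simp
      qed
      moreover have "sep (insert x N)"
        unfolding sep_def
      proof (intro ballI impI)
        fix y z assume yz: "y \<in> insert x N" "z \<in> insert x N" "y \<noteq> z"
        consider "y \<in> N" "z \<in> N" | "y = x" "z \<in> N" | "z = x" "y \<in> N" using yz by blast
        then show "q \<le> card ((S y - S z) \<union> (S z - S y))"
        proof cases
          case 1
          then show ?thesis using N yz by (simp add: fam_def sep_def)
        next
          case 2
          then show ?thesis using far by (simp add: not_less)
        next
          case 3
          then show ?thesis using far by (subst sym) (simp add: not_less)
        qed
      qed
      then have "fam (insert x N)" using N x by (simp add: fam_def)
      from max[OF this] show False using \<open>x \<notin> N\<close> N by (simp add: fam_def)
    qed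
    then obtain x' where x': "x' \<in> N" "card ((S x - S x') \<union> (S x' - S x)) < q" by blast
    have fin: "finite ((S x - S x') \<union> (S x' - S x))" using fI by (auto simp: S_def)
    have "card {p\<in>J. in_halfspace x p \<noteq> in_halfspace x' p} = card (Inl ` {p\<in>J. in_halfspace x p \<noteq> in_halfspace x' p} :: (((real^'d) \<times> real) + ('d \<times> nat)) set)"
      by (intro card_image[symmetric]) auto
    also have "\<dots> \<le> card ((S x - S x') \<union> (S x' - S x))"
      by (rule card_mono[OF fin]) (auto simp: S_def I_def h_def)
    finally have 1: "card {p\<in>J. in_halfspace x p \<noteq> in_halfspace x' p} < q" using x' by simp
    have 2: "\<bar>x $ c - x' $ c\<bar> \<le> 2 * real q / real M" for c
    proof -
      define D where "D = (\<lambda>u v. {t\<in>{1..M}. (0 \<le> u + (1 - 2 * real t / real M)) \<noteq> (0 \<le> v + (1 - 2 * real t / real M))})"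
      have "card (D (x $ c) (x' $ c)) = card ((\<lambda>t. Inr (c, t)) ` D (x $ c) (x' $ c) :: (((real^'d) \<times> real) + ('d \<times> nat)) set)"
        by (intro card_image[symmetric] inj_onI) auto
      also have "\<dots> \<le> card ((S x - S x') \<union> (S x' - S x))"
        by (rule card_mono[OF fin]) (auto simp: S_def I_def h_def D_def inner_axis' inner_axis)
      finally have D1: "card (D (x $ c) (x' $ c)) < q" using x' by simp
      moreover have "D (x' $ c) (x $ c) = D (x $ c) (x' $ c)" by (auto simp: D_def)
      ultimately have D2: "card (D (x' $ c) (x $ c)) < q" by simp
      have b: "\<bar>z $ c\<bar> \<le> 1" if "z \<in> cball 0 1" for z :: "real^'d"
        using that component_le_norm_cart[of z c] by simp
      have "x' \<in> cball 0 1" using N x' by (auto simp: fam_def)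
      from b[OF x] b[OF this] show ?thesis
        using grid_count[of "x $ c" "x' $ c" M q] grid_count[of "x' $ c" "x $ c" M q] D1 D2 M
        unfolding D_def by (cases "x $ c \<le> x' $ c") auto
    qed
    have "(\<Sum>c\<in>UNIV. \<bar>x $ c - x' $ c\<bar>) \<le> (\<Sum>c\<in>(UNIV::'d set). 2 * real q / real M)" by (intro sum_mono 2)
    also have "\<dots> = 2 * real ?d * (real q / real M)" by simp
    finally show ?thesis using 1 x'(1) by blast
  qed
  moreover have "real (card N) \<le> 2 * (8 * real ?d * (real ?d + 1) * (real M / real q)) ^ ?d"
  proof -
    have "real (M div q) + 1 \<le> real M / real q + real M / real q"
      using q by (intro add_mono) (auto simp: of_nat_div_le_of_nat)
    then have "real s \<le> 4 * real ?d * (real ?d + 1) * (2 * (real M / real q))"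
      unfolding s_def of_nat_mult of_nat_add by (intro mult_mono) auto
    also have "\<dots> = 8 * real ?d * (real ?d + 1) * (real M / real q)" by algebra
    finally have "2 * real s ^ ?d \<le> 2 * (8 * real ?d * (real ?d + 1) * (real M / real q)) ^ ?d"
      by (intro mult_left_mono power_mono) auto
    moreover have "real (card N) \<le> 2 * real s ^ ?d"
      using of_nat_mono[OF bound[of N], where ?'a = real] N by (simp add: fam_def)
    ultimately show ?thesis by (rule order_trans[rotated])
  qed
  ultimately show ?thesis using N unfolding fam_def by blast
qed

section \<open>Chaining\<close>

lemma abs_mi_pow_le_1: "norm (w :: real^'d::finite) \<le> 1 \<Longrightarrow> \<bar>mi_pow w \<alpha>\<bar> \<le> 1"
proof -
  assume w: "norm w \<le> 1"
  have "\<bar>mi_pow w \<alpha>\<bar> = (\<Prod>i\<in>UNIV. \<bar>w $ i\<bar> ^ \<alpha> i)" by (simp add: mi_pow_def abs_prod power_abs)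
  also have "\<dots> \<le> (\<Prod>i\<in>(UNIV::'d set). 1)"
    using component_le_norm_cart[of w] w by (intro prod_mono conjI power_le_one) (auto intro: order_trans)
  finally show ?thesis by simp
qed

lemma mi_pow_upd: "mi_pow w (\<alpha>(c := Suc (\<alpha> c))) = w $ c * mi_pow w \<alpha>"
  unfolding mi_pow_def by (subst (1 2) prod.remove[of _ c]) (auto intro!: prod.cong)

lemma mi_order_upd: "mi_order (\<alpha>(c := Suc (\<alpha> c))) = Suc (mi_order \<alpha>)"
  unfolding mi_order_def by (subst (1 2) sum.remove[of _ c]) (auto intro!: sum.cong)

lemma finite_mi_order_le: "finite {\<alpha> :: 'd::finite \<Rightarrow> nat. mi_order \<alpha> \<le> k}"
proof (rule finite_subset)
  show "finite (PiE (UNIV :: 'd set) (\<lambda>_. {..k}))" by (intro finite_PiE) auto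
  have "\<alpha> i \<le> mi_order \<alpha>" for \<alpha> :: "'d \<Rightarrow> nat" and i
    unfolding mi_order_def by (rule member_le_sum) auto
  then show "{\<alpha> :: 'd \<Rightarrow> nat. mi_order \<alpha> \<le> k} \<subseteq> PiE UNIV (\<lambda>_. {..k})"
    by (auto intro: order_trans)
qed

text \<open>The Taylor remainder of \<open>relu_pow j\<close> at \<open>t'\<close>, with the
  derivative factors and 1/r! combined into binomial coefficients. For \<open>j = 0\<close> it is
  the jump of the Heaviside function.\<close>

definition relu_rem :: "nat \<Rightarrow> real \<Rightarrow> real \<Rightarrow> real" where
  "relu_rem j t t' = relu_pow j t - (\<Sum>r\<le>j. real (j choose r) * (t - t') ^ r * relu_pow (j - r) t')"

text \<open>\<open>relu_pow j\<close> is a polynomial on each side of 0, and the expansion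
  reproduces the branch on which \<open>t'\<close> lies. Hence a remainder is nonzero only if 0
  separates \<open>t\<close> from \<open>t'\<close>.\<close>

lemma relu_taylor_sum:
  "(\<Sum>r\<le>j. real (j choose r) * (t - t') ^ r * relu_pow (j - r) t') = (if t' \<ge> 0 then t ^ j else 0)"
  using binomial_ring[of "t - t'" t' j] by (simp add: relu_pow_def)

lemma relu_rem_eq_0: "(0 \<le> t) = (0 \<le> t') \<Longrightarrow> relu_rem j t t' = 0"
  unfolding relu_rem_def relu_taylor_sum by (auto simp: relu_pow_def)

text \<open>If the remainder does not vanish, then 0 lies between \<open>t\<close> and
  \<open>t'\<close>, so \<open>\<bar>t\<bar> \<le> \<bar>t - t'\<bar>\<close>.\<close>

lemma abs_relu_rem_le: "\<bar>relu_rem j t t'\<bar> \<le> \<bar>t - t'\<bar> ^ j"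
proof (cases "(0 \<le> t) = (0 \<le> t')")
  case True
  then show ?thesis by (simp add: relu_rem_eq_0)
next
  case False
  then have "\<bar>relu_rem j t t'\<bar> = \<bar>t\<bar> ^ j"
    unfolding relu_rem_def relu_taylor_sum by (auto simp: relu_pow_def power_abs)
  also have "\<dots> \<le> \<bar>t - t'\<bar> ^ j" using False by (intro power_mono) auto
  finally show ?thesis .
qed

text \<open>One factor of the inner product at a time is expanded into coordinates, and each
  coordinate raises the multi-index by a unit. This is why distances to the nets are measured in the
  l1 norm.\<close>

lemma directional_power_bound:
  fixes J :: "((real^'d::finite) \<times> real) set"
  assumes "\<And>\<beta>. mi_order \<beta> = mi_order \<alpha> + r \<Longrightarrow> \<bar>\<Sum>p\<in>J. g p * mi_pow (fst p) \<beta>\<bar> \<le> G"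
  shows "\<bar>\<Sum>p\<in>J. g p * mi_pow (fst p) \<alpha> * (fst p \<bullet> z) ^ r\<bar> \<le> (\<Sum>c\<in>UNIV. \<bar>z $ c\<bar>) ^ r * G"
  using assms
proof (induction r arbitrary: \<alpha>)
  case 0
  then show ?case by simp
next
  case (Suc r)
  let ?Z = "\<Sum>c\<in>UNIV. \<bar>z $ c\<bar>"
  let ?f = "\<lambda>\<alpha>. \<Sum>p\<in>J. g p * mi_pow (fst p) \<alpha> * (fst p \<bullet> z) ^ r"
  have "(\<Sum>p\<in>J. g p * mi_pow (fst p) \<alpha> * (fst p \<bullet> z) ^ Suc r) =
      (\<Sum>p\<in>J. \<Sum>c\<in>UNIV. z $ c * (g p * mi_pow (fst p) (\<alpha>(c := Suc (\<alpha> c))) * (fst p \<bullet> z) ^ r))"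
  proof (rule sum.cong[OF refl])
    fix p :: "(real^'d) \<times> real"
    have "g p * mi_pow (fst p) \<alpha> * (fst p \<bullet> z) ^ Suc r = (\<Sum>c\<in>UNIV. fst p $ c * z $ c) * (g p * mi_pow (fst p) \<alpha> * (fst p \<bullet> z) ^ r)"
      by (simp add: inner_vec_def)
    also have "\<dots> = (\<Sum>c\<in>UNIV. fst p $ c * z $ c * (g p * mi_pow (fst p) \<alpha> * (fst p \<bullet> z) ^ r))"
      by (rule sum_distrib_right)
    finally show "g p * mi_pow (fst p) \<alpha> * (fst p \<bullet> z) ^ Suc r =
        (\<Sum>c\<in>UNIV. z $ c * (g p * mi_pow (fst p) (\<alpha>(c := Suc (\<alpha> c))) * (fst p \<bullet> z) ^ r))"
      by (simp add: mi_pow_upd mult_ac)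
  qed
  also have "\<dots> = (\<Sum>c\<in>UNIV. z $ c * ?f (\<alpha>(c := Suc (\<alpha> c))))"
    by (subst sum.swap) (simp add: sum_distrib_left)
  finally have "\<bar>\<Sum>p\<in>J. g p * mi_pow (fst p) \<alpha> * (fst p \<bullet> z) ^ Suc r\<bar> \<le> (\<Sum>c\<in>UNIV. \<bar>z $ c * ?f (\<alpha>(c := Suc (\<alpha> c)))\<bar>)"
    by (simp only: sum_abs)
  also have "\<dots> \<le> (\<Sum>c\<in>UNIV. \<bar>z $ c\<bar> * (?Z ^ r * G))"
    unfolding abs_mult
    by (intro sum_mono mult_left_mono Suc.IH Suc.prems abs_ge_zero) (simp only: mi_order_upd add_Suc_shift)
  also have "\<dots> = ?Z ^ Suc r * G" by (simp add: sum_distrib_right mult.assoc)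
  finally show ?case .
qed

text \<open>The derivative of order \<alpha> without its constant k!/(k-|\<alpha>|)!, which
  \<open>atom_deriv_atom\<close> restores. With this normalisation the Taylor coefficients are
  binomial.\<close>

definition ridge_sum :: "((real^'d::finite) \<times> real) set \<Rightarrow> ((real^'d) \<times> real \<Rightarrow> real) \<Rightarrow> nat \<Rightarrow> ('d \<Rightarrow> nat) \<Rightarrow> real^'d \<Rightarrow> real" where
  "ridge_sum J g k \<alpha> x = (\<Sum>p\<in>J. g p * mi_pow (fst p) \<alpha> * relu_pow (k - mi_order \<alpha>) (fst p \<bullet> x + snd p))"

text \<open>Taylor expansion around \<open>x'\<close>. The weights
  \<open>\<rho> ^ (k - mi_order \<beta>)\<close> are scaled so that the r-th term loses exactly the
  \<open>\<rho> ^ r\<close> that the displacement gains, and the binomial sum of the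
  \<open>\<theta> ^ r\<close> is at most \<open>exp (k * \<theta>)\<close>.\<close>

lemma ridge_sum_step:
  fixes J :: "((real^'d::finite) \<times> real) set"
  assumes \<alpha>: "mi_order \<alpha> \<le> k" and pos: "T \<ge> 0" "\<rho> \<ge> 0" "\<theta> \<ge> 0" "H \<ge> 0"
    and x': "\<And>\<beta>. mi_order \<beta> \<le> k \<Longrightarrow> \<bar>ridge_sum J g k \<beta> x'\<bar> \<le> T * \<rho> ^ (k - mi_order \<beta>) * H"
    and Z: "(\<Sum>c\<in>UNIV. \<bar>x $ c - x' $ c\<bar>) \<le> \<rho> * \<theta>"
    and R: "\<bar>\<Sum>p\<in>J. g p * mi_pow (fst p) \<alpha> * relu_rem (k - mi_order \<alpha>) (fst p \<bullet> x + snd p) (fst p \<bullet> x' + snd p)\<bar>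
      \<le> T * \<rho> ^ (k - mi_order \<alpha>) * a"
  shows "\<bar>ridge_sum J g k \<alpha> x\<bar> \<le> T * \<rho> ^ (k - mi_order \<alpha>) * (a + exp (real k * \<theta>) * H)"
proof -
  define j where "j = k - mi_order \<alpha>"
  let ?Z = "\<Sum>c\<in>UNIV. \<bar>x $ c - x' $ c\<bar>"
  let ?t = "\<lambda>y p. fst p \<bullet> y + snd p"
  let ?R = "\<Sum>p\<in>J. g p * mi_pow (fst p) \<alpha> * relu_rem j (?t x p) (?t x' p)"
  let ?E = "\<lambda>r. \<Sum>p\<in>J. (g p * relu_pow (j - r) (?t x' p)) * mi_pow (fst p) \<alpha> * (fst p \<bullet> (x - x')) ^ r"
  have "ridge_sum J g k \<alpha> x = ?R + (\<Sum>p\<in>J. \<Sum>r\<le>j. real (j choose r) * ((g p * relu_pow (j - r) (?t x' p)) * mi_pow (fst p) \<alpha> * (fst p \<bullet> (x - x')) ^ r))"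
    unfolding ridge_sum_def j_def[symmetric] sum.distrib[symmetric]
  proof (rule sum.cong[OF refl])
    fix p :: "(real^'d) \<times> real"
    have d: "?t x p - ?t x' p = fst p \<bullet> (x - x')" by (simp add: inner_diff_right)
    have "relu_pow j (?t x p) = relu_rem j (?t x p) (?t x' p) +
        (\<Sum>r\<le>j. real (j choose r) * (fst p \<bullet> (x - x')) ^ r * relu_pow (j - r) (?t x' p))"
      unfolding relu_rem_def d by simp
    then show "g p * mi_pow (fst p) \<alpha> * relu_pow j (?t x p) = g p * mi_pow (fst p) \<alpha> * relu_rem j (?t x p) (?t x' p) +
        (\<Sum>r\<le>j. real (j choose r) * ((g p * relu_pow (j - r) (?t x' p)) * mi_pow (fst p) \<alpha> * (fst p \<bullet> (x - x')) ^ r))"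
      by (simp add: ring_distribs sum_distrib_left mult_ac)
  qed
  also have "(\<Sum>p\<in>J. \<Sum>r\<le>j. real (j choose r) * ((g p * relu_pow (j - r) (?t x' p)) * mi_pow (fst p) \<alpha> * (fst p \<bullet> (x - x')) ^ r)) =
      (\<Sum>r\<le>j. real (j choose r) * ?E r)"
    by (subst sum.swap) (simp add: sum_distrib_left)
  finally have "\<bar>ridge_sum J g k \<alpha> x\<bar> \<le> \<bar>?R\<bar> + \<bar>\<Sum>r\<le>j. real (j choose r) * ?E r\<bar>" by linarith
  also have "\<bar>?R\<bar> \<le> T * \<rho> ^ j * a" using R by (simp add: j_def)
  also have "\<bar>\<Sum>r\<le>j. real (j choose r) * ?E r\<bar> \<le> (\<Sum>r\<le>j. \<bar>real (j choose r) * ?E r\<bar>)" by (rule sum_abs)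
  also have "\<dots> \<le> (\<Sum>r\<le>j. real (j choose r) * \<theta> ^ r * (T * \<rho> ^ j * H))"
  proof (intro sum_mono)
    fix r assume r: "r \<in> {..j}"
    have "\<bar>?E r\<bar> \<le> (\<Sum>c\<in>UNIV. \<bar>(x - x') $ c\<bar>) ^ r * (T * \<rho> ^ (j - r) * H)"
    proof (rule directional_power_bound)
      fix \<beta> :: "'d \<Rightarrow> nat" assume \<beta>: "mi_order \<beta> = mi_order \<alpha> + r"
      then have "mi_order \<beta> \<le> k" "k - mi_order \<beta> = j - r" using r \<alpha> by (auto simp: j_def)
      with x'[of \<beta>] show "\<bar>\<Sum>p\<in>J. g p * relu_pow (j - r) (?t x' p) * mi_pow (fst p) \<beta>\<bar> \<le> T * \<rho> ^ (j - r) * H"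
        by (simp add: ridge_sum_def mult_ac)
    qed
    also have "\<dots> \<le> (\<rho> * \<theta>) ^ r * (T * \<rho> ^ (j - r) * H)"
      using Z pos by (intro mult_right_mono power_mono) (auto intro!: sum_nonneg)
    also have "\<dots> = \<theta> ^ r * (T * (\<rho> ^ r * \<rho> ^ (j - r)) * H)" by (simp add: power_mult_distrib mult_ac)
    also have "\<rho> ^ r * \<rho> ^ (j - r) = \<rho> ^ j" using r by (simp flip: power_add)
    finally have "real (j choose r) * \<bar>?E r\<bar> \<le> real (j choose r) * (\<theta> ^ r * (T * \<rho> ^ j * H))"
      by (intro mult_left_mono) auto
    then show "\<bar>real (j choose r) * ?E r\<bar> \<le> real (j choose r) * \<theta> ^ r * (T * \<rho> ^ j * H)"
      by (simp add: abs_mult mult_ac)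
  qed
  also have "\<dots> = (\<theta> + 1) ^ j * (T * \<rho> ^ j * H)"
    by (simp add: binomial_ring sum_distrib_right)
  also have "\<dots> \<le> exp (real k * \<theta>) * (T * \<rho> ^ j * H)"
  proof (rule mult_right_mono)
    have "(\<theta> + 1) ^ j \<le> exp \<theta> ^ j" using pos exp_ge_add_one_self[of \<theta>] by (intro power_mono) (auto simp: add.commute)
    also have "\<dots> = exp (real j * \<theta>)" by (simp add: exp_of_nat_mult)
    also have "\<dots> \<le> exp (real k * \<theta>)" using pos by (auto simp: j_def intro!: mult_right_mono)
    finally show "(\<theta> + 1) ^ j \<le> exp (real k * \<theta>)" .
  qed (use pos in auto)
  finally show ?thesis by (simp add: j_def algebra_simps)
qed


lemma sum_Suc_mult_power_le:
  fixes z :: real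
  assumes "0 \<le> z" "z < 1"
  shows "(\<Sum>i<n. real (Suc i) * z ^ i) \<le> 1 / (1 - z)\<^sup>2"
proof -
  have "(\<lambda>i. real (Suc i) * z ^ i) sums (1 / (1 - z)\<^sup>2)"
    using geometric_deriv_sums[of z] assms by simp
  then show ?thesis using assms by (metis (mono_tags, lifting) mult_nonneg_nonneg of_nat_0_le_iff
      sum_le_suminf sums_iff zero_le_power finite_lessThan)
qed

lemma exp_neg_square_le: "exp (- (real n)\<^sup>2) \<le> (1/2) ^ n"
proof -
  have "n \<le> n\<^sup>2" by (simp add: power2_eq_square)
  then have "real n \<le> (real n)\<^sup>2" by (metis of_nat_le_iff of_nat_power)
  then have "exp (- (real n)\<^sup>2) \<le> exp (real n * (-1))" by simp
  also have "\<dots> = exp (-1) ^ n" by (rule exp_of_nat_mult)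
  also have "\<dots> \<le> (1/2) ^ n"
    using exp_ge_add_one_self[of 1] by (intro power_mono) (auto simp: exp_minus field_simps)
  finally show ?thesis .
qed

text \<open>Chaining: the colouring annihilates all derivatives at the points of the coarsest net, where
  \<open>2 ^ L\<close> points of \<open>J\<close> may separate \<open>x\<close> from the net, and has small inner product with all Taylor
  remainders between consecutive nets. At the finest net the remainders vanish identically.\<close>
lemma halfspace_coloring:
  fixes k L :: nat and J :: "((real^'d::finite) \<times> real) set"
  defines "D \<equiv> real CARD('d)"
  assumes J: "finite J" "J \<subseteq> param_dom" and M: "M = card J" "16 \<le> M"
    and w: "\<And>p. p \<in> J \<Longrightarrow> 0 \<le> w p" "\<And>p. p \<in> J \<Longrightarrow> w p \<le> 2 / real M"
    and L: "2 ^ L \<le> M" and \<delta>: "\<delta> = 2 ^ L / real M"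
    and small: "2 * (8 * D * (D + 1) / \<delta>) ^ CARD('d) * real (card {\<alpha> :: 'd \<Rightarrow> nat. mi_order \<alpha> \<le> k}) \<le> real M / 8"
  shows "\<exists>e. (\<forall>p\<in>J. \<bar>e p\<bar> \<le> 1) \<and> M \<le> 4 * card {p\<in>J. \<bar>e p\<bar> = 1} \<and> (\<Sum>p\<in>J. w p * e p) = 0 \<and>
    (\<forall>\<alpha> x. mi_order \<alpha> \<le> k \<longrightarrow> x \<in> cball 0 1 \<longrightarrow> \<bar>ridge_sum J (\<lambda>p. w p * e p) k \<alpha> x\<bar> \<le>
      exp (3 * real k) * (12 * (D + 1) / (1 - sqrt (1/2))\<^sup>2) * sqrt (\<delta> / real M) * (2 * D * \<delta>) ^ (k - mi_order \<alpha>))"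
proof -
  define A where "A = {\<alpha> :: 'd \<Rightarrow> nat. mi_order \<alpha> \<le> k}"
  have A: "finite A" unfolding A_def by (rule finite_mi_order_le)
  have M0: "real M > 0" and D: "D \<ge> 1" using M by (auto simp: D_def Suc_leI)
  have \<delta>0: "\<delta> > 0" using \<delta> M0 by simp
  \<comment> \<open>Since \<open>q L = 1\<close>, the strict bound \<open>< q L\<close> says that no
    point of \<open>J\<close> separates at the finest level.\<close>
  define q where "q l = (2::nat) ^ (L - l)" for l
  have q: "1 \<le> q l" "q l \<le> M" for l
    using order_trans[OF power_increasing[of "L - l" L "2::nat"] L] by (simp_all add: q_def)
  have qM: "real (q l) / real M = \<delta> * (1/2) ^ l" if "l \<le> L" for l
  proof -
    have "(2::real) ^ L = 2 ^ (L - l) * 2 ^ l" using that by (simp flip: power_add)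
    then show ?thesis by (simp add: q_def \<delta> power_one_over)
  qed
  define B where "B = (8 * D * (D + 1) / \<delta>) ^ CARD('d)"
  have B0: "B \<ge> 0" using D \<delta>0 by (simp add: B_def)
  define net where "net N l \<longleftrightarrow> N \<subseteq> cball 0 1 \<and> finite N \<and> real (card N) \<le> 2 * B * (2 ^ l) ^ CARD('d) \<and>
    (\<forall>x\<in>cball 0 1. \<exists>x'\<in>N. card {p\<in>J. in_halfspace x p \<noteq> in_halfspace x' p} < q l \<and>
      (\<Sum>c\<in>UNIV. \<bar>x $ c - x' $ c\<bar>) \<le> 2 * D * \<delta> * (1/2) ^ l)" for N :: "(real^'d) set" and l
  have "\<exists>N. net N l" if l: "l \<le> L" for l
  proof -
    have "real M / real (q l) = 2 ^ l / \<delta>"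
      using qM[OF l] q[of l] M0 \<delta>0 by (simp add: field_simps power_one_over)
    then have "8 * D * (D + 1) * (real M / real (q l)) = 8 * D * (D + 1) / \<delta> * 2 ^ l" by simp
    then have c: "2 * (8 * D * (D + 1) * (real M / real (q l))) ^ CARD('d) = 2 * B * (2 ^ l) ^ CARD('d)"
      by (simp only: B_def power_mult_distrib mult.assoc)
    have m: "2 * D * (real (q l) / real M) = 2 * D * \<delta> * (1/2) ^ l" by (simp only: qM[OF l] mult.assoc)
    show ?thesis
      unfolding net_def by (rule halfspace_net[OF J(1) M(1)[symmetric] q[of l], folded D_def, unfolded c m])
  qed
  then obtain N where N: "\<And>l. l \<le> L \<Longrightarrow> net (N l) l" by metis
  define \<pi> where "\<pi> l x = (SOME x'. x' \<in> N l \<and> card {p\<in>J. in_halfspace x p \<noteq> in_halfspace x' p} < q l \<and>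
      (\<Sum>c\<in>UNIV. \<bar>x $ c - x' $ c\<bar>) \<le> 2 * D * \<delta> * (1/2) ^ l)" for l x
  have \<pi>: "\<pi> l x \<in> N l" "card {p\<in>J. in_halfspace x p \<noteq> in_halfspace (\<pi> l x) p} < q l"
      "(\<Sum>c\<in>UNIV. \<bar>x $ c - \<pi> l x $ c\<bar>) \<le> 2 * D * \<delta> * (1/2) ^ l" if "l \<le> L" "x \<in> cball 0 1" for l x
  proof -
    have "\<exists>x'. x' \<in> N l \<and> card {p\<in>J. in_halfspace x p \<noteq> in_halfspace x' p} < q l \<and>
      (\<Sum>c\<in>UNIV. \<bar>x $ c - x' $ c\<bar>) \<le> 2 * D * \<delta> * (1/2) ^ l"
      using N[OF that(1)] that(2) unfolding net_def by blast
    from someI_ex[OF this] show "\<pi> l x \<in> N l" "card {p\<in>J. in_halfspace x p \<noteq> in_halfspace (\<pi> l x) p} < q l"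
      "(\<Sum>c\<in>UNIV. \<bar>x $ c - \<pi> l x $ c\<bar>) \<le> 2 * D * \<delta> * (1/2) ^ l" unfolding \<pi>_def by blast+
  qed
  have Nb: "N l \<subseteq> cball 0 1" "finite (N l)" "real (card (N l)) \<le> 2 * B * (2 ^ l) ^ CARD('d)" if "l \<le> L" for l
    using N[OF that] by (auto simp: net_def)
  define \<rho> where "\<rho> = 2 * D * \<delta>"
  define T where "T = sqrt (\<delta> / real M)"
  have pos: "\<rho> > 0" "T > 0" using D \<delta>0 M0 by (auto simp: \<rho>_def T_def)
  define z where "z = sqrt (1/2 :: real)"
  have z: "0 < z" "z < 1" "z\<^sup>2 = 1/2" unfolding z_def by (simp_all add: real_sqrt_pow2 del: real_sqrt_divide)
  define v where "v = (\<lambda>(l, x, \<alpha>) p. w p * mi_pow (fst p) \<alpha> *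
      relu_rem (k - mi_order \<alpha>) (fst p \<bullet> x + snd p) (fst p \<bullet> \<pi> l x + snd p))"
  define R where "R = Sigma {..<L} (\<lambda>l. N (Suc l) \<times> A)"
  \<comment> \<open>The square in the exponent gives
    \<open>exp (- lam\<^sup>2) \<le> 2 ^ -((d + 1) * Suc l)\<close>. The factor
    \<open>2 ^ (d * Suc l)\<close> by which the nets grow is absorbed, and the remaining
    \<open>2 ^ - Suc l\<close> sum to at most 1.\<close>
  define lam where "lam = (\<lambda>(l::nat, x::real^'d, \<alpha>::'d \<Rightarrow> nat). (D + 1) * real (Suc l))"
  \<comment> \<open>Fewer than \<open>q l = \<delta> * M / 2 ^ l\<close> remainders are nonzero,
    each at most \<open>2 / M * \<rho> ^ j\<close>; the square root of the count gives
    \<open>T\<close> and one factor \<open>z = sqrt (1/2)\<close> per level.\<close>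
  define s where "s = (\<lambda>(l::nat, x::real^'d, \<alpha>::'d \<Rightarrow> nat). T * \<rho> ^ (k - mi_order \<alpha>) * (2 * z ^ l))"
  \<comment> \<open>Including \<open>w\<close> itself preserves the total mass; the other members
    are all derivatives at the points of the coarsest net.\<close>
  define U where "U = insert w ((\<lambda>(x, \<alpha>) p. w p * (mi_pow (fst p) \<alpha> * relu_pow (k - mi_order \<alpha>) (fst p \<bullet> x + snd p))) ` (N 0 \<times> A))"
  have small': "2 * B * real (card A) \<le> real M / 8" using small by (simp add: B_def A_def)
  have U: "finite U" "4 * card U \<le> card J"
  proof -
    show "finite U" unfolding U_def using Nb[of 0] A by auto
    have f: "finite (N 0 \<times> A)" using Nb[of 0] A by auto
    have "card U \<le> Suc (card (N 0 \<times> A))"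
      unfolding U_def using f
      by (simp only: card_insert_if finite_imageI) (auto intro: card_image_le[OF f] le_SucI simp del: card_cartesian_product)
    then have "real (card U) \<le> 1 + real (card (N 0)) * real (card A)"
      by (simp add: card_cartesian_product flip: of_nat_mult)
    also have "\<dots> \<le> 1 + (2 * B) * real (card A)" using Nb[of 0] by (intro add_mono mult_right_mono) auto
    also have "\<dots> \<le> real M / 4" using small' M by simp
    finally show "4 * card U \<le> card J" using M by simp
  qed
  have R: "finite R" unfolding R_def using Nb A by (intro finite_SigmaI) auto
  have sum_lam: "(\<Sum>r\<in>R. exp (- (lam r)\<^sup>2)) \<le> real (card J) / 8"
  proof -
    have e: "exp (- ((D + 1) * real (Suc l))\<^sup>2) \<le> (1/2) ^ ((CARD('d) + 1) * Suc l)" for l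
    proof -
      let ?n = "(CARD('d) + 1) * Suc l"
      have n: "(D + 1) * real (Suc l) = real ?n" by (simp add: D_def algebra_simps)
      show ?thesis unfolding n by (rule exp_neg_square_le)
    qed
    have "(\<Sum>r\<in>R. exp (- (lam r)\<^sup>2)) = (\<Sum>l<L. real (card (N (Suc l))) * real (card A) * exp (- ((D + 1) * real (Suc l))\<^sup>2))"
    proof -
      have "(\<Sum>r\<in>R. exp (- (lam r)\<^sup>2)) =
          (\<Sum>(l, y)\<in>Sigma {..<L} (\<lambda>l. N (Suc l) \<times> A). exp (- ((D + 1) * real (Suc l))\<^sup>2))"
        unfolding R_def by (intro sum.cong refl) (auto simp: lam_def)
      also have "\<dots> = (\<Sum>l<L. \<Sum>y\<in>N (Suc l) \<times> A. exp (- ((D + 1) * real (Suc l))\<^sup>2))"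
        using Nb A by (intro sum.Sigma[symmetric]) auto
      finally show ?thesis by (simp add: card_cartesian_product)
    qed
    also have "\<dots> \<le> (\<Sum>l<L. 2 * B * (2 ^ Suc l) ^ CARD('d) * real (card A) * (1/2) ^ ((CARD('d) + 1) * Suc l))"
    proof (intro sum_mono)
      fix l assume "l \<in> {..<L}"
      then have "real (card (N (Suc l))) \<le> 2 * B * (2 ^ Suc l) ^ CARD('d)" by (intro Nb(3)) auto
      then show "real (card (N (Suc l))) * real (card A) * exp (- ((D + 1) * real (Suc l))\<^sup>2) \<le>
          2 * B * (2 ^ Suc l) ^ CARD('d) * real (card A) * (1/2) ^ ((CARD('d) + 1) * Suc l)"
        using B0 by (intro mult_mono e) auto
    qed
    also have "\<dots> = (\<Sum>l<L. 2 * B * real (card A) * (1/2) ^ Suc l)"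
    proof (rule sum.cong[OF refl])
      fix l
      have "(CARD('d) + 1) * Suc l = Suc l + Suc l * CARD('d)" by simp
      then have split: "(1/2 :: real) ^ ((CARD('d) + 1) * Suc l) = (1/2) ^ Suc l * ((1/2) ^ Suc l) ^ CARD('d)"
        by (simp only: power_add power_mult)
      have one: "((2::real) ^ Suc l) ^ CARD('d) * ((1/2) ^ Suc l) ^ CARD('d) = 1"
        by (simp only: power_mult_distrib[symmetric]) simp
      have "b * X * c * (Y * Z) = b * c * Y * (X * Z)" for b c X Y Z :: real by (simp only: mult_ac)
      then show "2 * B * (2 ^ Suc l) ^ CARD('d) * real (card A) * (1/2) ^ ((CARD('d) + 1) * Suc l) = 2 * B * real (card A) * (1/2) ^ Suc l"
        unfolding split by (simp only: one mult_1_right)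
    qed
    also have "\<dots> = 2 * B * real (card A) * (\<Sum>l<L. (1/2) ^ Suc l)" by (simp add: sum_distrib_left)
    also have "\<dots> \<le> 2 * B * real (card A) * 1"
    proof (rule mult_left_mono)
      have "(\<Sum>l<L. (1/2 :: real) ^ Suc l) = 1 - (1/2) ^ L" by (induction L) auto
      then show "(\<Sum>l<L. (1/2 :: real) ^ Suc l) \<le> 1" by simp
      show "0 \<le> 2 * B * real (card A)" using B0 by simp
    qed
    also have "\<dots> \<le> real (card J) / 8" using small' M by simp
    finally show ?thesis .
  qed
  have lam1: "1 \<le> lam r" for r
    using D mult_mono[of 1 "D + 1" 1 "real (Suc (fst r))"] by (auto simp: lam_def split: prod.splits)
  have s: "0 < s r" "(\<Sum>p\<in>J. (v r p)\<^sup>2) \<le> (s r)\<^sup>2" if "r \<in> R" for r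
  proof -
    obtain l x \<alpha> where r: "r = (l, x, \<alpha>)" by (cases r)
    have lx: "l < L" "x \<in> N (Suc l)" "mi_order \<alpha> \<le> k"
      using that unfolding r R_def A_def by auto
    then have x: "x \<in> cball 0 1" and l: "l \<le> L" using Nb(1)[of "Suc l"] by auto
    define j where "j = k - mi_order \<alpha>"
    show "0 < s r" using pos z by (simp add: s_def r)
    define E where "E = {p\<in>J. in_halfspace x p \<noteq> in_halfspace (\<pi> l x) p}"
    have "(\<Sum>p\<in>J. (v r p)\<^sup>2) = (\<Sum>p\<in>E. (v r p)\<^sup>2)"
      using J(1) by (intro sum.mono_neutral_right) (auto simp: E_def v_def r relu_rem_eq_0)
    also have "\<dots> \<le> (\<Sum>p\<in>E. (2 / real M * \<rho> ^ j)\<^sup>2)"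
    proof (intro sum_mono)
      fix p assume "p \<in> E"
      then have p: "p \<in> J" by (simp add: E_def)
      then have n: "norm (fst p) = 1" using J(2) by (auto simp: param_dom_def)
      have "fst p \<bullet> x + snd p - (fst p \<bullet> \<pi> l x + snd p) = fst p \<bullet> (x - \<pi> l x)" by (simp add: inner_diff_right)
      also have "\<bar>\<dots>\<bar> \<le> norm (fst p) * norm (x - \<pi> l x)" by (rule Cauchy_Schwarz_ineq2)
      also have "\<dots> \<le> (\<Sum>c\<in>UNIV. \<bar>(x - \<pi> l x) $ c\<bar>)" using norm_le_l1_cart[of "x - \<pi> l x"] n by simp
      also have "\<dots> \<le> \<rho> * (1/2) ^ l" using \<pi>(3)[OF l x] by (simp add: \<rho>_def)
      also have "\<dots> \<le> \<rho> * 1" using pos by (intro mult_left_mono power_le_one) auto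
      finally have t: "\<bar>fst p \<bullet> x + snd p - (fst p \<bullet> \<pi> l x + snd p)\<bar> \<le> \<rho>" by simp
      have "\<bar>relu_rem j (fst p \<bullet> x + snd p) (fst p \<bullet> \<pi> l x + snd p)\<bar> \<le> \<rho> ^ j"
        using abs_relu_rem_le by (rule order_trans) (intro power_mono t abs_ge_zero)
      moreover have "\<bar>mi_pow (fst p) \<alpha>\<bar> \<le> 1" using n by (intro abs_mi_pow_le_1) simp
      moreover have "\<bar>w p\<bar> \<le> 2 / real M" using w[OF p] by simp
      ultimately have "\<bar>v r p\<bar> \<le> (2 / real M * 1) * \<rho> ^ j"
        unfolding v_def r prod.case abs_mult j_def[symmetric] by (intro mult_mono) auto
      from power_mono[OF this abs_ge_zero, of 2]
      show "(v r p)\<^sup>2 \<le> (2 / real M * \<rho> ^ j)\<^sup>2" by (simp only: power2_abs mult_1_right)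
    qed
    also have "\<dots> = real (card E) * (2 / real M * \<rho> ^ j)\<^sup>2" by simp
    also have "\<dots> \<le> real (q l) * (2 / real M * \<rho> ^ j)\<^sup>2"
      using \<pi>(2)[OF l x] by (intro mult_right_mono) (auto simp: E_def)
    also have "real (q l) = \<delta> * (1/2) ^ l * real M" using qM[OF l] M0 by (simp add: field_simps)
    also have "\<delta> * (1/2) ^ l * real M * (2 / real M * \<rho> ^ j)\<^sup>2 = (\<delta> / real M) * (\<rho> ^ j)\<^sup>2 * (4 * (z\<^sup>2) ^ l)"
      using M0 unfolding z by (simp add: power2_eq_square field_simps)
    also have "\<delta> / real M = T\<^sup>2" using \<delta>0 M0 by (simp add: T_def)
    also have "T\<^sup>2 * (\<rho> ^ j)\<^sup>2 * (4 * (z\<^sup>2) ^ l) = (s r)\<^sup>2"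
      by (simp add: s_def r j_def[symmetric] power_mult_distrib power_mult[symmetric] mult.commute)
    finally show "(\<Sum>p\<in>J. (v r p)\<^sup>2) \<le> (s r)\<^sup>2" .
  qed
  have J16: "16 \<le> card J" using M by simp
  from partial_coloring[OF J(1) U(1) R U(2) J16 sum_lam lam1 s]
  obtain e where e0: "(\<forall>p\<in>J. \<bar>e p\<bar> \<le> 1) \<and> card J \<le> 4 * card {p\<in>J. \<bar>e p\<bar> = 1} \<and>
    (\<forall>u\<in>U. (\<Sum>p\<in>J. u p * e p) = 0) \<and> (\<forall>r\<in>R. \<bar>\<Sum>p\<in>J. v r p * e p\<bar> \<le> 6 * lam r * s r)" by (rule exE)
  note e = conjunct1[OF e0, rule_format] conjunct1[OF conjunct2[OF e0]]
    conjunct1[OF conjunct2[OF conjunct2[OF e0]], rule_format] conjunct2[OF conjunct2[OF conjunct2[OF e0]], rule_format]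
  let ?g = "\<lambda>p. w p * e p"
  define a where "a i = 12 * (D + 1) * (real (Suc i) * z ^ i)" for i
  \<comment> \<open>The accumulated error: each level adds \<open>a l\<close> and multiplies the
    past by \<open>exp (k / 2 ^ l)\<close>. These exponents sum to at most 2k, and the final step
    from the finest net costs at most k more, which explains \<open>exp (3 * k)\<close>.\<close>
  define H where "H l = exp (real k * (\<Sum>i<l. (1/2) ^ i)) * (\<Sum>i<l. a i)" for l
  have a0: "a i \<ge> 0" for i using D z by (simp add: a_def)
  have H0: "H l \<ge> 0" for l unfolding H_def by (intro mult_nonneg_nonneg sum_nonneg a0) auto
  have chain: "\<bar>ridge_sum J ?g k \<alpha> x\<bar> \<le> T * \<rho> ^ (k - mi_order \<alpha>) * H l"
    if "l \<le> L" "x \<in> N l" "mi_order \<alpha> \<le> k" for l x \<alpha>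
    using that
  proof (induction l arbitrary: x \<alpha>)
    case 0
    then have "(\<lambda>p. w p * (mi_pow (fst p) \<alpha> * relu_pow (k - mi_order \<alpha>) (fst p \<bullet> x + snd p))) \<in> U"
      unfolding U_def A_def by (intro insertI2 image_eqI[of _ _ "(x, \<alpha>)"]) auto
    from e(3)[OF this] show ?case by (simp add: ridge_sum_def H_def mult_ac)
  next
    case (Suc l)
    then have x: "x \<in> cball 0 1" and l: "l \<le> L" using Nb(1)[of "Suc l"] by auto
    have r: "(l, x, \<alpha>) \<in> R" using Suc.prems by (auto simp: R_def A_def)
    have "\<bar>ridge_sum J ?g k \<alpha> x\<bar> \<le> T * \<rho> ^ (k - mi_order \<alpha>) * (a l + exp (real k * (1/2) ^ l) * H l)"
    proof (rule ridge_sum_step[where x' = "\<pi> l x"])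
      show "(\<Sum>c\<in>UNIV. \<bar>x $ c - \<pi> l x $ c\<bar>) \<le> \<rho> * (1/2) ^ l" using \<pi>(3)[OF l x] by (simp add: \<rho>_def)
      show "\<bar>ridge_sum J ?g k \<beta> (\<pi> l x)\<bar> \<le> T * \<rho> ^ (k - mi_order \<beta>) * H l" if "mi_order \<beta> \<le> k" for \<beta>
        by (rule Suc.IH[OF l \<pi>(1)[OF l x] that])
      have "(\<Sum>p\<in>J. w p * e p * mi_pow (fst p) \<alpha> * relu_rem (k - mi_order \<alpha>) (fst p \<bullet> x + snd p) (fst p \<bullet> \<pi> l x + snd p))
          = (\<Sum>p\<in>J. v (l, x, \<alpha>) p * e p)" by (simp add: v_def mult_ac)
      also have "\<bar>\<dots>\<bar> \<le> 6 * lam (l, x, \<alpha>) * s (l, x, \<alpha>)" by (rule e(4)[OF r])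
      also have "\<dots> = T * \<rho> ^ (k - mi_order \<alpha>) * a l" by (simp add: lam_def s_def a_def)
      finally show "\<bar>\<Sum>p\<in>J. w p * e p * mi_pow (fst p) \<alpha> * relu_rem (k - mi_order \<alpha>) (fst p \<bullet> x + snd p) (fst p \<bullet> \<pi> l x + snd p)\<bar>
          \<le> T * \<rho> ^ (k - mi_order \<alpha>) * a l" .
    qed (use pos H0 Suc.prems in auto)
    also have "\<dots> \<le> T * \<rho> ^ (k - mi_order \<alpha>) * H (Suc l)"
    proof (rule mult_left_mono)
      have "H (Suc l) = exp (real k * (\<Sum>i<Suc l. (1/2) ^ i)) * a l + exp (real k * (1/2) ^ l) * H l"
        by (simp add: H_def algebra_simps exp_add)
      moreover have "1 * a l \<le> exp (real k * (\<Sum>i<Suc l. (1/2) ^ i)) * a l"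
      proof (intro mult_right_mono a0)
        have "0 \<le> (\<Sum>i<Suc l. (1/2::real) ^ i)" by (intro sum_nonneg) simp
        then show "1 \<le> exp (real k * (\<Sum>i<Suc l. (1/2) ^ i))" by (simp only: one_le_exp_iff) (intro mult_nonneg_nonneg; simp)
      qed
      ultimately show "a l + exp (real k * (1/2) ^ l) * H l \<le> H (Suc l)" by simp
    qed (use pos in auto)
    finally show ?case .
  qed
  define S where "S = 12 * (D + 1) / (1 - z)\<^sup>2"
  have HL: "H l \<le> exp (2 * real k) * S" for l
    unfolding H_def
  proof (intro mult_mono)
    have "(\<Sum>i<l. (1/2 :: real) ^ i) = 2 - 2 * (1/2) ^ l" by (induction l) auto
    then have "real k * (\<Sum>i<l. (1/2) ^ i) \<le> real k * 2" by (intro mult_left_mono) auto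
    then show "exp (real k * (\<Sum>i<l. (1/2) ^ i)) \<le> exp (2 * real k)" by (simp add: mult.commute)
    have "(\<Sum>i<l. a i) = 12 * (D + 1) * (\<Sum>i<l. real (Suc i) * z ^ i)" by (simp only: a_def sum_distrib_left)
    also have "\<dots> \<le> 12 * (D + 1) * (1 / (1 - z)\<^sup>2)"
      using D z by (intro mult_left_mono sum_Suc_mult_power_le) auto
    finally show "(\<Sum>i<l. a i) \<le> S" by (simp add: S_def)
  qed (auto intro!: sum_nonneg a0)
  have final: "\<bar>ridge_sum J ?g k \<alpha> x\<bar> \<le> exp (3 * real k) * S * T * \<rho> ^ (k - mi_order \<alpha>)"
    if \<alpha>: "mi_order \<alpha> \<le> k" and x: "x \<in> cball 0 1" for \<alpha> x
  proof -
    have "{p\<in>J. in_halfspace x p \<noteq> in_halfspace (\<pi> L x) p} = {}"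
      using \<pi>(2)[OF order_refl x] J(1) by (simp add: q_def)
    then have z0: "relu_rem j (fst p \<bullet> x + snd p) (fst p \<bullet> \<pi> L x + snd p) = 0" if "p \<in> J" for p j
      using that by (intro relu_rem_eq_0) blast
    have "\<bar>ridge_sum J ?g k \<alpha> x\<bar> \<le> T * \<rho> ^ (k - mi_order \<alpha>) * (0 + exp (real k * (1/2) ^ L) * H L)"
    proof (rule ridge_sum_step[where x' = "\<pi> L x"])
      show "(\<Sum>c\<in>UNIV. \<bar>x $ c - \<pi> L x $ c\<bar>) \<le> \<rho> * (1/2) ^ L" using \<pi>(3)[OF order_refl x] by (simp add: \<rho>_def)
      show "\<bar>ridge_sum J ?g k \<beta> (\<pi> L x)\<bar> \<le> T * \<rho> ^ (k - mi_order \<beta>) * H L" if "mi_order \<beta> \<le> k" for \<beta>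
        by (rule chain[OF order_refl \<pi>(1)[OF order_refl x] that])
    qed (use pos H0 \<alpha> z0 in auto)
    also have "\<dots> \<le> T * \<rho> ^ (k - mi_order \<alpha>) * (0 + exp (real k * 1) * (exp (2 * real k) * S))"
      using pos H0 by (intro mult_left_mono add_left_mono mult_mono HL) (auto intro!: power_le_one mult_left_le)
    also have "exp (real k * 1) * (exp (2 * real k) * S) = exp (3 * real k) * S"
      by (simp add: exp_add[symmetric] flip: mult.assoc)
    finally show ?thesis by (simp add: mult_ac)
  qed
  have "(\<Sum>p\<in>J. w p * e p) = 0" by (intro e(3)) (simp add: U_def)
  with e(1,2) final show ?thesis unfolding M(1) S_def T_def \<rho>_def z_def
    by (intro exI[of _ e]) (auto simp: mult_ac)
qed

section \<open>Reducing the number of atoms\<close>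

definition rate :: "'d::finite itself \<Rightarrow> nat \<Rightarrow> ('d \<Rightarrow> nat) \<Rightarrow> real" where
  "rate _ k \<alpha> = 1/2 + (2 * (real k - real (mi_order \<alpha>)) + 1) / (2 * real CARD('d))"

text \<open>The bounds are uniform in \<alpha>: the lower one gives a common ratio for the geometric
  series of errors, the upper one keeps all constants dependent on \<open>k\<close> and the
  dimension only.\<close>

lemma rate_bounds:
  assumes "mi_order (\<alpha> :: 'd::finite \<Rightarrow> nat) \<le> k"
  shows "1/2 \<le> rate TYPE('d) k \<alpha>" "rate TYPE('d) k \<alpha> \<le> real k + 1"
proof -
  let ?u = "2 * (real k - real (mi_order \<alpha>)) + 1"
  have u: "0 \<le> ?u" "?u \<le> 2 * real k + 1" using assms by auto
  have D: "1 \<le> real CARD('d)" by (simp add: Suc_leI)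
  then have v: "0 \<le> ?u / (2 * real CARD('d))" using u by simp
  have "?u / (2 * real CARD('d)) \<le> ?u / 2" using D u by (intro divide_left_mono) auto
  also have "\<dots> \<le> real k + 1/2" using u(2) by simp
  finally show "rate TYPE('d) k \<alpha> \<le> real k + 1" unfolding rate_def by linarith
  show "1/2 \<le> rate TYPE('d) k \<alpha>" using v unfolding rate_def by linarith
qed

definition fin_dist :: "((real^'d::finite) \<times> real) set \<Rightarrow> ((real^'d) \<times> real \<Rightarrow> real) \<Rightarrow> bool" where
  "fin_dist P w \<longleftrightarrow> finite P \<and> P \<subseteq> param_dom \<and> (\<forall>p\<in>P. 0 < w p) \<and> sum w P = 1"

lemma abs_ridge_sum_le:
  assumes P: "fin_dist P w" and x: "x \<in> cball (0 :: real^'d::finite) 1"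
  shows "\<bar>ridge_sum P w k \<alpha> x\<bar> \<le> 2 ^ k"
proof -
  have "\<bar>ridge_sum P w k \<alpha> x\<bar> \<le> (\<Sum>p\<in>P. w p * 2 ^ k)"
    unfolding ridge_sum_def
  proof (rule order_trans[OF sum_abs], rule sum_mono)
    fix p assume "p \<in> P"
    then have "0 < w p" "p \<in> param_dom" using P by (auto simp: fin_dist_def)
    then have p: "0 < w p" "norm (fst p) = 1" "\<bar>snd p\<bar> \<le> 1"
      by (auto simp: param_dom_def mem_Times_iff abs_le_iff)
    have "\<bar>fst p \<bullet> x\<bar> \<le> norm (fst p) * norm x" by (rule Cauchy_Schwarz_ineq2)
    also have "\<dots> \<le> 1" using p x by simp
    finally have t: "\<bar>fst p \<bullet> x + snd p\<bar> \<le> 2" using p by linarith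
    let ?j = "k - mi_order \<alpha>"
    have "\<bar>relu_pow ?j (fst p \<bullet> x + snd p)\<bar> \<le> \<bar>fst p \<bullet> x + snd p\<bar> ^ ?j"
      by (auto simp: relu_pow_def power_abs)
    also have "\<dots> \<le> 2 ^ ?j" using t by (intro power_mono) auto
    also have "\<dots> \<le> 2 ^ k" by (intro power_increasing) auto
    finally have "\<bar>relu_pow ?j (fst p \<bullet> x + snd p)\<bar> \<le> 2 ^ k" .
    moreover have "\<bar>mi_pow (fst p) \<alpha>\<bar> \<le> 1" using p by (intro abs_mi_pow_le_1) simp
    ultimately have "w p * \<bar>mi_pow (fst p) \<alpha>\<bar> * \<bar>relu_pow ?j (fst p \<bullet> x + snd p)\<bar> \<le> (w p * 1) * 2 ^ k"
      using p by (intro mult_mono) auto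
    then show "\<bar>w p * mi_pow (fst p) \<alpha> * relu_pow ?j (fst p \<bullet> x + snd p)\<bar> \<le> w p * 2 ^ k"
      using p by (simp add: abs_mult)
  qed
  also have "\<dots> = 2 ^ k" using P by (simp add: fin_dist_def flip: sum_distrib_right)
  finally show ?thesis .
qed

text \<open>Replacing \<open>w\<close> by \<open>w * (1 - \<sigma> * e)\<close> keeps the mass and
  the signs and annihilates the atoms with \<open>e p = \<sigma>\<close>. Half of \<open>P\<close>
  is coloured, a quarter of that reaches 1 or -1, and the more frequent sign has half of these,
  hence 1/16.\<close>

lemma reduction_from_coloring:
  fixes P :: "((real^'d::finite) \<times> real) set"
  assumes P: "fin_dist P w" and J: "J \<subseteq> P" "card P \<le> 2 * card J"
    and e: "\<forall>p\<in>J. \<bar>e p\<bar> \<le> 1" "card J \<le> 4 * card {p\<in>J. \<bar>e p\<bar> = 1}" "(\<Sum>p\<in>J. w p * e p) = 0"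
  shows "\<exists>P' w'. fin_dist P' w' \<and> 16 * card P' \<le> 15 * card P \<and>
    (\<forall>\<alpha> x. \<bar>ridge_sum P w k \<alpha> x - ridge_sum P' w' k \<alpha> x\<bar> = \<bar>ridge_sum J (\<lambda>p. w p * e p) k \<alpha> x\<bar>)"
proof -
  have fP: "finite P" "finite J" using P J by (auto simp: fin_dist_def intro: finite_subset)
  have "card {p\<in>J. \<bar>e p\<bar> = 1} \<le> card ({p\<in>J. e p = 1} \<union> {p\<in>J. e p = -1})"
    using fP(2) by (intro card_mono) (auto simp: abs_if split: if_splits)
  also have "\<dots> \<le> card {p\<in>J. e p = 1} + card {p\<in>J. e p = -1}" by (rule card_Un_le)
  finally have "card {p\<in>J. \<bar>e p\<bar> = 1} \<le> card {p\<in>J. e p = 1} + card {p\<in>J. e p = -1}" .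
  then have "card J \<le> 8 * card {p\<in>J. e p = 1} \<or> card J \<le> 8 * card {p\<in>J. e p = -1}" using e(2) by linarith
  then obtain \<sigma> where \<sigma>: "\<sigma> = 1 \<or> \<sigma> = -1" "card J \<le> 8 * card {p\<in>J. e p = \<sigma>}" by blast
  define w' where "w' p = (if p \<in> J then w p * (1 - \<sigma> * e p) else w p)" for p
  define P' where "P' = P - {p\<in>J. e p = \<sigma>}"
  have kill: "w' p = 0" if "p \<in> P - P'" for p using that \<sigma>(1) by (auto simp: P'_def w'_def)
  have split: "(\<Sum>p\<in>P'. w' p * g p) = (\<Sum>p\<in>P. w p * g p) - \<sigma> * (\<Sum>p\<in>J. w p * e p * g p)" for g
  proof -
    have "(\<Sum>p\<in>P'. w' p * g p) = (\<Sum>p\<in>P. w' p * g p)"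
      using fP kill by (intro sum.mono_neutral_left) (auto simp: P'_def)
    also have "\<dots> = (\<Sum>p\<in>P. w p * g p - (if p \<in> J then \<sigma> * (w p * e p * g p) else 0))"
      by (intro sum.cong) (auto simp: w'_def algebra_simps)
    also have "\<dots> = (\<Sum>p\<in>P. w p * g p) - (\<Sum>p\<in>P \<inter> J. \<sigma> * (w p * e p * g p))"
      using fP by (simp add: sum_subtractf sum.inter_restrict)
    also have "P \<inter> J = J" using J by blast
    finally show ?thesis by (simp add: sum_distrib_left)
  qed
  have "w' p > 0" if p: "p \<in> P'" for p
  proof -
    have "w p > 0" using p P by (auto simp: P'_def fin_dist_def)
    moreover have "\<sigma> * e p < 1" if "p \<in> J"
      using that p e(1) \<sigma>(1) by (force simp: P'_def abs_le_iff)
    ultimately show ?thesis by (auto simp: w'_def)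
  qed
  moreover have "sum w' P' = 1" using split[of "\<lambda>_. 1"] e(3) P by (simp add: fin_dist_def)
  ultimately have "fin_dist P' w'" using P by (auto simp: fin_dist_def P'_def)
  moreover have "card P' = card P - card {p\<in>J. e p = \<sigma>}"
    unfolding P'_def using fP J by (intro card_Diff_subset) auto
  then have "16 * card P' \<le> 15 * card P" using \<sigma>(2) J(2) by linarith
  moreover have "ridge_sum P w k \<alpha> x - ridge_sum P' w' k \<alpha> x = \<sigma> * ridge_sum J (\<lambda>p. w p * e p) k \<alpha> x" for \<alpha> x
    using split[of "\<lambda>p. mi_pow (fst p) \<alpha> * relu_pow (k - mi_order \<alpha>) (fst p \<bullet> x + snd p)"]
    by (simp add: ridge_sum_def mult.assoc)
  then have "\<bar>ridge_sum P w k \<alpha> x - ridge_sum P' w' k \<alpha> x\<bar> = \<bar>ridge_sum J (\<lambda>p. w p * e p) k \<alpha> x\<bar>" for \<alpha> x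
    using \<sigma>(1) by (auto simp: abs_mult)
  ultimately show ?thesis by blast
qed

lemma dyadic_scale:
  fixes y :: real
  assumes "1 \<le> y"
  shows "\<exists>L. 2 ^ L \<le> y \<and> y < 2 * 2 ^ L"
proof -
  obtain L where L: "2 ^ L \<le> nat \<lfloor>y\<rfloor>" "nat \<lfloor>y\<rfloor> < 2 ^ (L + 1)"
    using ex_power_ivl1[of 2 "nat \<lfloor>y\<rfloor>"] assms by (auto simp: le_nat_iff)
  have "real (2 ^ L) \<le> y" using L(1) assms by (metis le_nat_floor of_nat_le_iff of_nat_floor order_trans zero_le_one)
  moreover have "y < real (2 ^ (L + 1))" using L(2) assms by linarith
  ultimately show ?thesis by (intro exI[of _ L]) auto
qed

text \<open>With \<delta> of order M^(-1/D) the exponents -1/2 - 1/(2D) and -j/D add up to minus the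
  rate. The constants are made independent of \<open>j\<close> by
  \<open>2 * D * A \<ge> 1\<close>.\<close>

lemma scale_exponents:
  fixes A D M \<delta> :: real
  assumes "M > 0" "D \<ge> 1" "A \<ge> 1" "0 < \<delta>" "\<delta> \<le> A * M powr (- 1 / D)" "j \<le> k"
  shows "sqrt (\<delta> / M) * (2 * D * \<delta>) ^ j \<le> sqrt A * (2 * D * A) ^ k * M powr (- (1/2 + (2 * real j + 1) / (2 * D)))"
proof -
  have "sqrt (\<delta> / M) \<le> sqrt (A * M powr (- 1 / D) / M)"
    using assms by (intro real_sqrt_le_mono divide_right_mono) auto
  also have "\<dots> = sqrt A * sqrt (M powr (- 1 / D) * M powr (-1))"
    using assms by (simp add: real_sqrt_mult powr_minus_divide real_sqrt_divide)
  also have "sqrt (M powr (- 1 / D) * M powr (-1)) = M powr ((- 1 / D - 1) / 2)"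
  proof -
    have "sqrt (M powr (- 1 / D) * M powr (-1)) = sqrt (M powr (- 1 / D - 1))"
      by (simp only: powr_add[symmetric] add_uminus_conv_diff)
    also have "\<dots> = (M powr (- 1 / D - 1)) powr (1/2)" by (subst powr_half_sqrt) auto
    also have "\<dots> = M powr ((- 1 / D - 1) * (1/2))" by (rule powr_powr)
    finally show ?thesis by simp
  qed
  finally have 1: "sqrt (\<delta> / M) \<le> sqrt A * M powr ((- 1 / D - 1) / 2)" .
  have "(2 * D * \<delta>) ^ j \<le> (2 * D * (A * M powr (- 1 / D))) ^ j"
    using assms by (intro power_mono mult_left_mono) auto
  also have "\<dots> = (2 * D * A) ^ j * M powr (real j * (- 1 / D))"
    using assms by (simp add: power_mult_distrib powr_power mult.commute)
  also have "\<dots> \<le> (2 * D * A) ^ k * M powr (real j * (- 1 / D))"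
    using assms mult_mono[of 1 "2 * D" 1 A] by (intro mult_right_mono power_increasing) auto
  finally have 2: "(2 * D * \<delta>) ^ j \<le> (2 * D * A) ^ k * M powr (real j * (- 1 / D))" .
  have "sqrt (\<delta> / M) * (2 * D * \<delta>) ^ j \<le> (sqrt A * M powr ((- 1 / D - 1) / 2)) * ((2 * D * A) ^ k * M powr (real j * (- 1 / D)))"
    using 1 2 assms by (intro mult_mono) auto
  also have "\<dots> = sqrt A * (2 * D * A) ^ k * M powr ((- 1 / D - 1) / 2 + real j * (- 1 / D))"
    by (simp only: powr_add mult_ac)
  also have "(- 1 / D - 1) / 2 + real j * (- 1 / D) = - (1/2 + (2 * real j + 1) / (2 * D))"
    using assms by (simp add: field_simps)
  finally show ?thesis .
qed

lemma reduction_step: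
  fixes k :: nat
  shows "\<exists>C\<ge>0. \<forall>(P :: ((real^'d::finite) \<times> real) set) w. fin_dist P w \<longrightarrow> 2 \<le> card P \<longrightarrow>
    (\<exists>P' w'. fin_dist P' w' \<and> 16 * card P' \<le> 15 * card P \<and>
      (\<forall>\<alpha> x. mi_order \<alpha> \<le> k \<longrightarrow> x \<in> cball 0 1 \<longrightarrow>
        \<bar>ridge_sum P w k \<alpha> x - ridge_sum P' w' k \<alpha> x\<bar> \<le> C * real (card P) powr (- rate TYPE('d) k \<alpha>)))"
proof -
  define D where "D = real CARD('d)"
  define K where "K = real (card {\<alpha> :: 'd \<Rightarrow> nat. mi_order \<alpha> \<le> k})"
  \<comment> \<open>256 = 16 * 16: after a factor 2 for dyadic rounding,
    \<open>8 * D * (D + 1) / \<delta>\<close> is at most \<open>h / (16 * K)\<close>, which gives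
    the \<open>M / 8\<close> required in \<open>small\<close>.\<close>
  define A where "A = 256 * D * (D + 1) * K"
  define C0 where "C0 = exp (3 * real k) * (12 * (D + 1) / (1 - sqrt (1/2))\<^sup>2)"
  define C1 where "C1 = C0 * (sqrt A * (2 * D * A) ^ k) * 2 powr (real k + 1)"
  define m0 where "m0 = nat \<lceil>2 * max 16 (A ^ CARD('d))\<rceil>"
  \<comment> \<open>For at most \<open>m0\<close> atoms a single atom of \<open>P\<close> is taken;
    the trivial error \<open>2 * 2 ^ k\<close> is absorbed by this constant.\<close>
  define C2 where "C2 = 2 * 2 ^ k * (real m0 + 1) powr (real k + 1)"
  have D: "D \<ge> 1" by (simp add: D_def Suc_leI)
  have K: "K \<ge> 1"
  proof -
    have "(\<lambda>_. 0) \<in> {\<alpha> :: 'd \<Rightarrow> nat. mi_order \<alpha> \<le> k}" by (simp add: mi_order_def)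
    then have "card {\<alpha> :: 'd \<Rightarrow> nat. mi_order \<alpha> \<le> k} > 0" using finite_mi_order_le[of k, where 'd = 'd] by (auto simp: card_gt_0_iff)
    then show ?thesis by (simp add: K_def)
  qed
  have A: "A \<ge> 1"
  proof -
    have "1 * 1 * 1 \<le> D * (D + 1) * K" using D K by (intro mult_mono) auto
    then show ?thesis by (simp add: A_def)
  qed
  have C0: "C0 \<ge> 0" using D by (auto simp: C0_def intro!: mult_nonneg_nonneg divide_nonneg_nonneg)
  have C1: "C1 \<ge> 0" and C2: "C2 \<ge> 0" using C0 A D by (auto simp: C1_def C2_def)
  show ?thesis
  proof (intro exI[of _ "C1 + C2"] conjI allI impI)
    show "0 \<le> C1 + C2" using C1 C2 by simp
  next
    fix P :: "((real^'d) \<times> real) set" and w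
    assume P: "fin_dist P w" and c2: "2 \<le> card P"
    define m where "m = card P"
    have m: "real m \<ge> 2" using c2 by (simp add: m_def)
    have fP: "finite P" using P by (simp add: fin_dist_def)
    show "\<exists>P' w'. fin_dist P' w' \<and> 16 * card P' \<le> 15 * card P \<and>
      (\<forall>\<alpha> x. mi_order \<alpha> \<le> k \<longrightarrow> x \<in> cball 0 1 \<longrightarrow>
        \<bar>ridge_sum P w k \<alpha> x - ridge_sum P' w' k \<alpha> x\<bar> \<le> (C1 + C2) * real (card P) powr (- rate TYPE('d) k \<alpha>))"
    proof (cases "m \<le> m0")
      case True
      have "P \<noteq> {}" using c2 by auto
      then obtain p where p: "p \<in> P" by blast
      have d: "fin_dist {p} (\<lambda>_. 1)" using P p by (auto simp: fin_dist_def)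
      show ?thesis
      proof (intro exI[of _ "{p}"] exI[of _ "\<lambda>_. 1"] conjI allI impI d)
        show "16 * card {p} \<le> 15 * card P" using c2 by simp
        fix \<alpha> :: "'d \<Rightarrow> nat" and x :: "real^'d" assume \<alpha>: "mi_order \<alpha> \<le> k" and x: "x \<in> cball 0 1"
        have "\<bar>ridge_sum P w k \<alpha> x - ridge_sum {p} (\<lambda>_. 1) k \<alpha> x\<bar> \<le> 2 * 2 ^ k * 1"
          using abs_ridge_sum_le[OF P x, of k \<alpha>] abs_ridge_sum_le[OF d x, of k \<alpha>] by linarith
        also have "\<dots> \<le> 2 * 2 ^ k * ((real m0 + 1) powr (real k + 1) * real m powr (- rate TYPE('d) k \<alpha>))"
        proof (rule mult_left_mono)
          have "real m powr rate TYPE('d) k \<alpha> \<le> real m powr (real k + 1)"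
            using m rate_bounds[OF \<alpha>] by (intro powr_mono) auto
          also have "\<dots> \<le> (real m0 + 1) powr (real k + 1)"
            using True by (intro powr_mono2) auto
          finally show "1 \<le> (real m0 + 1) powr (real k + 1) * real m powr (- rate TYPE('d) k \<alpha>)"
            using m by (simp add: powr_minus field_simps)
        qed simp
        also have "\<dots> = C2 * real m powr (- rate TYPE('d) k \<alpha>)" by (simp add: C2_def)
        also have "\<dots> \<le> (C1 + C2) * real m powr (- rate TYPE('d) k \<alpha>)" using C1 by (intro mult_right_mono) auto
        finally show "\<bar>ridge_sum P w k \<alpha> x - ridge_sum {p} (\<lambda>_. 1) k \<alpha> x\<bar> \<le> (C1 + C2) * real (card P) powr (- rate TYPE('d) k \<alpha>)"
          by (simp add: m_def)
      qed
    next
      case False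
      \<comment> \<open>The light atoms. As the total mass is 1, at most half of the atoms weigh
        more than \<open>2 / m\<close>.\<close>
      define J where "J = {p\<in>P. w p \<le> 2 / real m}"
      define M where "M = card J"
      have J: "J \<subseteq> P" "finite J" using fP by (auto simp: J_def)
      have "real (card (P - J)) * (2 / real m) \<le> 1"
      proof -
        have "real (card (P - J)) * (2 / real m) = (\<Sum>p\<in>P - J. 2 / real m)" by simp
        also have "\<dots> \<le> sum w (P - J)" by (intro sum_mono) (auto simp: J_def)
        also have "\<dots> \<le> sum w P" using fP P by (intro sum_mono2) (auto simp: fin_dist_def less_imp_le)
        finally show ?thesis using P by (simp add: fin_dist_def)
      qed
      then have "2 * card (P - J) \<le> m" using m by (simp add: field_simps)
      moreover have "card (P - J) = m - M" "M \<le> m"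
        using J fP by (auto simp: m_def M_def card_Diff_subset intro: card_mono)
      ultimately have Mm: "m \<le> 2 * M" by linarith
      have "real m > 2 * max 16 (A ^ CARD('d))" using False unfolding m0_def by linarith
      then have M: "real M > 16" "real M > A ^ CARD('d)" using Mm by (auto simp: max_def split: if_splits)
      define h where "h = real M powr (1 / D)"
      have h: "h > 0" "h ^ CARD('d) = real M"
        using M D by (auto simp: h_def powr_power D_def)
      have "A < h" using M(2) h A by (metis power_less_imp_less_base less_imp_le)
      have M0: "real M > 0" using M by simp
      have "1 \<le> h ^ CARD('d)" using h M by simp
      then have h1: "h \<le> real M"
        unfolding h(2)[symmetric] using h(1) \<open>A < h\<close> A by (intro self_le_power) auto
      \<comment> \<open>The colouring needs \<delta> of the form \<open>2 ^ L / M\<close>. Here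
        \<open>y\<close> is \<open>M\<close> times the ideal scale \<open>A / h\<close>; rounding it
        down to a power of two costs a factor below 2, and \<open>A < h\<close> keeps it below
        \<open>M\<close>.\<close>
      define y where "y = A * (real M / h)"
      have y: "1 \<le> y" "y \<le> real M"
        using A h h1 \<open>A < h\<close> M0 mult_mono[of 1 A 1 "real M / h"] by (auto simp: y_def field_simps)
      obtain L where L: "2 ^ L \<le> y" "y < 2 * 2 ^ L" using dyadic_scale[OF y(1)] by blast
      define \<delta> where "\<delta> = 2 ^ L / real M"
      have \<delta>: "0 < \<delta>" "\<delta> \<le> A / h" "A / h \<le> 2 * \<delta>"
        using L M0 h unfolding \<delta>_def y_def by (auto simp: field_simps)
      have small: "2 * (8 * D * (D + 1) / \<delta>) ^ CARD('d) * K \<le> real M / 8"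
      proof -
        have "1 / \<delta> \<le> 2 * h / A" using \<delta> h A by (simp add: field_simps)
        then have "8 * D * (D + 1) * (1 / \<delta>) \<le> 8 * D * (D + 1) * (2 * h / A)" using D by (intro mult_left_mono) auto
        also have "\<dots> = (16 * (D * (D + 1))) * h / ((16 * (D * (D + 1))) * (16 * K))" by (simp add: A_def mult_ac)
        also have "\<dots> = h * (1 / (16 * K))" using D by (subst mult_divide_mult_cancel_left) auto
        finally have "(8 * D * (D + 1) / \<delta>) ^ CARD('d) \<le> (h * (1 / (16 * K))) ^ CARD('d)"
          using \<delta> D by (intro power_mono) auto
        also have "\<dots> = real M * (1 / (16 * K)) ^ CARD('d)" by (simp only: power_mult_distrib h(2))
        also have "\<dots> \<le> real M * (1 / (16 * K)) ^ 1"
          using K by (intro mult_left_mono power_decreasing) (auto simp: Suc_leI)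
        finally have "2 * (8 * D * (D + 1) / \<delta>) ^ CARD('d) * K \<le> 2 * (real M * (1 / (16 * K))) * K"
          using K by (intro mult_right_mono mult_left_mono) auto
        also have "\<dots> = real M / 8" using K by simp
        finally show ?thesis .
      qed
      have "(2::real) ^ L \<le> real M" using L y by linarith
      then have LM: "2 ^ L \<le> M" by simp
      have wJ: "0 \<le> w p" "w p \<le> 2 / real M" if "p \<in> J" for p
      proof -
        show "0 \<le> w p" using that P by (auto simp: J_def fin_dist_def less_imp_le)
        have "w p \<le> 2 / real m" using that by (simp add: J_def)
        also have "\<dots> \<le> 2 / real M" using M0 \<open>M \<le> m\<close> by (intro divide_left_mono) auto
        finally show "w p \<le> 2 / real M" .
      qed
      have J': "J \<subseteq> param_dom" "16 \<le> M" using J P M by (auto simp: fin_dist_def)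
      obtain e where e: "\<forall>p\<in>J. \<bar>e p\<bar> \<le> 1" "M \<le> 4 * card {p\<in>J. \<bar>e p\<bar> = 1}" "(\<Sum>p\<in>J. w p * e p) = 0"
        and bd: "\<forall>\<alpha> x. mi_order \<alpha> \<le> k \<longrightarrow> x \<in> cball 0 1 \<longrightarrow> \<bar>ridge_sum J (\<lambda>p. w p * e p) k \<alpha> x\<bar> \<le>
          C0 * sqrt (\<delta> / real M) * (2 * D * \<delta>) ^ (k - mi_order \<alpha>)"
        using halfspace_coloring[where w = w, OF J(2) J'(1) M_def J'(2) wJ LM \<delta>_def small[unfolded D_def K_def]]
        unfolding C0_def D_def by blast
      obtain P' w' where P': "fin_dist P' w'" "16 * card P' \<le> 15 * card P"
        "\<forall>\<alpha> x. \<bar>ridge_sum P w k \<alpha> x - ridge_sum P' w' k \<alpha> x\<bar> = \<bar>ridge_sum J (\<lambda>p. w p * e p) k \<alpha> x\<bar>"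
        using reduction_from_coloring[OF P J(1) _ e(1) _ e(3)] e(2) Mm unfolding M_def m_def by blast
      have "\<bar>ridge_sum P w k \<alpha> x - ridge_sum P' w' k \<alpha> x\<bar> \<le> (C1 + C2) * real m powr (- rate TYPE('d) k \<alpha>)"
        if \<alpha>: "mi_order \<alpha> \<le> k" and x: "x \<in> cball 0 1" for \<alpha> x
      proof -
        let ?j = "k - mi_order \<alpha>" and ?\<gamma> = "rate TYPE('d) k \<alpha>"
        have \<gamma>: "?\<gamma> = 1/2 + (2 * real ?j + 1) / (2 * D)" using \<alpha> by (simp add: rate_def D_def of_nat_diff)
        have "\<bar>ridge_sum P w k \<alpha> x - ridge_sum P' w' k \<alpha> x\<bar> \<le> C0 * (sqrt (\<delta> / real M) * (2 * D * \<delta>) ^ ?j)"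
          using P'(3) bd \<alpha> x by (simp add: mult.assoc)
        also have "\<dots> \<le> C0 * (sqrt A * (2 * D * A) ^ k * real M powr (- ?\<gamma>))"
          unfolding \<gamma> using M0 D A \<delta> C0
          by (intro mult_left_mono scale_exponents) (auto simp: h_def powr_minus_divide)
        also have "real M powr (- ?\<gamma>) \<le> 2 powr (real k + 1) * real m powr (- ?\<gamma>)"
        proof -
          have "real m powr ?\<gamma> \<le> (2 * real M) powr ?\<gamma>"
            using Mm rate_bounds[OF \<alpha>] by (intro powr_mono2) auto
          also have "\<dots> = 2 powr ?\<gamma> * real M powr ?\<gamma>" by (simp add: powr_mult)
          also have "\<dots> \<le> 2 powr (real k + 1) * real M powr ?\<gamma>"
            using rate_bounds[OF \<alpha>] by (intro mult_right_mono powr_mono) auto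
          finally show ?thesis using M0 m by (simp add: powr_minus field_simps)
        qed
        finally have "\<bar>ridge_sum P w k \<alpha> x - ridge_sum P' w' k \<alpha> x\<bar> \<le>
            C0 * (sqrt A * (2 * D * A) ^ k * (2 powr (real k + 1) * real m powr (- ?\<gamma>)))"
          using C0 A D by (simp add: mult_left_mono)
        also have "\<dots> = C1 * real m powr (- ?\<gamma>)" by (simp add: C1_def)
        also have "\<dots> \<le> (C1 + C2) * real m powr (- ?\<gamma>)" using C2 by (intro mult_right_mono) auto
        finally show ?thesis .
      qed
      with P'(1,2) show ?thesis unfolding m_def by blast
    qed
  qed
qed

text \<open>Each reduction shrinks the support by 15/16 while its error grows at least
  geometrically, so the last reductions, made with more than \<open>n\<close> atoms, dominate
  whatever the initial size was.\<close>

lemma finite_quadrature: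
  fixes k :: nat
  shows "\<exists>C\<ge>0. \<forall>(n::nat) (P :: ((real^'d::finite) \<times> real) set) w. 1 \<le> n \<longrightarrow> fin_dist P w \<longrightarrow>
    (\<exists>P' w'. fin_dist P' w' \<and> card P' \<le> n \<and>
      (\<forall>\<alpha> x. mi_order \<alpha> \<le> k \<longrightarrow> x \<in> cball 0 1 \<longrightarrow>
        \<bar>ridge_sum P w k \<alpha> x - ridge_sum P' w' k \<alpha> x\<bar> \<le> C * real n powr (- rate TYPE('d) k \<alpha>)))"
proof -
  obtain C where C: "C \<ge> 0" and step: "\<And>(P :: ((real^'d) \<times> real) set) w. fin_dist P w \<Longrightarrow> 2 \<le> card P \<Longrightarrow>
    (\<exists>P' w'. fin_dist P' w' \<and> 16 * card P' \<le> 15 * card P \<and>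
      (\<forall>\<alpha> x. mi_order \<alpha> \<le> k \<longrightarrow> x \<in> cball 0 1 \<longrightarrow>
        \<bar>ridge_sum P w k \<alpha> x - ridge_sum P' w' k \<alpha> x\<bar> \<le> C * real (card P) powr (- rate TYPE('d) k \<alpha>)))"
    using reduction_step[where 'd = 'd, of k] by blast
  \<comment> \<open>As every rate is at least 1/2, one reduction multiplies
    \<open>card powr (- rate)\<close> by at least \<open>1 + \<kappa>\<close>. With
    \<open>D * \<kappa> = C\<close> this increase pays for the error of the reduction.\<close>
  define \<kappa> where "\<kappa> = (16/15 :: real) powr (1/2) - 1"
  have \<kappa>: "\<kappa> > 0" using powr_less_mono[of 0 "1/2" "16/15 :: real"] by (simp add: \<kappa>_def)
  define D where "D = C / \<kappa>"
  have D: "D \<ge> 0" "D * \<kappa> = C" using C \<kappa> by (auto simp: D_def)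
  let ?err = "\<lambda>P w P' w' \<alpha> x. \<bar>ridge_sum P w k \<alpha> x - ridge_sum P' w' k \<alpha> x\<bar>"
  text \<open>The subtracted term \<open>D * (card P) powr (- rate)\<close> makes the errors of the successive reductions telescope.\<close>
  have main: "\<exists>P' w'. fin_dist P' w' \<and> card P' \<le> n \<and> (\<forall>\<alpha> x. mi_order \<alpha> \<le> k \<longrightarrow> x \<in> cball 0 1 \<longrightarrow>
        ?err P w P' w' \<alpha> x \<le> (C + D) * real n powr (- rate TYPE('d) k \<alpha>) - D * real (card P) powr (- rate TYPE('d) k \<alpha>))"
    if "1 \<le> n" "fin_dist P w" "n < card P" for n and P :: "((real^'d) \<times> real) set" and w
    using that(2,3)
  proof (induction "card P" arbitrary: P w rule: less_induct)
    case less
    have c2: "2 \<le> card P" using less.prems \<open>1 \<le> n\<close> by linarith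
    then obtain P1 w1 where P1: "fin_dist P1 w1" "16 * card P1 \<le> 15 * card P"
      and err1: "\<And>\<alpha> x. mi_order \<alpha> \<le> k \<Longrightarrow> x \<in> cball 0 1 \<Longrightarrow> ?err P w P1 w1 \<alpha> x \<le> C * real (card P) powr (- rate TYPE('d) k \<alpha>)"
      using step[OF less.prems(1)] by blast
    show ?case
    proof (cases "card P1 \<le> n")
      case True
      have "?err P w P1 w1 \<alpha> x \<le> (C + D) * real n powr (- rate TYPE('d) k \<alpha>) - D * real (card P) powr (- rate TYPE('d) k \<alpha>)"
        if a: "mi_order \<alpha> \<le> k" "x \<in> cball 0 1" for \<alpha> x
      proof -
        have "(C + D) * real (card P) powr (- rate TYPE('d) k \<alpha>) \<le> (C + D) * real n powr (- rate TYPE('d) k \<alpha>)"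
          using less.prems(2) \<open>1 \<le> n\<close> C D rate_bounds(1)[OF a(1)] by (intro mult_left_mono powr_mono2') auto
        with err1[OF a] show ?thesis by (simp add: algebra_simps)
      qed
      with P1(1) True show ?thesis by blast
    next
      case False
      have "card P1 < card P" using P1(2) c2 by linarith
      from less.hyps[OF this P1(1)] False
      obtain P2 w2 where P2: "fin_dist P2 w2" "card P2 \<le> n"
        and err2: "\<And>\<alpha> x. mi_order \<alpha> \<le> k \<Longrightarrow> x \<in> cball 0 1 \<Longrightarrow>
          ?err P1 w1 P2 w2 \<alpha> x \<le> (C + D) * real n powr (- rate TYPE('d) k \<alpha>) - D * real (card P1) powr (- rate TYPE('d) k \<alpha>)"
        by (auto simp: not_le)
      have "?err P w P2 w2 \<alpha> x \<le> (C + D) * real n powr (- rate TYPE('d) k \<alpha>) - D * real (card P) powr (- rate TYPE('d) k \<alpha>)"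
        if a: "mi_order \<alpha> \<le> k" "x \<in> cball 0 1" for \<alpha> x
      proof -
        let ?\<gamma> = "rate TYPE('d) k \<alpha>"
        have "(1 + \<kappa>) * real (card P) powr (- ?\<gamma>) \<le> (16/15) powr ?\<gamma> * real (card P) powr (- ?\<gamma>)"
          unfolding \<kappa>_def using rate_bounds(1)[OF a(1)] by (intro mult_right_mono) (auto intro!: powr_mono)
        also have "\<dots> = (15/16 * real (card P)) powr (- ?\<gamma>)"
        proof -
          have "(16/15 :: real) powr ?\<gamma> = (15/16) powr (- ?\<gamma>)"
            using powr_minus_divide[of "15/16 :: real" ?\<gamma>] powr_divide[of 1 "15/16 :: real" ?\<gamma>] by simp
          then show ?thesis using powr_mult[of "15/16 :: real" "real (card P)" "- ?\<gamma>"] by simp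
        qed
        also have "\<dots> \<le> real (card P1) powr (- ?\<gamma>)"
          using P1(2) False rate_bounds(1)[OF a(1)] by (intro powr_mono2') auto
        finally have "D * ((1 + \<kappa>) * real (card P) powr (- ?\<gamma>)) \<le> D * real (card P1) powr (- ?\<gamma>)"
          using D by (intro mult_left_mono)
        then have "D * real (card P) powr (- ?\<gamma>) + C * real (card P) powr (- ?\<gamma>) \<le> D * real (card P1) powr (- ?\<gamma>)"
          unfolding D(2)[symmetric] by (simp add: algebra_simps)
        with err1[OF a] err2[OF a] show ?thesis by linarith
      qed
      with P2 show ?thesis by blast
    qed
  qed
  show ?thesis
  proof (intro exI[of _ "C + D"] conjI allI impI)
    show "0 \<le> C + D" using C D by simp
    fix n :: nat and P :: "((real^'d) \<times> real) set" and w assume n: "1 \<le> n" and P: "fin_dist P w"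
    show "\<exists>P' w'. fin_dist P' w' \<and> card P' \<le> n \<and> (\<forall>\<alpha> x. mi_order \<alpha> \<le> k \<longrightarrow> x \<in> cball 0 1 \<longrightarrow>
        ?err P w P' w' \<alpha> x \<le> (C + D) * real n powr (- rate TYPE('d) k \<alpha>))"
    proof (cases "n < card P")
      case True
      from main[OF n P True] obtain P' w' where "fin_dist P' w'" "card P' \<le> n"
        "\<And>\<alpha> x. mi_order \<alpha> \<le> k \<Longrightarrow> x \<in> cball 0 1 \<Longrightarrow>
          ?err P w P' w' \<alpha> x \<le> (C + D) * real n powr (- rate TYPE('d) k \<alpha>) - D * real (card P) powr (- rate TYPE('d) k \<alpha>)"
        by blast
      moreover have "D * real (card P) powr (- rate TYPE('d) k \<alpha>) \<ge> 0" for \<alpha> using D by simp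
      ultimately show ?thesis by (smt (verit))
    next
      case False
      then show ?thesis using P C D by (intro exI[of _ P] exI[of _ w]) auto
    qed
  qed
qed

section \<open>Discretization\<close>

text \<open>Near \<open>y\<^sub>0\<close> the halfspaces \<open>{p. 0 \<le> p \<bullet> y}\<close> agree outside a thin double cone around the hyperplane
  \<open>y\<^sub>0\<^sup>\<bottom>\<close>. The mass on the hyperplane itself, which need not be small, is treated by induction on the dimension.\<close>
lemma halfspace_brackets:
  fixes V :: "'a::euclidean_space set"
  assumes V: "subspace V" and \<tau>: "finite_measure \<tau>" "sets \<tau> = sets borel" and \<eta>: "0 < \<eta>"
  shows "\<exists>B. finite B \<and> B \<subseteq> sets borel \<times> sets borel \<and>
    (\<forall>y. \<exists>(L, U)\<in>B. L \<subseteq> V \<inter> {p. 0 \<le> p \<bullet> y} \<and> V \<inter> {p. 0 \<le> p \<bullet> y} \<subseteq> U \<and> measure \<tau> (U - L) \<le> \<eta>)"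
  using V \<eta>
proof (induction "dim V" arbitrary: V \<eta> rule: less_induct)
  case less
  interpret finite_measure \<tau> by (rule \<tau>(1))
  have closed_V: "closed V" using less.prems(1) by (rule closed_subspace)
  then have mV: "V \<in> sets borel" by simp
  define brk where "brk \<epsilon> W y L U \<longleftrightarrow> L \<subseteq> W \<inter> {p. 0 \<le> p \<bullet> y} \<and> W \<inter> {p. 0 \<le> p \<bullet> y} \<subseteq> U \<and> measure \<tau> (U - L) \<le> \<epsilon>"
    for \<epsilon> W y L U
  have local: "\<exists>r>0. \<exists>B. finite B \<and> B \<subseteq> sets borel \<times> sets borel \<and> (\<forall>y\<in>ball y0 r. \<exists>(L, U)\<in>B. brk \<eta> V y L U)"
    if y0: "y0 \<in> V \<inter> sphere 0 1" for y0
  proof -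
    define V0 where "V0 = V \<inter> {p. p \<bullet> y0 = 0}"
    have V0: "subspace V0" unfolding V0_def
      using subspace_inter[OF less.prems(1) subspace_hyperplane[of y0]] by (simp add: inner_commute)
    have mV0: "V0 \<in> sets borel" using closed_subspace[OF V0] by simp
    have "y0 \<notin> V0" using y0 by (simp add: V0_def dot_square_norm)
    moreover have "V0 \<subseteq> V" unfolding V0_def by blast
    ultimately have "V0 \<subset> V" using y0 by blast
    then have "dim V0 < dim V"
      using V0 less.prems(1) by (intro dim_psubset) (simp add: span_eq_iff[THEN iffD2])
    from less.hyps[OF this V0, of "\<eta> / 2"] less.prems(2)
    obtain B0 where B0: "finite B0" "B0 \<subseteq> sets borel \<times> sets borel" "\<And>y. \<exists>(L, U)\<in>B0. brk (\<eta>/2) V0 y L U"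
      unfolding brk_def by auto
    \<comment> \<open>The hyperplane is removed so that these cones decrease to the empty set; with
      it they would decrease to \<open>V0\<close>, which may carry mass and is bracketed by
      induction.\<close>
    define A where "A n = V \<inter> {p. p \<bullet> y0 \<noteq> 0 \<and> \<bar>p \<bullet> y0\<bar> \<le> norm p / real (Suc n)}" for n
    have mA: "A n \<in> sets \<tau>" for n
    proof -
      have "{p. p \<bullet> y0 \<noteq> 0 \<and> \<bar>p \<bullet> y0\<bar> \<le> norm p / real (Suc n)} \<in> sets borel" by measurable
      then show ?thesis unfolding A_def \<tau>(2) using mV by blast
    qed
    have "(\<lambda>n. measure \<tau> (A n)) \<longlonglongrightarrow> measure \<tau> (\<Inter>n. A n)"
    proof (rule finite_Lim_measure_decseq)
      show "range A \<subseteq> sets \<tau>" using mA by blast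
      show "decseq A"
        unfolding decseq_Suc_iff
      proof (intro allI subsetI)
        fix n p assume p: "p \<in> A (Suc n)"
        have "norm p / real (Suc (Suc n)) \<le> norm p / real (Suc n)" by (intro divide_left_mono) auto
        with p show "p \<in> A n" unfolding A_def by auto
      qed
    qed
    also have "(\<Inter>n. A n) = {}"
    proof (rule ccontr)
      assume "(\<Inter>n. A n) \<noteq> {}"
      then obtain p where p: "\<And>n. p \<in> A n" by blast
      have "(\<lambda>n. norm p / real (Suc n)) \<longlonglongrightarrow> 0" using lim_const_over_n[of "norm p"] by (rule LIMSEQ_Suc)
      moreover have "\<bar>p \<bullet> y0\<bar> \<le> norm p / real (Suc n)" for n using p[of n] by (simp add: A_def)
      ultimately have "\<bar>p \<bullet> y0\<bar> \<le> 0" by (intro LIMSEQ_le_const) auto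
      then show False using p[of 0] by (simp add: A_def)
    qed
    finally have "(\<lambda>n. measure \<tau> (A n)) \<longlonglongrightarrow> 0" by simp
    then have "eventually (\<lambda>n. measure \<tau> (A n) < \<eta> / 2) sequentially"
      using less.prems(2) by (intro order_tendstoD) auto
    then obtain n where n: "measure \<tau> (A n) < \<eta> / 2" by (auto simp: eventually_sequentially)
    define r where "r = 1 / real (Suc n)"
    define P where "P = V \<inter> {p. norm p * r < p \<bullet> y0}"
    define Q where "Q = V \<inter> {p. p \<bullet> y0 \<noteq> 0 \<and> - (norm p * r) \<le> p \<bullet> y0}"
    have mPQ: "P \<in> sets borel" "Q \<in> sets borel"
    proof -
      have "{p. norm p * r < p \<bullet> y0} \<in> sets borel" "{p. p \<bullet> y0 \<noteq> 0 \<and> - (norm p * r) \<le> p \<bullet> y0} \<in> sets borel"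
        by measurable
      then show "P \<in> sets borel" "Q \<in> sets borel" unfolding P_def Q_def using mV by blast+
    qed
    define B where "B = (\<lambda>(L, U). (L \<union> P, U \<union> Q)) ` B0"
    have r: "r > 0" by (simp add: r_def)
    show ?thesis
    proof (intro exI[of _ r] conjI r exI[of _ B] ballI)
      show "finite B" using B0 by (simp add: B_def)
      show "B \<subseteq> sets borel \<times> sets borel" using B0(2) mPQ by (auto simp: B_def)
      fix y assume y: "y \<in> ball y0 r"
      obtain L U where LU: "(L, U) \<in> B0" "brk (\<eta>/2) V0 y L U" using B0(3)[of y] by blast
      have near: "\<bar>p \<bullet> y - p \<bullet> y0\<bar> \<le> norm p * r" for p
      proof -
        have "\<bar>p \<bullet> (y - y0)\<bar> \<le> norm p * norm (y - y0)" by (rule Cauchy_Schwarz_ineq2)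
        also have "\<dots> \<le> norm p * r" using y by (intro mult_left_mono) (auto simp: dist_norm norm_minus_commute)
        finally show ?thesis by (simp add: inner_diff_right)
      qed
      have pos: "0 \<le> p \<bullet> y" if "norm p * r < p \<bullet> y0" for p using near[of p] that by linarith
      have neg: "- (norm p * r) \<le> p \<bullet> y0" if "0 \<le> p \<bullet> y" for p using near[of p] that by linarith
      have "L \<union> P \<subseteq> V \<inter> {p. 0 \<le> p \<bullet> y}"
        using LU(2) pos by (auto simp: brk_def V0_def P_def)
      moreover have "V \<inter> {p. 0 \<le> p \<bullet> y} \<subseteq> U \<union> Q"
        using LU(2) neg by (auto simp: brk_def V0_def Q_def)
      moreover have "measure \<tau> ((U \<union> Q) - (L \<union> P)) \<le> measure \<tau> ((U - L) \<union> A n)"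
        using LU(1) B0(2) mA \<tau>(2)
        by (intro finite_measure_mono) (auto simp: Q_def P_def A_def r_def abs_le_iff divide_inverse)
      moreover have "measure \<tau> ((U - L) \<union> A n) \<le> measure \<tau> (U - L) + measure \<tau> (A n)"
        using LU(1) B0(2) mA \<tau>(2) by (intro measure_Un_le) auto
      ultimately have "brk \<eta> V y (L \<union> P) (U \<union> Q)" using LU(2) n by (auto simp: brk_def)
      moreover have "(L \<union> P, U \<union> Q) \<in> B" using LU(1) by (force simp: B_def)
      ultimately show "\<exists>(L, U)\<in>B. brk \<eta> V y L U" by blast
    qed
  qed
  then obtain r B where rB: "\<And>y0. y0 \<in> V \<inter> sphere 0 1 \<Longrightarrow> 0 < r y0 \<and> finite (B y0) \<and> B y0 \<subseteq> sets borel \<times> sets borel \<and>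
      (\<forall>y\<in>ball y0 (r y0). \<exists>(L, U)\<in>B y0. brk \<eta> V y L U)" by metis
  have comp: "compact (V \<inter> sphere 0 1)" using closed_V by (simp add: closed_Int_compact)
  have cov: "V \<inter> sphere 0 1 \<subseteq> (\<Union>y0\<in>V \<inter> sphere 0 1. ball y0 (r y0))" using rB by fastforce
  obtain C where C: "C \<subseteq> V \<inter> sphere 0 1" "finite C" "V \<inter> sphere 0 1 \<subseteq> (\<Union>y0\<in>C. ball y0 (r y0))"
    by (rule compactE_image[OF comp open_ball cov])
  \<comment> \<open>The pair \<open>(V, V)\<close> serves the vectors \<open>y\<close> orthogonal to
    \<open>V\<close>, whose halfspace contains all of \<open>V\<close>. It also settles dimension 0,
    where the sphere in \<open>V\<close> is empty.\<close>
  define BB where "BB = insert (V, V) (\<Union>y0\<in>C. B y0)"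
  have "finite (B y0)" if "y0 \<in> C" for y0 using rB that C(1) by blast
  then have fBB: "finite BB" unfolding BB_def using C(2) by blast
  have mBB: "BB \<subseteq> sets borel \<times> sets borel" unfolding BB_def using C(1) rB mV by blast
  have "\<exists>(L, U)\<in>BB. brk \<eta> V y L U" for y
  proof -
    \<comment> \<open>On \<open>V\<close> the halfspace depends only on the direction of the
      projection of \<open>y\<close>, so the compact unit sphere of \<open>V\<close> covers all
      \<open>y\<close>.\<close>
    obtain v z where vz: "v \<in> span V" "\<And>w. w \<in> span V \<Longrightarrow> orthogonal z w" "y = v + z"
      using orthogonal_subspace_decomp_exists[of V y] by metis
    have sp: "span V = V" using less.prems(1) by simp
    have py: "p \<bullet> y = p \<bullet> v" if "p \<in> V" for p
      using vz(2)[of p] that sp by (simp add: vz(3) inner_add_right orthogonal_def inner_commute)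
    show ?thesis
    proof (cases "v = 0")
      case True
      then have "brk \<eta> V y V V" using py less.prems(2) by (auto simp: brk_def)
      then show ?thesis by (auto simp: BB_def)
    next
      case False
      define u where "u = v /\<^sub>R norm v"
      have u: "u \<in> V \<inter> sphere 0 1"
        using False vz(1) sp less.prems(1) by (auto simp: u_def subspace_scale)
      then obtain y0 where y0: "y0 \<in> C" "u \<in> ball y0 (r y0)" using C(3) by blast
      then obtain L U where LU: "(L, U) \<in> B y0" "brk \<eta> V u L U" using rB C(1) by blast
      have "(0 \<le> p \<bullet> u) = (0 \<le> p \<bullet> y)" if "p \<in> V" for p
        using py[OF that] False by (simp add: u_def zero_le_mult_iff)
      then have "V \<inter> {p. 0 \<le> p \<bullet> u} = V \<inter> {p. 0 \<le> p \<bullet> y}" by blast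
      then have "brk \<eta> V y L U" using LU(2) by (simp add: brk_def)
      then show ?thesis using LU(1) y0(1) by (auto simp: BB_def)
    qed
  qed
  then show ?case using fBB mBB unfolding brk_def by blast
qed

section \<open>Regularity of single atoms and approximation by finitely many\<close>

definition atom :: "nat \<Rightarrow> ('d::finite \<Rightarrow> nat) \<Rightarrow> real^'d \<Rightarrow> (real^'d) \<times> real \<Rightarrow> real" where
  "atom k \<alpha> x p = mi_pow (fst p) \<alpha> * relu_pow (k - mi_order \<alpha>) (fst p \<bullet> x + snd p)"

lemma ridge_sum_atom: "ridge_sum P w k \<alpha> x = (\<Sum>p\<in>P. w p * atom k \<alpha> x p)"
  by (simp add: ridge_sum_def atom_def mult.assoc)

lemma atom_deriv_atom: "atom_deriv k \<alpha> x p = fact k / fact (k - mi_order \<alpha>) * atom k \<alpha> x p"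
  by (simp add: atom_deriv_def atom_def relu_pow_def Let_def)

lemma abs_atom_le:
  assumes "p \<in> param_dom" "x \<in> cball (0 :: real^'d::finite) 1"
  shows "\<bar>atom k \<alpha> x p\<bar> \<le> 2 ^ k"
  using abs_ridge_sum_le[of "{p}" "\<lambda>_. 1" x k \<alpha>] assms by (simp add: fin_dist_def ridge_sum_atom)

lemma compact_param_dom: "compact (param_dom :: ((real^'d::finite) \<times> real) set)"
  unfolding param_dom_def by (intro compact_Times) auto

lemma continuous_mi_pow: "continuous_on S (\<lambda>p. mi_pow (fst p) \<alpha>)"
  unfolding mi_pow_def by (intro continuous_intros)

lemma borel_measurable_atom:
  fixes \<alpha> :: "'d::finite \<Rightarrow> nat"
  shows "atom k \<alpha> x \<in> borel_measurable borel"
proof -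
  have [measurable]: "(\<lambda>p::(real^'d) \<times> real. mi_pow (fst p) \<alpha>) \<in> borel_measurable borel"
    "(\<lambda>p::(real^'d) \<times> real. fst p \<bullet> x + snd p) \<in> borel_measurable borel"
    by (intro borel_measurable_continuous_onI continuous_mi_pow continuous_intros)+
  show ?thesis unfolding atom_def relu_pow_def by measurable
qed

text \<open>On the nonnegative side an atom is a polynomial, uniformly continuous on the compact
  domain; for order k it may jump across the hyperplane. Finitely many \<alpha> give a common
  \<epsilon>.\<close>

lemma atom_modulus:
  assumes "0 < \<eta>"
  shows "\<exists>\<epsilon>>0. \<forall>\<alpha> x p q. mi_order \<alpha> \<le> k \<longrightarrow> x \<in> cball (0 :: real^'d::finite) 1 \<longrightarrow> p \<in> param_dom \<longrightarrow> q \<in> param_dom \<longrightarrow>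
    dist p q < \<epsilon> \<longrightarrow> 0 \<le> fst p \<bullet> x + snd p \<longrightarrow> 0 \<le> fst q \<bullet> x + snd q \<longrightarrow> \<bar>atom k \<alpha> x p - atom k \<alpha> x q\<bar> \<le> \<eta>"
proof -
  define A where "A = {\<alpha> :: 'd \<Rightarrow> nat. mi_order \<alpha> \<le> k}"
  define \<phi> where "\<phi> \<alpha> = (\<lambda>(x, p). mi_pow (fst p) \<alpha> * (fst p \<bullet> x + snd p) ^ (k - mi_order \<alpha>))"
    for \<alpha> :: "'d \<Rightarrow> nat"
  have "\<exists>\<epsilon>>0. \<forall>x\<in>cball 0 1. \<forall>p\<in>param_dom. \<forall>q\<in>param_dom. dist p q < \<epsilon> \<longrightarrow> \<bar>\<phi> \<alpha> (x, p) - \<phi> \<alpha> (x, q)\<bar> < \<eta>" for \<alpha>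
  proof -
    have "continuous_on (cball 0 1 \<times> param_dom) (\<phi> \<alpha>)"
      unfolding \<phi>_def case_prod_unfold mi_pow_def by (intro continuous_intros)
    then have "uniformly_continuous_on (cball 0 1 \<times> param_dom) (\<phi> \<alpha>)"
      by (intro compact_uniformly_continuous compact_Times compact_cball compact_param_dom)
    then obtain \<epsilon> where e: "\<epsilon> > 0" "\<And>u v. u \<in> cball 0 1 \<times> param_dom \<Longrightarrow> v \<in> cball 0 1 \<times> param_dom \<Longrightarrow>
        dist v u < \<epsilon> \<Longrightarrow> dist (\<phi> \<alpha> v) (\<phi> \<alpha> u) < \<eta>"
      unfolding uniformly_continuous_on_def using assms by metis
    have "\<bar>\<phi> \<alpha> (x, p) - \<phi> \<alpha> (x, q)\<bar> < \<eta>"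
      if "x \<in> cball 0 1" "p \<in> param_dom" "q \<in> param_dom" "dist p q < \<epsilon>" for x p q
      using e(2)[of "(x, q)" "(x, p)"] that by (simp add: dist_Pair_Pair dist_real_def)
    with e(1) show ?thesis by blast
  qed
  then obtain E where E: "\<And>\<alpha>. 0 < E \<alpha>" "\<And>\<alpha> x p q. x \<in> cball 0 1 \<Longrightarrow> p \<in> param_dom \<Longrightarrow> q \<in> param_dom \<Longrightarrow>
      dist p q < E \<alpha> \<Longrightarrow> \<bar>\<phi> \<alpha> (x, p) - \<phi> \<alpha> (x, q)\<bar> < \<eta>" by metis
  have A: "finite A" "A \<noteq> {}"
    using finite_mi_order_le[of k, where 'd = 'd] by (auto simp: A_def mi_order_def intro!: exI[of _ "\<lambda>_. 0"])
  define \<epsilon> where "\<epsilon> = Min (E ` A)"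
  have "\<epsilon> > 0" using A E(1) by (auto simp: \<epsilon>_def)
  moreover have "\<bar>atom k \<alpha> x p - atom k \<alpha> x q\<bar> \<le> \<eta>"
    if "mi_order \<alpha> \<le> k" "x \<in> cball 0 1" "p \<in> param_dom" "q \<in> param_dom" "dist p q < \<epsilon>"
      "0 \<le> fst p \<bullet> x + snd p" "0 \<le> fst q \<bullet> x + snd q" for \<alpha> :: "'d \<Rightarrow> nat" and x :: "real^'d" and p q
  proof -
    have "\<epsilon> \<le> E \<alpha>" using that(1) A unfolding \<epsilon>_def by (intro Min_le) (auto simp: A_def)
    then have "\<bar>\<phi> \<alpha> (x, p) - \<phi> \<alpha> (x, q)\<bar> < \<eta>" using that by (intro E(2)) auto
    then show ?thesis using that(6,7) by (simp add: \<phi>_def atom_def relu_pow_def)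
  qed
  ultimately show ?thesis by blast
qed

text \<open>The parameter domain is cut into the cells generated by small balls and by brackets, and
  the mass of each cell is moved to one representative. Only cells inside some \<open>U - L\<close>
  can be cut by the hyperplane of \<open>x\<close>, and their total mass is small.\<close>

lemma finite_approximation:
  fixes \<tau> :: "((real^'d::finite) \<times> real) measure"
  assumes \<tau>: "prob_on_dom \<tau>" and \<eta>: "0 < \<eta>"
  shows "\<exists>P w. fin_dist P w \<and> (\<forall>\<alpha> x. mi_order \<alpha> \<le> k \<longrightarrow> x \<in> cball 0 1 \<longrightarrow>
    \<bar>(\<integral>p. atom k \<alpha> x p \<partial>\<tau>) - ridge_sum P w k \<alpha> x\<bar> \<le> \<eta>)"
proof -
  interpret prob_space \<tau> using \<tau> by (simp add: prob_on_dom_def)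
  have sets_\<tau>: "sets \<tau> = sets borel" and null: "emeasure \<tau> (UNIV - param_dom) = 0"
    using \<tau> by (auto simp: prob_on_dom_def)
  have space_\<tau>: "space \<tau> = UNIV" using sets_eq_imp_space_eq[OF sets_\<tau>] by simp
  have m_dom: "param_dom \<in> sets borel" by (intro borel_closed compact_imp_closed compact_param_dom)
  have AE_dom: "AE p in \<tau>. p \<in> param_dom"
    using null m_dom by (intro AE_I[of _ _ "UNIV - param_dom"]) (auto simp: sets_\<tau>)
  \<comment> \<open>The halfspace of \<open>x\<close> is the homogeneous one of
    \<open>y = (x, 1)\<close>, so one finite family of brackets serves all \<open>x\<close>. Times
    the trivial difference \<open>2 * 2 ^ k\<close>, the bracket width contributes
    \<open>\<eta> / 2\<close>.\<close>
  obtain B where B: "finite B" "B \<subseteq> sets borel \<times> sets borel" "\<And>y. \<exists>(L, U)\<in>B. L \<subseteq> UNIV \<inter> {p. 0 \<le> p \<bullet> y} \<and>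
      UNIV \<inter> {p. 0 \<le> p \<bullet> y} \<subseteq> U \<and> measure \<tau> (U - L) \<le> \<eta> / (4 * 2 ^ k)"
    using halfspace_brackets[OF subspace_UNIV finite_measure_axioms sets_\<tau>, of "\<eta> / (4 * 2 ^ k)"] \<eta> by auto
  obtain \<epsilon> where \<epsilon>: "\<epsilon> > 0" and mod: "\<And>\<alpha> x p q. mi_order \<alpha> \<le> k \<Longrightarrow> x \<in> cball (0 :: real^'d) 1 \<Longrightarrow> p \<in> param_dom \<Longrightarrow> q \<in> param_dom \<Longrightarrow>
    dist p q < \<epsilon> \<Longrightarrow> 0 \<le> fst p \<bullet> x + snd p \<Longrightarrow> 0 \<le> fst q \<bullet> x + snd q \<Longrightarrow> \<bar>atom k \<alpha> x p - atom k \<alpha> x q\<bar> \<le> \<eta> / 2"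
    using atom_modulus[of "\<eta> / 2" k] \<eta> by (metis half_gt_zero)
  have cov: "(param_dom :: ((real^'d) \<times> real) set) \<subseteq> (\<Union>z\<in>param_dom. ball z (\<epsilon> / 2))" using \<epsilon> by auto
  obtain Z :: "((real^'d) \<times> real) set" where Z: "finite Z" "param_dom \<subseteq> (\<Union>z\<in>Z. ball z (\<epsilon> / 2))"
    by (rule compactE_image[OF compact_param_dom open_ball cov])
  define G where "G = (\<lambda>z. ball z (\<epsilon> / 2)) ` Z \<union> fst ` B \<union> snd ` B"
  have G: "finite G" "G \<subseteq> sets borel" using Z B by (auto simp: G_def)
  define key where "key p = {g\<in>G. p \<in> g}" for p
  define KS where "KS = key ` param_dom"
  define cell where "cell c = {p\<in>param_dom. key p = c}" for c
  define rep where "rep c = (SOME q. q \<in> param_dom \<and> key q = c)" for c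
  have KS: "finite KS" "KS \<subseteq> Pow G"
    using finite_subset[of KS "Pow G"] G by (auto simp: KS_def key_def)
  have rep: "rep c \<in> param_dom" "key (rep c) = c" if "c \<in> KS" for c
    using someI_ex[of "\<lambda>q. q \<in> param_dom \<and> key q = c"] that unfolding rep_def KS_def by auto
  have m_cell: "cell c \<in> sets \<tau>" if "c \<in> KS" for c
  proof -
    have "cell c = param_dom \<inter> (\<Inter>g\<in>G. if g \<in> c then g else UNIV - g)"
      using KS that by (auto simp: cell_def key_def split: if_splits)
    also have "\<dots> \<in> sets borel"
      using G m_dom by (intro sets.Int sets.countable_INT'' countable_finite) auto
    finally show ?thesis by (simp add: sets_\<tau>)
  qed
  define w where "w q = measure \<tau> (cell (key q))" for q
  \<comment> \<open>Null cells are dropped because \<open>fin_dist\<close> demands strictly positive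
    weights.\<close>
  define KP where "KP = {c\<in>KS. 0 < measure \<tau> (cell c)}"
  define P where "P = rep ` KP"
  have inj: "inj_on rep KP" using rep(2) by (intro inj_on_inverseI[of _ key]) (auto simp: KP_def)
  have sum_P: "(\<Sum>q\<in>P. w q * f q) = (\<Sum>c\<in>KS. measure \<tau> (cell c) * f (rep c))" for f
  proof -
    have "(\<Sum>q\<in>P. w q * f q) = (\<Sum>c\<in>KP. measure \<tau> (cell c) * f (rep c))"
      unfolding P_def using inj rep(2) by (subst sum.reindex) (auto simp: w_def KP_def)
    also have "\<dots> = (\<Sum>c\<in>KS. measure \<tau> (cell c) * f (rep c))"
      using KS by (intro sum.mono_neutral_left) (auto simp: KP_def zero_less_measure_iff)
    finally show ?thesis .
  qed
  define g where "g f p = (\<Sum>c\<in>KS. f (rep c) * indicator (cell c) p)" for f :: "(real^'d) \<times> real \<Rightarrow> real" and p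
  have int_g: "integrable \<tau> (g f)" and eq_g: "(\<integral>p. g f p \<partial>\<tau>) = (\<Sum>q\<in>P. w q * f q)" for f
  proof -
    have i: "integrable \<tau> (\<lambda>p. f (rep c) * indicator (cell c) p)" if "c \<in> KS" for c
      using m_cell[OF that] by (intro integrable_mult_right integrable_real_indicator) (auto simp: emeasure_eq_measure)
    then show "integrable \<tau> (g f)" unfolding g_def by (intro Bochner_Integration.integrable_sum)
    have "(\<integral>p. g f p \<partial>\<tau>) = (\<Sum>c\<in>KS. \<integral>p. f (rep c) * indicator (cell c) p \<partial>\<tau>)"
      unfolding g_def using i by (intro Bochner_Integration.integral_sum)
    also have "\<dots> = (\<Sum>c\<in>KS. measure \<tau> (cell c) * f (rep c))"
      using m_cell by (intro sum.cong refl) (simp add: space_\<tau> mult.commute)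
    finally show "(\<integral>p. g f p \<partial>\<tau>) = (\<Sum>q\<in>P. w q * f q)" by (simp add: sum_P)
  qed
  have g_dom: "g f p = f (rep (key p))" if "p \<in> param_dom" for f p
  proof -
    have "g f p = (\<Sum>c\<in>KS. if c = key p then f (rep c) else 0)"
      unfolding g_def using that by (intro sum.cong) (auto simp: cell_def indicator_def)
    then show ?thesis using KS that by (simp add: KS_def)
  qed
  have "sum w P = (\<integral>p. g (\<lambda>_. 1) p \<partial>\<tau>)" by (simp add: eq_g)
  also have "\<dots> = (\<integral>p. 1 \<partial>\<tau>)"
    using AE_dom by (intro integral_cong_AE borel_measurable_integrable[OF int_g]) (auto simp: g_dom elim: eventually_mono)
  also have "\<dots> = 1" using prob_space by simp
  finally have "fin_dist P w"
    using KS rep by (auto simp: fin_dist_def P_def KP_def w_def)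
  moreover have "\<bar>(\<integral>p. atom k \<alpha> x p \<partial>\<tau>) - ridge_sum P w k \<alpha> x\<bar> \<le> \<eta>"
    if \<alpha>: "mi_order \<alpha> \<le> k" and x: "x \<in> cball 0 1" for \<alpha> x
  proof -
    let ?f = "atom k \<alpha> x"
    have m_f: "?f \<in> borel_measurable \<tau>"
      using borel_measurable_atom by (simp add: measurable_cong_sets[OF sets_\<tau> refl])
    have int_f: "integrable \<tau> ?f"
      using AE_dom abs_atom_le[OF _ x, of _ k \<alpha>]
      by (intro integrable_const_bound[of _ "2 ^ k"] m_f) (auto elim: eventually_mono)
    obtain L U where LU: "(L, U) \<in> B" "L \<subseteq> {p. 0 \<le> p \<bullet> (x, 1)}" "{p. 0 \<le> p \<bullet> (x, 1)} \<subseteq> U"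
      "measure \<tau> (U - L) \<le> \<eta> / (4 * 2 ^ k)" using B(3)[of "(x, 1)"] by auto
    have half: "{p :: (real^'d) \<times> real. 0 \<le> p \<bullet> (x, 1)} = {p. 0 \<le> fst p \<bullet> x + snd p}" by (simp add: inner_prod_def)
    have mUL: "U - L \<in> sets \<tau>" using B(2) LU(1) by (auto simp: sets_\<tau>)
    have "\<bar>?f p - g ?f p\<bar> \<le> \<eta> / 2 + 2 * 2 ^ k * indicator (U - L) p" if p: "p \<in> param_dom" for p
    proof -
      define q where "q = rep (key p)"
      have q: "q \<in> param_dom" "key q = key p" using rep[of "key p"] p by (auto simp: q_def KS_def)
      have same: "(p \<in> s) = (q \<in> s)" if "s \<in> G" for s using q(2) that by (auto simp: key_def)
      have LG: "L \<in> G" "U \<in> G" using LU(1) by (force simp: G_def)+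
      obtain z where z: "z \<in> Z" "p \<in> ball z (\<epsilon> / 2)" using Z(2) p by blast
      then have "q \<in> ball z (\<epsilon> / 2)" using same[of "ball z (\<epsilon> / 2)"] by (auto simp: G_def)
      then have pq: "dist p q < \<epsilon>" using z(2) dist_triangle_half_r[of z p \<epsilon> q] by simp
      \<comment> \<open>A cell lies on one side of each bracket set: in \<open>L\<close> both points
        see the polynomial branch, outside \<open>U\<close> both atoms vanish, and in
        \<open>U - L\<close> only the trivial bound is available.\<close>
      consider "p \<in> L" | "p \<notin> U" | "p \<in> U - L" by blast
      then have "\<bar>?f p - ?f q\<bar> \<le> \<eta> / 2 + 2 * 2 ^ k * indicator (U - L) p"
      proof cases
        case 1
        then have "0 \<le> fst p \<bullet> x + snd p" "0 \<le> fst q \<bullet> x + snd q"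
          using same[OF LG(1)] LU(2) unfolding half by auto
        from mod[OF \<alpha> x p q(1) pq this] 1 show ?thesis by simp
      next
        case 2
        then have "\<not> 0 \<le> fst p \<bullet> x + snd p" "\<not> 0 \<le> fst q \<bullet> x + snd q"
          using same[OF LG(2)] LU(3) unfolding half by auto
        then have "?f p = 0" "?f q = 0" by (auto simp: atom_def relu_pow_def)
        then show ?thesis using \<eta> by simp
      next
        case 3
        have "\<bar>?f p - ?f q\<bar> \<le> 2 ^ k + 2 ^ k"
          using abs_atom_le[OF p x, of k \<alpha>] abs_atom_le[OF q(1) x, of k \<alpha>] by linarith
        then show ?thesis using 3 \<eta> by simp
      qed
      then show ?thesis using g_dom[OF p, of ?f] by (simp add: q_def)
    qed
    then have AE: "AE p in \<tau>. \<bar>?f p - g ?f p\<bar> \<le> \<eta> / 2 + 2 * 2 ^ k * indicator (U - L) p"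
      using AE_dom by (auto elim: eventually_mono)
    have int_b: "integrable \<tau> (\<lambda>p. \<eta> / 2 + 2 * 2 ^ k * indicator (U - L) p :: real)"
      using mUL by (intro Bochner_Integration.integrable_add integrable_const integrable_mult_right integrable_real_indicator)
        (auto simp: emeasure_eq_measure)
    have "\<bar>(\<integral>p. ?f p \<partial>\<tau>) - ridge_sum P w k \<alpha> x\<bar> = \<bar>\<integral>p. ?f p - g ?f p \<partial>\<tau>\<bar>"
      using int_f int_g by (simp add: eq_g ridge_sum_atom)
    also have "\<dots> \<le> (\<integral>p. \<bar>?f p - g ?f p\<bar> \<partial>\<tau>)" by (rule integral_abs_bound)
    also have "\<dots> \<le> (\<integral>p. \<eta> / 2 + 2 * 2 ^ k * indicator (U - L) p \<partial>\<tau>)"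
      using int_f int_g int_b AE by (intro integral_mono_AE) auto
    also have "\<dots> = \<eta> / 2 + 2 * 2 ^ k * measure \<tau> (U - L)"
      using mUL prob_space by (subst Bochner_Integration.integral_add) (auto simp: space_\<tau> emeasure_eq_measure intro!: integrable_real_indicator)
    also have "\<dots> \<le> \<eta> / 2 + 2 * 2 ^ k * (\<eta> / (4 * 2 ^ k))"
      using LU(4) by (intro add_left_mono mult_left_mono) auto
    also have "\<dots> = \<eta>" by simp
    finally show ?thesis .
  qed
  ultimately show ?thesis by blast
qed

text \<open>The point measure lives on the space \<open>P\<close>; pushing it forward along the
  identity gives it the Borel sets of the whole space.\<close>

lemma fin_dist_measure:
  fixes P :: "((real^'d::finite) \<times> real) set"
  assumes P: "fin_dist P w"
  shows "\<exists>\<tau>. prob_on_dom \<tau> \<and> emeasure \<tau> (UNIV - P) = 0 \<and>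
    (\<forall>f\<in>borel_measurable borel. (\<integral>p. f p \<partial>\<tau>) = (\<Sum>p\<in>P. w p * f p :: real))"
proof -
  have fP: "finite P" "P \<subseteq> param_dom" "\<And>p. p \<in> P \<Longrightarrow> 0 \<le> w p" "sum w P = 1"
    using P by (auto simp: fin_dist_def less_imp_le)
  define M where "M = point_measure P (\<lambda>p. ennreal (w p))"
  define \<tau> where "\<tau> = distr M borel (\<lambda>p. p)"
  have meas: "(\<lambda>p. p) \<in> measurable M borel" by (simp add: M_def measurable_def space_point_measure sets_point_measure)
  have "emeasure M P = (\<Sum>p\<in>P. ennreal (w p))" unfolding M_def using fP by (subst emeasure_point_measure_finite) auto
  also have "\<dots> = 1" using fP by (simp add: sum_ennreal)
  finally have "prob_space M" by (intro prob_spaceI) (simp add: M_def space_point_measure)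
  then have "prob_space \<tau>" unfolding \<tau>_def using meas by (rule prob_space.prob_space_distr)
  moreover have null: "emeasure \<tau> (UNIV - S) = 0" if "P \<subseteq> S" "S \<in> sets borel" for S
  proof -
    have "emeasure \<tau> (UNIV - S) = emeasure M ((\<lambda>p. p) -` (UNIV - S) \<inter> space M)"
      unfolding \<tau>_def using that meas by (intro emeasure_distr) auto
    also have "(\<lambda>p. p) -` (UNIV - S) \<inter> space M = {}" using that by (auto simp: M_def space_point_measure)
    finally show ?thesis by simp
  qed
  moreover have "sets \<tau> = sets borel" by (simp add: \<tau>_def)
  moreover have "(\<integral>p. f p \<partial>\<tau>) = (\<Sum>p\<in>P. w p * f p)" if "f \<in> borel_measurable borel" for f :: "(real^'d) \<times> real \<Rightarrow> real"
  proof -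
    have "(\<integral>p. f p \<partial>\<tau>) = (\<integral>p. f p \<partial>M)" unfolding \<tau>_def using meas that by (rule integral_distr)
    also have "\<dots> = (\<Sum>p\<in>P. w p * f p)" unfolding M_def using fP by (simp add: lebesgue_integral_point_measure_finite)
    finally show ?thesis .
  qed
  ultimately show ?thesis
    using fP(1,2) borel_closed[OF compact_imp_closed[OF compact_param_dom]]
      borel_closed[OF finite_imp_closed[OF fP(1)]]
    unfolding prob_on_dom_def by (intro exI[of _ \<tau>]) (auto intro!: null)
qed

theorem theorem2:
  fixes k :: nat
  shows "\<exists>C::real. \<forall>(n::nat) (\<tau>::((real^'d::finite) \<times> real) measure).
     n \<ge> 1 \<longrightarrow> prob_on_dom \<tau> \<longrightarrow>
     (\<exists>\<tau>'. prob_on_dom \<tau>' \<and>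
        (\<exists>P. finite P \<and> card P \<le> n \<and> P \<subseteq> param_dom \<and> emeasure \<tau>' (UNIV - P) = 0) \<and>
        (\<forall>\<alpha>::'d \<Rightarrow> nat. mi_order \<alpha> \<le> k \<longrightarrow>
           (\<forall>x \<in> cball (0::real^'d) 1.
              \<bar>(\<integral>wb. atom_deriv k \<alpha> x wb \<partial>\<tau>) - (\<integral>wb. atom_deriv k \<alpha> x wb \<partial>\<tau>')\<bar>
                \<le> C * real n powr (- 1/2 - (2 * (real k - real (mi_order \<alpha>)) + 1) / (2 * real CARD('d))))))"
proof -
  obtain C where C: "C \<ge> 0" and quad: "\<And>(n::nat) (P :: ((real^'d) \<times> real) set) w. 1 \<le> n \<Longrightarrow> fin_dist P w \<Longrightarrow>
    (\<exists>P' w'. fin_dist P' w' \<and> card P' \<le> n \<and>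
      (\<forall>\<alpha> x. mi_order \<alpha> \<le> k \<longrightarrow> x \<in> cball 0 1 \<longrightarrow>
        \<bar>ridge_sum P w k \<alpha> x - ridge_sum P' w' k \<alpha> x\<bar> \<le> C * real n powr (- rate TYPE('d) k \<alpha>)))"
    using finite_quadrature[where 'd = 'd, of k] by blast
  show ?thesis
  proof (intro exI[of _ "fact k * (C + 1)"] allI impI)
    fix n :: nat and \<tau> :: "((real^'d) \<times> real) measure"
    assume n: "1 \<le> n" and \<tau>: "prob_on_dom \<tau>"
    \<comment> \<open>Since every rate is at most k + 1, this accuracy is within the target for all
      \<alpha> at once.\<close>
    define \<eta> where "\<eta> = real n powr (- (real k + 1))"
    have "\<eta> > 0" using n by (simp add: \<eta>_def)
    then obtain P w where P: "fin_dist P w" and err: "\<And>\<alpha> x. mi_order \<alpha> \<le> k \<Longrightarrow> x \<in> cball 0 1 \<Longrightarrow>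
        \<bar>(\<integral>p. atom k \<alpha> x p \<partial>\<tau>) - ridge_sum P w k \<alpha> x\<bar> \<le> \<eta>"
      using finite_approximation[OF \<tau>, of \<eta> k] by blast
    obtain P' w' where P': "fin_dist P' w'" "card P' \<le> n" and err': "\<And>\<alpha> x. mi_order \<alpha> \<le> k \<Longrightarrow> x \<in> cball 0 1 \<Longrightarrow>
        \<bar>ridge_sum P w k \<alpha> x - ridge_sum P' w' k \<alpha> x\<bar> \<le> C * real n powr (- rate TYPE('d) k \<alpha>)"
      using quad[OF n P] by blast
    obtain \<tau>' where \<tau>': "prob_on_dom \<tau>'" "emeasure \<tau>' (UNIV - P') = 0"
      and int': "\<And>f. f \<in> borel_measurable borel \<Longrightarrow> (\<integral>p. f p \<partial>\<tau>') = (\<Sum>p\<in>P'. w' p * f p)"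
      using fin_dist_measure[OF P'(1)] by blast
    have bound: "\<bar>(\<integral>wb. atom_deriv k \<alpha> x wb \<partial>\<tau>) - (\<integral>wb. atom_deriv k \<alpha> x wb \<partial>\<tau>')\<bar>
        \<le> fact k * (C + 1) * real n powr (- 1/2 - (2 * (real k - real (mi_order \<alpha>)) + 1) / (2 * real CARD('d)))"
      if \<alpha>: "mi_order \<alpha> \<le> k" and x: "x \<in> cball 0 1" for \<alpha> :: "'d \<Rightarrow> nat" and x
    proof -
      let ?c = "fact k / fact (k - mi_order \<alpha>) :: real" and ?\<gamma> = "rate TYPE('d) k \<alpha>"
      have c: "0 \<le> ?c" "?c \<le> fact k" using fact_ge_1[of "k - mi_order \<alpha>", where 'a = real] by (auto simp: divide_le_eq)
      have "(\<integral>wb. atom_deriv k \<alpha> x wb \<partial>\<tau>) - (\<integral>wb. atom_deriv k \<alpha> x wb \<partial>\<tau>') =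
          ?c * ((\<integral>p. atom k \<alpha> x p \<partial>\<tau>) - ridge_sum P' w' k \<alpha> x)"
        unfolding atom_deriv_atom using int'[OF borel_measurable_atom]
        by (simp add: ridge_sum_atom right_diff_distrib)
      then have "\<bar>(\<integral>wb. atom_deriv k \<alpha> x wb \<partial>\<tau>) - (\<integral>wb. atom_deriv k \<alpha> x wb \<partial>\<tau>')\<bar> =
          ?c * \<bar>(\<integral>p. atom k \<alpha> x p \<partial>\<tau>) - ridge_sum P' w' k \<alpha> x\<bar>"
        using c by (simp add: abs_mult)
      also have "\<dots> \<le> fact k * ((C + 1) * real n powr (- ?\<gamma>))"
      proof (rule mult_mono)
        have "\<eta> \<le> real n powr (- ?\<gamma>)"
          unfolding \<eta>_def using n rate_bounds(2)[OF \<alpha>] by (intro powr_mono) auto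
        with err[OF \<alpha> x] err'[OF \<alpha> x]
        show "\<bar>(\<integral>p. atom k \<alpha> x p \<partial>\<tau>) - ridge_sum P' w' k \<alpha> x\<bar> \<le> (C + 1) * real n powr (- ?\<gamma>)"
          by (simp add: distrib_right)
      qed (use c in auto)
      also have "- ?\<gamma> = - 1/2 - (2 * (real k - real (mi_order \<alpha>)) + 1) / (2 * real CARD('d))"
        by (simp add: rate_def)
      finally show ?thesis by (simp add: mult.assoc)
    qed
    have "finite P'" "P' \<subseteq> param_dom" using P'(1) by (auto simp: fin_dist_def)
    then show "\<exists>\<tau>'. prob_on_dom \<tau>' \<and>
        (\<exists>P. finite P \<and> card P \<le> n \<and> P \<subseteq> param_dom \<and> emeasure \<tau>' (UNIV - P) = 0) \<and>
        (\<forall>\<alpha>::'d \<Rightarrow> nat. mi_order \<alpha> \<le> k \<longrightarrow>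
           (\<forall>x \<in> cball (0::real^'d) 1.
              \<bar>(\<integral>wb. atom_deriv k \<alpha> x wb \<partial>\<tau>) - (\<integral>wb. atom_deriv k \<alpha> x wb \<partial>\<tau>')\<bar>
                \<le> fact k * (C + 1) * real n powr (- 1/2 - (2 * (real k - real (mi_order \<alpha>)) + 1) / (2 * real CARD('d)))))"
      using \<tau>' P'(2) bound by (intro exI[of _ \<tau>'] conjI exI[of _ P'] allI impI ballI) auto
  qed
qed

end
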